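(* Let $\Omega\subseteq\mathbb{R}^n$ be open and bounded and let $F\colon \mathcal{S}^n\times\Omega\to\overline{\mathbb{R}}$ be elliptic at $0$. Suppose that for all $x_0\in\Omega$ we have $\partial\Theta_+(x_0)=\partial\Theta_-(x_0)\neq\emptyset$ and $$\lim_{t\to 0^+}\ \sup_{x,y\in B_t(x_0)}\operatorname{ex}\Big(\Theta_+^{\frac{|x-y|^2}{t}}(x),\ \Theta_+(y)\Big)=0 .$$ Then the comparison principle holds for the equation $F(\mathcal{H}w,x)=0$ in $\Omega$.
   Context: $\mathcal{S}^n$ is the space of real symmetric $n\times n$ matrices with its usual partial order ($X\le Y$ iff $Y-X$ is positive semidefinite), $|X|$ is the operator norm of $X\in\mathcal{S}^n$ (largest absolute value of an eigenvalue), $\overline{\mathbb{R}}=\mathbb{R}\cup\{-\infty,\infty\}$, $\mathcal{H}w$ is the Hessian matrix of $w$, and $B_t(x_0)$ is the open ball in $\mathbb{R}^n$ ($t$ is taken so small that $B_t(x_0)\subseteq\Omega$). $F$ is elliptic at $0$ if for all $x\in\Omega$ and $X\le Y$ in $\mathcal{S}^n$: $0\le F(X,x)$ implies $0\le F(Y,x)$, and $0<F(X,x)$ implies $0<F(Y,x)$. $\Theta_-(x):=\{X\in\mathcal{S}^n : F(X,x)\le 0\}$ and $\Theta_+(x):=\{X\in\mathcal{S}^n : F(X,x)\ge 0\}$; $\partial$ denotes the topological boundary in $\mathcal{S}^n$. For $\delta\ge0$, $$\Theta_+^\delta(x):=\{X(I-\delta X)^{-1} : F(X,x)\ge 0,\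 \delta|X|<1\}.$$ For sets $\Theta_1,\Theta_2\subseteq\mathcal{S}^n$, the excess is $\operatorname{ex}(\Theta_1,\Theta_2):=\sup_{Z\in\Theta_1}\operatorname{dist}(Z,\Theta_2)$ (equal to $0$ if $\Theta_1=\emptyset$), where $\operatorname{dist}(Z,\Theta):=\inf_{Y\in\Theta}|Z-Y|$ is taken with respect to the operator norm. Viscosity solutions: $v\in USC(\overline\Omega)$ is a viscosity subsolution of $F(\mathcal{H}w,x)=0$ in $\Omega$ if, whenever $x_0\in\Omega$ and $\phi$ is a $C^2$ function near $x_0$ with $\phi(x_0)=v(x_0)$ and $\phi\ge v$ near $x_0$, then $F(\mathcal{H}\phi(x_0),x_0)\ge0$. $u\in LSC(\overline\Omega)$ is a viscosity supersolution if, whenever $\phi$ is $C^2$ near $x_0\in\Omega$ with $\phi(x_0)=u(x_0)$ and $\phi\le u$ near $x_0$, then $F(\mathcal{H}\phi(x_0),x_0)\le0$. ($USC$, $LSC$: real-valued upper/lower semicontinuous functions.) The comparison principle holds for the equation in $\Omega$ if: whenever $v\in USC(\overline\Omega)$ is a viscosity subsolution and $u\in LSC(\overline\Omega)$ is a viscosity supersolution in $\Omega$ with $v\le u$ on $\partial\Omega$, then $v\le u$ in $\Omega$. *)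

theory Defs
  imports "HOL-Analysis.Analysis"
begin

text \<open>
  Symmetric matrices form a subset of \<^typ>\<open>real^'n^'n\<close>. An equation is given by a function
  \<open>F :: real^'n^'n \<Rightarrow> real^'n \<Rightarrow> ereal\<close> of which only the values \<open>F X x\<close> with \<open>X\<close> symmetric
  and \<open>x \<in> \<Omega>\<close> are relevant.
\<close>

definition sym_matrices :: "(real^'n^'n) set" where
  "sym_matrices = {X. transpose X = X}"

text \<open>The order \<open>\<le>\<close> that the library provides on \<^typ>\<open>real^'n^'n\<close> is the entrywise one.\<close>

definition pos_semidef :: "real^'n^'n \<Rightarrow> bool" where
  "pos_semidef X \<longleftrightarrow> X \<in> sym_matrices \<and> (\<forall>v. 0 \<le> v \<bullet> (X *v v))"

definition loewner_le :: "real^'n^'n \<Rightarrow> real^'n^'n \<Rightarrow> bool" where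
  "loewner_le X Y \<longleftrightarrow> pos_semidef (Y - X)"

text \<open>The library's \<^const>\<open>norm\<close> on \<^typ>\<open>real^'n^'n\<close> is the Frobenius norm.\<close>

definition op_norm :: "real^'n^'n \<Rightarrow> real" where
  "op_norm X = onorm (\<lambda>v. X *v v)"

definition elliptic_at_0 :: "(real^'n) set \<Rightarrow> (real^'n^'n \<Rightarrow> real^'n \<Rightarrow> ereal) \<Rightarrow> bool" where
  "elliptic_at_0 \<Omega> F \<longleftrightarrow>
     (\<forall>x\<in>\<Omega>. \<forall>X\<in>sym_matrices. \<forall>Y\<in>sym_matrices. loewner_le X Y \<longrightarrow>
        (0 \<le> F X x \<longrightarrow> 0 \<le> F Y x) \<and> (0 < F X x \<longrightarrow> 0 < F Y x))"

definition Theta_minus :: "(real^'n^'n \<Rightarrow> real^'n \<Rightarrow> ereal) \<Rightarrow> real^'n \<Rightarrow> (real^'n^'n) set" where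
  "Theta_minus F x = {X \<in> sym_matrices. F X x \<le> 0}"

definition Theta_plus :: "(real^'n^'n \<Rightarrow> real^'n \<Rightarrow> ereal) \<Rightarrow> real^'n \<Rightarrow> (real^'n^'n) set" where
  "Theta_plus F x = {X \<in> sym_matrices. F X x \<ge> 0}"

text \<open>If \<open>\<delta> |X| < 1\<close> then \<open>I - \<delta>X\<close> is invertible, so \<^const>\<open>matrix_inv\<close> is the genuine inverse.\<close>

definition Theta_plus_pert ::
  "(real^'n^'n \<Rightarrow> real^'n \<Rightarrow> ereal) \<Rightarrow> real \<Rightarrow> real^'n \<Rightarrow> (real^'n^'n) set" where
  "Theta_plus_pert F \<delta> x =
     {X ** matrix_inv (mat 1 - \<delta> *\<^sub>R X) | X. X \<in> sym_matrices \<and> F X x \<ge> 0 \<and> \<delta> * op_norm X < 1}"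

definition sym_frontier :: "(real^'n^'n) set \<Rightarrow> (real^'n^'n) set" where
  "sym_frontier \<Theta> = (top_of_set sym_matrices) frontier_of \<Theta>"

text \<open>
  Distances and excesses take values in \<open>[0, \<infinity>]\<close>. In \<^typ>\<open>ennreal\<close> the infimum over the empty
  set is \<open>\<infinity>\<close> and the supremum over the empty set is \<open>0\<close>.
\<close>

definition op_dist :: "real^'n^'n \<Rightarrow> (real^'n^'n) set \<Rightarrow> ennreal" where
  "op_dist Z \<Theta> = (INF Y\<in>\<Theta>. ennreal (op_norm (Z - Y)))"

definition excess :: "(real^'n^'n) set \<Rightarrow> (real^'n^'n) set \<Rightarrow> ennreal" where
  "excess \<Theta>\<^sub>1 \<Theta>\<^sub>2 = (SUP Z\<in>\<Theta>\<^sub>1. op_dist Z \<Theta>\<^sub>2)"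

definition usc_on :: "'a::topological_space set \<Rightarrow> ('a \<Rightarrow> real) \<Rightarrow> bool" where
  "usc_on S f \<longleftrightarrow> (\<forall>x\<in>S. \<forall>c. f x < c \<longrightarrow> (\<forall>\<^sub>F y in at x within S. f y < c))"

definition lsc_on :: "'a::topological_space set \<Rightarrow> ('a \<Rightarrow> real) \<Rightarrow> bool" where
  "lsc_on S f \<longleftrightarrow> (\<forall>x\<in>S. \<forall>c. c < f x \<longrightarrow> (\<forall>\<^sub>F y in at x within S. c < f y))"

definition gradient :: "(real^'n \<Rightarrow> real) \<Rightarrow> real^'n \<Rightarrow> real^'n" where
  "gradient f x = (\<chi> i. frechet_derivative f (at x) (axis i 1))"

definition hessian :: "(real^'n \<Rightarrow> real) \<Rightarrow> real^'n \<Rightarrow> real^'n^'n" where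
  "hessian f x = jacobian (gradient f) (at x)"

definition C2_near :: "(real^'n \<Rightarrow> real) \<Rightarrow> real^'n \<Rightarrow> bool" where
  "C2_near f x0 \<longleftrightarrow>
     (\<exists>U. open U \<and> x0 \<in> U \<and>
        (\<forall>x\<in>U. f differentiable (at x)) \<and>
        (\<forall>x\<in>U. gradient f differentiable (at x)) \<and>
        continuous_on U (hessian f))"

text \<open>
  In the following, the values of \<open>v\<close> and \<open>u\<close> outside \<open>closure \<Omega>\<close> are irrelevant when \<open>\<Omega>\<close> is open.
\<close>

definition viscosity_subsolution ::
  "(real^'n) set \<Rightarrow> (real^'n^'n \<Rightarrow> real^'n \<Rightarrow> ereal) \<Rightarrow> (real^'n \<Rightarrow> real) \<Rightarrow> bool" where
  "viscosity_subsolution \<Omega> F v \<longleftrightarrow>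
     usc_on (closure \<Omega>) v \<and>
     (\<forall>x0\<in>\<Omega>. \<forall>\<phi>. C2_near \<phi> x0 \<and> \<phi> x0 = v x0 \<and> (\<forall>\<^sub>F x in nhds x0. \<phi> x \<ge> v x)
        \<longrightarrow> F (hessian \<phi> x0) x0 \<ge> 0)"

definition viscosity_supersolution ::
  "(real^'n) set \<Rightarrow> (real^'n^'n \<Rightarrow> real^'n \<Rightarrow> ereal) \<Rightarrow> (real^'n \<Rightarrow> real) \<Rightarrow> bool" where
  "viscosity_supersolution \<Omega> F u \<longleftrightarrow>
     lsc_on (closure \<Omega>) u \<and>
     (\<forall>x0\<in>\<Omega>. \<forall>\<phi>. C2_near \<phi> x0 \<and> \<phi> x0 = u x0 \<and> (\<forall>\<^sub>F x in nhds x0. \<phi> x \<le> u x)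
        \<longrightarrow> F (hessian \<phi> x0) x0 \<le> 0)"

definition comparison_principle ::
  "(real^'n) set \<Rightarrow> (real^'n^'n \<Rightarrow> real^'n \<Rightarrow> ereal) \<Rightarrow> bool" where
  "comparison_principle \<Omega> F \<longleftrightarrow>
     (\<forall>v u. viscosity_subsolution \<Omega> F v \<and> viscosity_supersolution \<Omega> F u \<and>
            (\<forall>x\<in>frontier \<Omega>. v x \<le> u x)
        \<longrightarrow> (\<forall>x\<in>\<Omega>. v x \<le> u x))"

end

theory Submission
  imports Defs "HOL-Complex_Analysis.Great_Picard"
begin

text \<open>
  Suppose \<open>v - u\<close> has a positive maximum. Subtracting a small multiple of \<open>|y|\<^sup>2\<close>
  from \<open>u\<close> makes it a strict supersolution; the condition \<open>\<partial>\<Theta>\<^sub>+ = \<partial>\<Theta>\<^sub>- \<noteq> \<emptyset>\<close> is what turns this into a gap between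
  \<open>\<Theta>\<^sub>+\<close> and \<open>\<Theta>\<^sub>-\<close>. After doubling the variables, let \<open>w\<^sub>1\<close> and \<open>w\<^sub>2\<close> be the
  sup-convolutions of \<open>v\<close> and of the modified \<open>-u\<close>; both are semiconvex.
  At points where \<open>w\<^sub>1 + w\<^sub>2\<close> has a second order expansion and a maximum after adding a small
  linear term one gets jets with matrices \<open>H\<^sub>1\<close>, \<open>H\<^sub>2\<close>, where \<open>H\<^sub>1 + H\<^sub>2\<close> is nearly negative
  semidefinite. Undoing the sup-convolution turns \<open>H\<^sub>1\<close> into \<open>Y = H\<^sub>1 (I + \<delta> H\<^sub>1)\<inverse> \<in> \<Theta>\<^sub>+(x)\<close>, so that
  \<open>H\<^sub>1 = Y (I - \<delta> Y)\<inverse>\<close> lies in the perturbed set and, by the excess condition, close to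
  \<open>\<Theta>\<^sub>+(y)\<close>, while \<open>-H\<^sub>2\<close> lies in \<open>\<Theta>\<^sub>-(y)\<close> with a gap.

  Aleksandrov's theorem is avoided as follows. The lower envelope \<open>f\<close> of the paraboloids
  dominating \<open>w\<^sub>1\<close> has bounded second differences. The \<open>L\<^sup>2\<close> norms of its dyadic
  second difference quotients increase up to boundary errors, which forces the scaled third differences
  to tend to \<open>0\<close> almost everywhere; there, blow-ups of \<open>f\<close> converge along subsequences to
  functions with vanishing third differences, that is, to quadratic forms. Closeness to
  a quadratic form at one small scale is enough, because a paraboloid that nearly touches can be
  moved into touching position nearby.
\<close>

section \<open>Vanishing third differences\<close>

lemma inner_sym_matrix:
  assumes "X \<in> sym_matrices"
  shows "u \<bullet> (X *v v) = v \<bullet> (X *v u)"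
proof -
  have "transpose X = X" using assms by (simp add: sym_matrices_def)
  then show ?thesis by (metis dot_lmul_matrix inner_commute transpose_matrix_vector)
qed

lemma sym_matrices_add: "X \<in> sym_matrices \<Longrightarrow> Y \<in> sym_matrices \<Longrightarrow> X + Y \<in> sym_matrices"
  by (simp add: sym_matrices_def transpose_def vec_eq_iff)

lemma sym_matrices_minus: "X \<in> sym_matrices \<Longrightarrow> Y \<in> sym_matrices \<Longrightarrow> X - Y \<in> sym_matrices"
  by (simp add: sym_matrices_def transpose_def vec_eq_iff)

lemma sym_matrices_scaled_id: "r *\<^sub>R mat 1 \<in> sym_matrices"
  by (simp add: sym_matrices_def transpose_def vec_eq_iff mat_def eq_commute)

definition third_diff :: "('a::real_vector \<Rightarrow> real) \<Rightarrow> 'a \<Rightarrow> 'a \<Rightarrow> real" where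
  "third_diff f x s = f (x + 3 *\<^sub>R s) - 3 * f (x + 2 *\<^sub>R s) + 3 * f (x + s) - f x"

text \<open>A vanishing third difference is a linear recurrence of order three along the
  progression, so the first three values determine the rest. The right-hand side is their Newton
  interpolation polynomial.\<close>

lemma quadratic_along_progression:
  fixes g :: "'a::real_vector \<Rightarrow> real"
  assumes "\<And>y. third_diff g y s = 0"
  shows "g (x + real m *\<^sub>R s) = g x + real m * (g (x + s) - g x - (g (x + 2 *\<^sub>R s) - 2 * g (x + s) + g x) / 2)
    + (real m)\<^sup>2 * ((g (x + 2 *\<^sub>R s) - 2 * g (x + s) + g x) / 2)"
proof -
  define P where "P m \<longleftrightarrow> g (x + real m *\<^sub>R s) = g x + real m * (g (x + s) - g x - (g (x + 2 *\<^sub>R s) - 2 * g (x + s) + g x) / 2)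
    + (real m)\<^sup>2 * ((g (x + 2 *\<^sub>R s) - 2 * g (x + s) + g x) / 2)" for m :: nat
  \<comment> \<open>The recurrence reaches back three steps, hence three consecutive values are
    carried through the induction.\<close>
  have "P m \<and> P (m + 1) \<and> P (m + 2)"
  proof (induction m)
    case 0
    show ?case by (simp add: P_def field_simps power2_eq_square)
  next
    case (Suc m)
    have "g (x + real (m + 3) *\<^sub>R s) = 3 * g (x + real (m + 2) *\<^sub>R s) - 3 * g (x + real (m + 1) *\<^sub>R s) + g (x + real m *\<^sub>R s)"
      using assms[of "x + real m *\<^sub>R s"] unfolding third_diff_def
      by (simp add: algebra_simps)
    with Suc have "P (m + 3)"
      unfolding P_def by (simp add: field_simps power2_eq_square)
    with Suc show ?case by (simp add: numeral_3_eq_3)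
  qed
  then show ?thesis unfolding P_def by blast
qed

lemma eq_0_if_multiples_bounded:
  fixes a :: real
  assumes "\<And>n. \<bar>a\<bar> * real (Suc n) \<le> K"
  shows "a = 0"
proof (rule ccontr)
  assume "a \<noteq> 0"
  then obtain n where n: "K < real n * \<bar>a\<bar>"
    using reals_Archimedean3[of "\<bar>a\<bar>"] by auto
  also have "\<dots> \<le> \<bar>a\<bar> * real (Suc n)" by (simp add: algebra_simps)
  finally show False using assms[of n] by linarith
qed

text \<open>Cauchy's functional equation. For every natural \<open>N\<close> the number
  \<open>N * r\<close> is an integer plus a remainder in \<open>[0, 1]\<close>; since
  \<open>\<phi>\<close> is linear on integers and bounded on remainders, \<open>N\<close> times the
  deviation from linearity stays bounded.\<close>

lemma additive_bounded_imp_linear: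
  fixes \<phi> :: "real \<Rightarrow> real"
  assumes add: "\<And>r t. \<phi> (r + t) = \<phi> r + \<phi> t" and bdd: "\<And>r. \<bar>r\<bar> \<le> 1 \<Longrightarrow> \<bar>\<phi> r\<bar> \<le> M"
  shows "\<phi> r = r * \<phi> 1"
proof -
  have zero: "\<phi> 0 = 0" using add[of 0 0] by simp
  have neg: "\<phi> (- t) = - \<phi> t" for t using add[of t "-t"] zero by simp
  have nat: "\<phi> (real n * t) = real n * \<phi> t" for n t
    by (induction n) (auto simp: zero add algebra_simps)
  have int: "\<phi> (of_int k * t) = of_int k * \<phi> t" for k :: int and t
    by (cases k rule: int_cases2) (auto simp: nat neg)
  have "\<bar>\<phi> r - r * \<phi> 1\<bar> * real (Suc n) \<le> M + \<bar>\<phi> 1\<bar>" for n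
  proof -
    define N where "N = real (Suc n)"
    have N: "N > 0" by (simp add: N_def)
    define d where "d = N * r - of_int \<lfloor>N * r\<rfloor>"
    have d: "0 \<le> d" "d \<le> 1" unfolding d_def by linarith+
    have "N * \<phi> r = \<phi> (N * r)" using nat[of "Suc n" r] by (simp add: N_def)
    also have "\<dots> = \<phi> (of_int \<lfloor>N * r\<rfloor> * 1 + d)" by (simp add: d_def)
    also have "\<dots> = of_int \<lfloor>N * r\<rfloor> * \<phi> 1 + \<phi> d" unfolding add int by simp
    finally have "N * (\<phi> r - r * \<phi> 1) = \<phi> d - d * \<phi> 1" by (simp add: d_def algebra_simps)
    then have "\<bar>\<phi> r - r * \<phi> 1\<bar> * N = \<bar>\<phi> d - d * \<phi> 1\<bar>" using N by (metis abs_mult abs_of_pos mult.commute)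
    also have "\<dots> \<le> \<bar>\<phi> d\<bar> + \<bar>d * \<phi> 1\<bar>" by linarith
    also have "\<dots> \<le> M + \<bar>\<phi> 1\<bar>"
      using bdd[of d] d by (auto simp: abs_mult intro!: add_mono mult_left_le_one_le)
    finally show ?thesis by (simp add: N_def)
  qed
  then have "\<phi> r - r * \<phi> 1 = 0" by (rule eq_0_if_multiples_bounded)
  then show ?thesis by simp
qed

text \<open>Along each ray from the origin \<open>g\<close> is a quadratic polynomial, and the
  quadratic bound forces its linear coefficient to vanish. Looking at \<open>x + N s\<close> for
  large \<open>N\<close> then shows that the second difference in direction \<open>s\<close> is
  \<open>2 * g s\<close> at every base point.\<close>

lemma parallelogram_if_third_diff_0:
  fixes g :: "'a::real_normed_vector \<Rightarrow> real"
  assumes cont: "continuous_on UNIV g" and C: "\<And>h. \<bar>g h\<bar> \<le> C * (norm h)\<^sup>2"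
    and td: "\<And>x s. third_diff g x s = 0"
  shows "g (x + s) + g (x - s) = 2 * g x + 2 * g s"
proof -
  have g0: "g 0 = 0" using C[of 0] by simp
  have hom: "g (real m *\<^sub>R s) = (real m)\<^sup>2 * g s" for m s
  proof -
    define \<alpha> where "\<alpha> s = g s - (g (2 *\<^sub>R s) - 2 * g s) / 2" for s
    define \<beta> where "\<beta> s = (g (2 *\<^sub>R s) - 2 * g s) / 2" for s
    have q: "g (real m *\<^sub>R s) = real m * \<alpha> s + (real m)\<^sup>2 * \<beta> s" for m s
      using quadratic_along_progression[OF td, of 0 m s] by (simp add: g0 \<alpha>_def \<beta>_def)
    \<comment> \<open>Dividing \<open>s\<close> into \<open>N\<close> equal parts \<open>t\<close>
      divides the linear coefficient by \<open>N\<close> and the quadratic one by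
      \<open>N\<^sup>2\<close>; the bound on \<open>g t\<close> is of the order of the latter, so
      \<open>\<alpha> s * N\<close> stays bounded.\<close>
    have "\<bar>\<alpha> s\<bar> * real (Suc n) \<le> C * (norm s)\<^sup>2 + \<bar>\<beta> s\<bar>" for n
    proof -
      define N where "N = real (Suc n)"
      have N: "N \<ge> 1" by (simp add: N_def)
      define t where "t = (1 / N) *\<^sub>R s"
      have s: "s = N *\<^sub>R t" using N by (simp add: t_def)
      have 1: "g s = N * \<alpha> t + N\<^sup>2 * \<beta> t" using q[of "Suc n" t] unfolding N_def[symmetric] s by simp
      have 2: "g (2 *\<^sub>R s) = 2 * N * \<alpha> t + 4 * N\<^sup>2 * \<beta> t"
        using q[of "2 * Suc n" t] unfolding s N_def by (simp add: algebra_simps power2_eq_square)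
      have b: "\<beta> s = N\<^sup>2 * \<beta> t" and a: "\<alpha> s = N * \<alpha> t"
        unfolding \<beta>_def[of s] \<alpha>_def[of s] 1 2 by (simp_all add: algebra_simps)
      have "g t = \<alpha> t + \<beta> t" by (simp add: \<alpha>_def \<beta>_def)
      then have "\<alpha> s * N = N\<^sup>2 * g t - \<beta> s" unfolding a b by (simp only:) (simp add: algebra_simps power2_eq_square)
      then have "\<bar>\<alpha> s\<bar> * N \<le> N\<^sup>2 * \<bar>g t\<bar> + \<bar>\<beta> s\<bar>"
        using N abs_mult[of "\<alpha> s" N] abs_mult[of "N\<^sup>2" "g t"] by auto
      also have "N\<^sup>2 * \<bar>g t\<bar> \<le> N\<^sup>2 * (C * (norm t)\<^sup>2)" by (intro mult_left_mono C) auto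
      also have "\<dots> = C * (norm s)\<^sup>2" unfolding s using N by (simp add: power_mult_distrib)
      finally show ?thesis by (simp add: N_def)
    qed
    then have "\<alpha> s = 0" by (rule eq_0_if_multiples_bounded)
    then show ?thesis unfolding q by (simp add: \<alpha>_def \<beta>_def field_simps)
  qed
  have second: "(g (x + 2 *\<^sub>R s) - 2 * g (x + s) + g x) / 2 = g s" for x s
  proof -
    define c where "c = (g (x + 2 *\<^sub>R s) - 2 * g (x + s) + g x) / 2"
    define b where "b = g (x + s) - g x - c"
    \<comment> \<open>\<open>g (x + N s)\<close> is computed by homogeneity of degree two and by
      interpolation. After division by \<open>N\<^sup>2\<close> only \<open>c\<close> survives in
      the limit, and continuity of \<open>g\<close> at \<open>s\<close> identifies it.\<close>
    have ev: "g ((1 / real (Suc m)) *\<^sub>R x + s) = g x * (1 / real (Suc m)) * (1 / real (Suc m)) + b * (1 / real (Suc m)) + c" for m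
    proof -
      define N where "N = real (Suc m)"
      have N: "N > 0" by (simp add: N_def)
      have "N\<^sup>2 * g ((1 / N) *\<^sub>R x + s) = g (N *\<^sub>R ((1 / N) *\<^sub>R x + s))" using hom[of "Suc m"] by (simp add: N_def)
      also have "\<dots> = g (x + N *\<^sub>R s)" using N by (simp add: algebra_simps)
      also have "\<dots> = g x + N * b + N\<^sup>2 * c"
        using quadratic_along_progression[OF td, of x "Suc m" s] by (simp only: b_def c_def N_def)
      finally show ?thesis using N unfolding N_def[symmetric] by (simp add: field_simps power2_eq_square)
    qed
    have lim0: "(\<lambda>m. 1 / real (Suc m)) \<longlonglongrightarrow> 0" using LIMSEQ_inverse_real_of_nat by (simp add: inverse_eq_divide)
    have "(\<lambda>m. (1 / real (Suc m)) *\<^sub>R x + s) \<longlonglongrightarrow> 0 *\<^sub>R x + s"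
      by (intro tendsto_intros lim0)
    then have l1: "(\<lambda>m. g ((1 / real (Suc m)) *\<^sub>R x + s)) \<longlonglongrightarrow> g s"
      using continuous_on_tendsto_compose[OF cont] by fastforce
    have l2: "(\<lambda>m. g x * (1 / real (Suc m)) * (1 / real (Suc m)) + b * (1 / real (Suc m)) + c) \<longlonglongrightarrow> g x * 0 * 0 + b * 0 + c"
      by (intro tendsto_intros lim0)
    from LIMSEQ_unique[OF l1] l2 show ?thesis unfolding ev c_def[symmetric] by fastforce
  qed
  have e: "x - s + 2 *\<^sub>R s = x + s" by (simp add: scaleR_2)
  show ?thesis using second[of "x - s" s] unfolding e by simp
qed

text \<open>The Jordan-von Neumann argument: polarisation turns the parallelogram identity into a
  symmetric biadditive form, and boundedness on segments upgrades additivity to real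
  homogeneity.\<close>

lemma quadratic_form_if_third_diff_0:
  fixes g :: "real^'n \<Rightarrow> real"
  assumes cont: "continuous_on UNIV g" and C: "\<And>h. \<bar>g h\<bar> \<le> C * (norm h)\<^sup>2"
    and td: "\<And>x s. third_diff g x s = 0"
  obtains X where "X \<in> sym_matrices" "\<And>h. g h = h \<bullet> (X *v h) / 2"
proof -
  note par = parallelogram_if_third_diff_0[OF assms]
  define b where "b x y = (g (x + y) - g x - g y) / 2" for x y
  have sym: "b x y = b y x" for x y by (simp add: b_def add.commute)
  have add: "b (x + z) y = b x y + b z y" for x y z
  proof -
    have "g (x + y + z) + g (x + y - z) = 2 * g (x + y) + 2 * g z" by (rule par)
    moreover have "g (x + y + z) + g (x + z - y) = 2 * g (x + z) + 2 * g y"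
      using par[of "x + z" y] by (simp add: algebra_simps)
    moreover have "g (x + z - y) + g (x + y - z) = 2 * g x + 2 * g (z - y)"
      using par[of x "z - y"] by (simp add: algebra_simps)
    moreover have "g (z + y) + g (z - y) = 2 * g z + 2 * g y" by (rule par)
    ultimately show ?thesis unfolding b_def by (simp add: field_simps)
  qed
  have C0: "0 \<le> C"
  proof -
    obtain u :: "real^'n" where "norm u = 1" using vector_choose_size[of 1] by auto
    then show ?thesis using C[of u] by simp
  qed
  have scale: "b (r *\<^sub>R x) y = r * b x y" for r x y
  proof -
    define M where "M = C * (norm x + norm y)\<^sup>2 + C * (norm x)\<^sup>2 + C * (norm y)\<^sup>2"
    have "b (r *\<^sub>R x) y = r * b (1 *\<^sub>R x) y"
    proof (rule additive_bounded_imp_linear[where M = M])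
      show "b ((r + t) *\<^sub>R x) y = b (r *\<^sub>R x) y + b (t *\<^sub>R x) y" for r t
        by (simp add: scaleR_add_left add)
      fix r :: real assume r: "\<bar>r\<bar> \<le> 1"
      have nr: "norm (r *\<^sub>R x) \<le> norm x" using r by (simp add: mult_left_le_one_le)
      have "norm (r *\<^sub>R x + y) \<le> norm x + norm y" using norm_triangle_ineq[of "r *\<^sub>R x" y] nr by linarith
      then have "\<bar>g (r *\<^sub>R x + y)\<bar> \<le> C * (norm x + norm y)\<^sup>2"
        using C[of "r *\<^sub>R x + y"] C0 by (meson mult_left_mono norm_ge_zero order.trans power_mono)
      moreover have "\<bar>g (r *\<^sub>R x)\<bar> \<le> C * (norm x)\<^sup>2"
        using C[of "r *\<^sub>R x"] C0 nr by (meson mult_left_mono norm_ge_zero order.trans power_mono)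
      moreover have "\<bar>g y\<bar> \<le> C * (norm y)\<^sup>2" by (rule C)
      moreover have "\<bar>(u - v - w) / 2\<bar> \<le> U + V + W" if "\<bar>u\<bar> \<le> U" "\<bar>v\<bar> \<le> V" "\<bar>w\<bar> \<le> W" for u v w U V W :: real
      proof -
        have "\<bar>u - v - w\<bar> \<le> U + V + W" "0 \<le> U + V + W" using that by linarith+
        then show ?thesis by simp
      qed
      ultimately show "\<bar>b (r *\<^sub>R x) y\<bar> \<le> M"
        unfolding b_def M_def by blast
    qed
    then show ?thesis by simp
  qed
  have linb: "linear (\<lambda>x. b x y)" for y
    by (rule linearI) (auto simp: add scale)
  have expand: "b x y = (\<Sum>i\<in>UNIV. x $ i * b (axis i 1) y)" for x y
  proof -
    have "b x y = b (\<Sum>i\<in>UNIV. x $ i *\<^sub>R axis i 1) y" using basis_expansion[of x] by (simp add: scalar_mult_eq_scaleR)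
    also have "\<dots> = (\<Sum>i\<in>UNIV. b (x $ i *\<^sub>R axis i 1) y)"
      by (rule linear_sum[OF linb])
    finally show ?thesis by (simp add: scale)
  qed
  \<comment> \<open>The factor 2 makes \<open>X\<close> the Hessian of \<open>g\<close>, in
    agreement with the division by 2 in the conclusion.\<close>
  define X :: "real^'n^'n" where "X = (\<chi> i j. 2 * b (axis i 1) (axis j 1))"
  have Xv: "(X *v y) $ i = 2 * b (axis i 1) y" for y i
  proof -
    have "(X *v y) $ i = (\<Sum>j\<in>UNIV. 2 * b (axis i 1) (axis j 1) * y $ j)"
      by (simp add: X_def matrix_vector_mult_def)
    also have "\<dots> = 2 * (\<Sum>j\<in>UNIV. y $ j * b (axis j 1) (axis i 1))"
      by (simp add: sum_distrib_left sym algebra_simps)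
    finally show ?thesis using expand[of y "axis i 1"] sym by simp
  qed
  have bb: "g h = b h h" for h
    using par[of h h] C[of 0] by (simp add: b_def)
  show ?thesis
  proof
    show "X \<in> sym_matrices"
      by (simp add: sym_matrices_def X_def transpose_def vec_eq_iff sym)
    fix h
    have "h \<bullet> (X *v h) = (\<Sum>i\<in>UNIV. h $ i * (2 * b (axis i 1) h))"
      by (simp add: inner_vec_def Xv)
    also have "\<dots> = 2 * b h h" using expand[of h h] by (simp add: sum_distrib_left algebra_simps)
    finally show "g h = h \<bullet> (X *v h) / 2" by (simp add: bb)
  qed
qed

section \<open>Compactness of functions with bounded second differences\<close>

lemma lipschitz_if_second_diff_bounded:
  fixes g :: "'a::real_normed_vector \<Rightarrow> real"
  assumes c: "\<And>x h. \<bar>g (x + h) + g (x - h) - 2 * g x\<bar> \<le> c * (norm h)\<^sup>2" and c0: "0 \<le> c"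
    and M: "\<And>y. norm y \<le> R + 1 \<Longrightarrow> \<bar>g y\<bar> \<le> M"
    and x: "norm x \<le> R" "norm y \<le> R"
  shows "\<bar>g y - g x\<bar> \<le> (4 * M + c) * norm (y - x)"
proof -
  have M0: "0 \<le> M" using M[of x] x by linarith
  \<comment> \<open>Passing from \<open>2h\<close> to \<open>h\<close> halves the increment of
    \<open>g\<close> up to an error \<open>c * (norm h)\<^sup>2 / 2\<close>. The increment is
    doubled until it has unit size, where the bound \<open>2 * M\<close> applies; this is why
    \<open>M\<close> has to bound \<open>g\<close> on the ball of radius
    \<open>R + 1\<close>.\<close>
  have dyadic: "\<bar>g (x + h) - g x\<bar> \<le> 2 * M * (1/2)^m + c * ((2^m - 1) / 2) * (norm h)\<^sup>2"
    if "norm h \<le> (1/2)^m" for m h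
    using that
  proof (induction m arbitrary: h)
    case 0
    have "norm (x + h) \<le> R + 1" using 0 x norm_triangle_ineq[of x h] by simp
    then show ?case using M[of "x + h"] M[of x] x by simp
  next
    case (Suc m)
    have "\<bar>g (x + 2 *\<^sub>R h) - g x\<bar> \<le> 2 * M * (1/2)^m + c * ((2^m - 1) / 2) * (norm (2 *\<^sub>R h))\<^sup>2"
      using Suc.prems by (intro Suc.IH) simp
    moreover have "\<bar>g (x + 2 *\<^sub>R h) + g x - 2 * g (x + h)\<bar> \<le> c * (norm h)\<^sup>2"
      using c[of "x + h" h] by (simp add: scaleR_2 add.assoc)
    moreover have "\<bar>g (x + h) - g x\<bar> \<le> A / 2 + B / 2"
      if "\<bar>g (x + 2 *\<^sub>R h) - g x\<bar> \<le> A" "\<bar>g (x + 2 *\<^sub>R h) + g x - 2 * g (x + h)\<bar> \<le> B" for A B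
      using that by linarith
    ultimately have "\<bar>g (x + h) - g x\<bar> \<le> (2 * M * (1/2)^m + c * ((2^m - 1) / 2) * (norm (2 *\<^sub>R h))\<^sup>2) / 2 + c * (norm h)\<^sup>2 / 2"
      by blast
    also have "\<dots> = 2 * M * (1/2)^Suc m + c * ((2^Suc m - 1) / 2) * (norm h)\<^sup>2"
      by (simp add: power2_eq_square field_simps)
    finally show ?case .
  qed
  define h where "h = y - x"
  show ?thesis
  proof (cases "h = 0")
    case False
    show ?thesis
    proof (cases "norm h \<le> 1")
      case True
      have "\<exists>m. (1/2)^Suc m < norm h"
      proof -
        obtain n where "(1/2)^n < norm h" using real_arch_pow_inv[of "norm h" "1/2"] False by auto
        then have "(1/2)^Suc n < norm h"
          by (rule le_less_trans[rotated]) simp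
        then show ?thesis ..
      qed
      \<comment> \<open>The dyadic scale of \<open>h\<close>: \<open>norm h \<le> (1/2)^m\<close>
        permits the estimate above, and \<open>(1/2)^Suc m < norm h\<close> bounds its first term by
        a multiple of \<open>norm h\<close>.\<close>
      define m where "m = (LEAST m. (1/2)^Suc m < norm h)"
      have m: "(1/2)^Suc m < norm h" unfolding m_def by (rule LeastI_ex) fact
      have m': "norm h \<le> (1/2)^m"
      proof (cases m)
        case 0 with True show ?thesis by simp
      next
        case (Suc j)
        then show ?thesis using not_less_Least[of j "\<lambda>m. (1/2)^Suc m < norm h"] by (simp add: m_def)
      qed
      have "\<bar>g (x + h) - g x\<bar> \<le> 2 * M * (1/2)^m + c * ((2^m - 1) / 2) * (norm h)\<^sup>2"
        by (rule dyadic[OF m'])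
      also have "2 * M * (1/2)^m \<le> 2 * M * (2 * norm h)" using m M0 by (intro mult_left_mono) auto
      also have "c * ((2^m - 1) / 2) * (norm h)\<^sup>2 \<le> c * norm h"
      proof -
        have "2^m * norm h \<le> 2^m * (1/2)^m" using m' by (intro mult_left_mono) auto
        also have "\<dots> = (1::real)" by (simp add: power_mult_distrib[symmetric])
        finally have A: "2^m * norm h \<le> 1" .
        have "(2^m - 1) / 2 * norm h = (2^m * norm h - norm h) / 2" by (simp add: field_simps)
        also have "\<dots> \<le> 1"
        proof -
          have "2^m * norm h - norm h \<le> 2" using A norm_ge_zero[of h] by linarith
          then show ?thesis by simp
        qed
        finally have "(2^m - 1) / 2 * norm h \<le> 1" .
        then have "c * norm h * ((2^m - 1) / 2 * norm h) \<le> c * norm h * 1"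
          using c0 by (intro mult_left_mono) auto
        then show ?thesis by (simp add: power2_eq_square algebra_simps)
      qed
      finally show ?thesis by (simp add: h_def algebra_simps)
    next
      case False
      have "\<bar>g y - g x\<bar> \<le> 2 * M" using M[of x] M[of y] x by auto
      also have "\<dots> \<le> 2 * M * norm h" using False M0 by (simp add: mult_le_cancel_left1)
      also have "\<dots> \<le> (4 * M + c) * norm h" using M0 c0 by (intro mult_right_mono) auto
      finally show ?thesis by (simp add: h_def)
    qed
  qed (simp add: h_def)
qed

text \<open>An Arzela-Ascoli argument. Bounded second differences make the \<open>G k\<close>
  equi-Lipschitz on balls, so convergence of a diagonal subsequence on \<open>D\<close> extends to
  all points, uniformly on the unit ball. The limit has no third differences, hence is a quadratic
  form.\<close>

lemma subsequence_tendsto_quadratic_form: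
  fixes G :: "nat \<Rightarrow> real^'n \<Rightarrow> real"
  assumes c: "\<And>k x h. \<bar>G k (x + h) + G k (x - h) - 2 * G k x\<bar> \<le> c * (norm h)\<^sup>2"
    and C: "\<And>k h. \<bar>G k h\<bar> \<le> C * (norm h)\<^sup>2" and c0: "0 \<le> c" "0 \<le> C"
    and D: "countable D" "closure D = UNIV"
    and td: "\<And>\<eta> \<xi>. \<eta> \<in> D \<Longrightarrow> \<xi> \<in> D \<Longrightarrow> (\<lambda>k. third_diff (G k) \<eta> \<xi>) \<longlonglongrightarrow> 0"
  obtains \<sigma> X where "strict_mono (\<sigma> :: nat \<Rightarrow> nat)" "X \<in> sym_matrices"
    "\<And>e. 0 < e \<Longrightarrow> \<forall>\<^sub>F n in sequentially. \<forall>h. norm h \<le> 1 \<longrightarrow> \<bar>G (\<sigma> n) h - h \<bullet> (X *v h) / 2\<bar> \<le> e"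
proof -
  define L where "L R = 4 * (C * (R + 1)\<^sup>2) + c" for R
  have L0: "0 \<le> L R" for R using c0 by (simp add: L_def)
  have lip: "\<bar>G k y - G k x\<bar> \<le> L R * norm (y - x)" if "norm x \<le> R" "norm y \<le> R" for k x y R
    unfolding L_def
  proof (rule lipschitz_if_second_diff_bounded[OF c c0(1) _ that])
    fix y :: "real^'n" assume "norm y \<le> R + 1"
    then show "\<bar>G k y\<bar> \<le> C * (R + 1)\<^sup>2"
      using C[of k y] c0(2) by (meson mult_left_mono norm_ge_zero order.trans power_mono)
  qed
  have pos: "0 < 1 + (norm h)\<^sup>2" for h :: "real^'n" by (smt (verit) zero_le_power2)
  \<comment> \<open>The diagonal subsequence is extracted from functions with one bound for all
    points; the weight provides it and is removed again once the limits on \<open>D\<close>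
    exist.\<close>
  have "norm (G n h / (1 + (norm h)\<^sup>2)) \<le> C" for n h
  proof -
    have "\<bar>G n h\<bar> \<le> C * (1 + (norm h)\<^sup>2)" using C[of n h] c0 by (simp add: algebra_simps)
    then show ?thesis using pos[of h] by (simp add: divide_le_eq abs_of_pos)
  qed
  then obtain \<sigma> where \<sigma>: "strict_mono (\<sigma> :: nat \<Rightarrow> nat)"
    and conv: "\<And>h. h \<in> D \<Longrightarrow> \<exists>l. (\<lambda>n. G (\<sigma> n) h / (1 + (norm h)\<^sup>2)) \<longlonglongrightarrow> l"
    using function_convergent_subsequence[OF D(1), of "\<lambda>n h. G n h / (1 + (norm h)\<^sup>2)" C] by metis
  have near: "\<exists>d\<in>D. norm (d - h) < e" if "0 < e" for h e
  proof -
    have "h \<in> closure D" using D by simp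
    then show ?thesis using that by (auto simp: closure_approachable dist_norm)
  qed
  have convD: "convergent (\<lambda>n. G (\<sigma> n) h)" if hD: "h \<in> D" for h
  proof -
    obtain l where "(\<lambda>n. G (\<sigma> n) h / (1 + (norm h)\<^sup>2)) \<longlonglongrightarrow> l" using conv[OF hD] by blast
    then have "(\<lambda>n. (1 + (norm h)\<^sup>2) * (G (\<sigma> n) h / (1 + (norm h)\<^sup>2))) \<longlonglongrightarrow> (1 + (norm h)\<^sup>2) * l"
      by (intro tendsto_intros)
    moreover have "(1 + (norm h)\<^sup>2) * (G (\<sigma> n) h / (1 + (norm h)\<^sup>2)) = G (\<sigma> n) h" for n
      using pos[of h] by simp
    ultimately show ?thesis by (auto simp: convergent_def)
  qed
  have "convergent (\<lambda>n. G (\<sigma> n) h)" for h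
  proof (rule Cauchy_convergent, rule CauchyI)
    fix e :: real assume e: "0 < e"
    define R where "R = norm h + 1"
    define K where "K = L R + 1"
    have K: "0 < K" using L0[of R] by (simp add: K_def)
    obtain d where d: "d \<in> D" "norm (d - h) < min 1 (e / (3 * K))" using near[of "min 1 (e / (3 * K))" h] e K by auto
    have dR: "norm d \<le> R" "norm h \<le> R" using d norm_triangle_ineq2[of d h] by (auto simp: R_def)
    have close: "\<bar>G k d - G k h\<bar> < e / 3" for k
    proof -
      have "\<bar>G k d - G k h\<bar> \<le> L R * norm (d - h)" by (rule lip[OF dR(2,1)])
      also have "\<dots> \<le> K * norm (d - h)" by (intro mult_right_mono) (auto simp: K_def)
      also have "\<dots> < K * (e / (3 * K))" using d K by (intro mult_strict_left_mono) auto
      finally show ?thesis using K by simp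
    qed
    have "Cauchy (\<lambda>n. G (\<sigma> n) d)" using convD[OF d(1)] convergent_Cauchy by blast
    then obtain N where "\<forall>m\<ge>N. \<forall>n\<ge>N. norm (G (\<sigma> m) d - G (\<sigma> n) d) < e / 3"
      using e CauchyD[of _ "e/3"] by (metis divide_pos_pos zero_less_numeral)
    then have "norm (G (\<sigma> m) h - G (\<sigma> n) h) < e" if "m \<ge> N" "n \<ge> N" for m n
      proof -
      have "\<bar>G (\<sigma> m) d - G (\<sigma> n) d\<bar> < e / 3"
        using \<open>\<forall>m\<ge>N. \<forall>n\<ge>N. norm (G (\<sigma> m) d - G (\<sigma> n) d) < e / 3\<close> that by simp
      then show ?thesis using close[of "\<sigma> m"] close[of "\<sigma> n"] unfolding real_norm_def by linarith
    qed
    then show "\<exists>N. \<forall>m\<ge>N. \<forall>n\<ge>N. norm (G (\<sigma> m) h - G (\<sigma> n) h) < e" by blast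
  qed
  then obtain g where g: "(\<lambda>n. G (\<sigma> n) h) \<longlonglongrightarrow> g h" for h
    unfolding convergent_def by metis
  have glip: "\<bar>g y - g x\<bar> \<le> L R * norm (y - x)" if "norm x \<le> R" "norm y \<le> R" for x y R
  proof (rule LIMSEQ_le_const2)
    show "(\<lambda>n. \<bar>G (\<sigma> n) y - G (\<sigma> n) x\<bar>) \<longlonglongrightarrow> \<bar>g y - g x\<bar>" by (intro tendsto_intros g)
  qed (use lip[OF that] in auto)
  have "isCont g x" for x
  proof -
    have "(L (norm x + 1))-lipschitz_on (cball 0 (norm x + 1)) g"
      by (rule lipschitz_onI) (auto simp: dist_real_def dist_norm L0 intro: glip)
    then have "continuous_on (cball 0 (norm x + 1)) g" by (rule lipschitz_on_continuous_on)
    then show ?thesis by (rule continuous_on_interior) simp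
  qed
  then have gcont: "continuous_on UNIV g" by (simp add: continuous_at_imp_continuous_on)
  have gC: "\<bar>g h\<bar> \<le> C * (norm h)\<^sup>2" for h
    by (rule LIMSEQ_le_const2[of "\<lambda>n. \<bar>G (\<sigma> n) h\<bar>"]) (use C in \<open>auto intro!: tendsto_intros g\<close>)
  have tdD: "third_diff g \<eta> \<xi> = 0" if "\<eta> \<in> D" "\<xi> \<in> D" for \<eta> \<xi>
  proof (rule LIMSEQ_unique)
    show "(\<lambda>n. third_diff (G (\<sigma> n)) \<eta> \<xi>) \<longlonglongrightarrow> third_diff g \<eta> \<xi>"
      unfolding third_diff_def by (intro tendsto_intros g)
    show "(\<lambda>n. third_diff (G (\<sigma> n)) \<eta> \<xi>) \<longlonglongrightarrow> 0"
      using LIMSEQ_subseq_LIMSEQ[OF td[OF that] \<sigma>] by (simp add: o_def)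
  qed
  have comp: "continuous_on UNIV (\<lambda>x. g (p x))" if "continuous_on UNIV p" for p :: "real^'n \<Rightarrow> real^'n"
    by (rule continuous_on_compose2[OF gcont that]) simp
  \<comment> \<open>Density is used first in the base point and afterwards in the step.\<close>
  have tdx: "third_diff g x \<xi> = 0" if "\<xi> \<in> D" for x \<xi>
  proof (rule continuous_constant_on_closure[where S = D and f = "\<lambda>x. third_diff g x \<xi>"])
    show "continuous_on (closure D) (\<lambda>x. third_diff g x \<xi>)"
      unfolding third_diff_def D by (intro continuous_intros comp)
  qed (use D tdD that in auto)
  have td0: "third_diff g x s = 0" for x s
  proof (rule continuous_constant_on_closure[where S = D and f = "third_diff g x"])
    show "continuous_on (closure D) (third_diff g x)"
      unfolding third_diff_def D by (intro continuous_intros comp)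
  qed (use D tdx in auto)
  obtain X where X: "X \<in> sym_matrices" "\<And>h. g h = h \<bullet> (X *v h) / 2"
    using quadratic_form_if_third_diff_0[OF gcont gC td0] by blast
  have unif: "\<forall>\<^sub>F n in sequentially. \<forall>h. norm h \<le> 1 \<longrightarrow> \<bar>G (\<sigma> n) h - g h\<bar> \<le> e" if e: "0 < e" for e
  proof -
    define K where "K = L 2 + 1"
    have K: "0 < K" using L0[of 2] by (simp add: K_def)
    define d where "d = min 1 (e / (3 * K))"
    have d: "0 < d" "d \<le> 1" "K * d \<le> e / 3" using e K by (auto simp: d_def min_def field_simps)
    obtain A where A: "A \<subseteq> cball (0::real^'n) 1" "finite A" "cball 0 1 \<subseteq> (\<Union>a\<in>A. ball a d)"
      by (rule compactE_image[of "cball (0::real^'n) 1" "cball 0 1" "\<lambda>a. ball a d"]) (use d in auto)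
    have "\<forall>\<^sub>F n in sequentially. \<forall>a\<in>A. \<bar>G (\<sigma> n) a - g a\<bar> < e / 3"
    proof (rule eventually_ball_finite[OF A(2)], rule ballI)
      fix a
      show "\<forall>\<^sub>F n in sequentially. \<bar>G (\<sigma> n) a - g a\<bar> < e / 3"
        using tendstoD[OF g[of a], of "e/3"] e by (simp add: dist_real_def)
    qed
    then show ?thesis
    proof eventually_elim
      case (elim n)
      show ?case
      proof (intro allI impI)
        fix h :: "real^'n" assume h: "norm h \<le> 1"
        then obtain a where a: "a \<in> A" "norm (h - a) < d" using A(3) by (auto simp: dist_norm norm_minus_commute)
        have a1: "norm a \<le> 2" "norm h \<le> 2" using a A(1) h by auto
        have Kd: "L 2 * norm (h - a) \<le> e / 3"
        proof -
          have "L 2 * norm (h - a) \<le> K * d" using a L0[of 2] by (intro mult_mono) (auto simp: K_def)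
          then show ?thesis using d by linarith
        qed
        show "\<bar>G (\<sigma> n) h - g h\<bar> \<le> e"
          using Kd lip[OF a1, of "\<sigma> n"] glip[OF a1] bspec[OF elim a(1)] by linarith
      qed
    qed
  qed
  show ?thesis
    by (rule that[OF \<sigma> X(1)]) (use unif in \<open>simp add: X(2)\<close>)
qed

section \<open>Almost everywhere decay of dyadic third differences\<close>

text \<open>The series of the \<open>g k\<close> has a finite integral, hence converges almost
  everywhere, and its terms tend to 0 there.\<close>

lemma AE_tendsto_0_if_summable_integral:
  fixes g :: "nat \<Rightarrow> 'a \<Rightarrow> real"
  assumes int: "\<And>k. integrable M (g k)" and nonneg: "\<And>k x. 0 \<le> g k x"
    and summ: "summable (\<lambda>k. integral\<^sup>L M (g k))"
  shows "AE x in M. (\<lambda>k. g k x) \<longlonglongrightarrow> 0"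
proof -
  have [measurable]: "g k \<in> borel_measurable M" for k
    using int by auto
  have "(\<integral>\<^sup>+x. (\<Sum>k. ennreal (g k x)) \<partial>M) = (\<Sum>k. \<integral>\<^sup>+x. ennreal (g k x) \<partial>M)"
    by (rule nn_integral_suminf) auto
  also have "\<dots> = (\<Sum>k. ennreal (integral\<^sup>L M (g k)))"
    using nn_integral_eq_integral[OF int] nonneg by simp
  also have "\<dots> = ennreal (\<Sum>k. integral\<^sup>L M (g k))"
    by (rule suminf_ennreal2) (auto intro: summ nonneg Bochner_Integration.integral_nonneg)
  finally have "(\<integral>\<^sup>+x. (\<Sum>k. ennreal (g k x)) \<partial>M) \<noteq> \<infinity>"
    by simp
  then have "AE x in M. (\<Sum>k. ennreal (g k x)) \<noteq> \<infinity>"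
    by (intro nn_integral_PInf_AE) auto
  then show ?thesis
  proof eventually_elim
    case (elim x)
    then have "summable (\<lambda>k. g k x)"
      using nonneg by (intro summable_suminf_not_top) auto
    then show ?case
      by (rule summable_LIMSEQ_zero)
  qed
qed

text \<open>A compactly supported weight with Lipschitz constant 1: translating a function
  integrated against it costs at most a multiple of the length of the translation.\<close>

definition tent :: "real \<Rightarrow> 'a::euclidean_space \<Rightarrow> real" where
  "tent R x = max 0 (R - norm x)"

lemma tent_nonneg: "0 \<le> tent R x"
  by (simp add: tent_def)

lemma tent_lipschitz: "\<bar>tent R x - tent R y\<bar> \<le> norm (x - y)"
proof -
  have "\<bar>norm x - norm y\<bar> \<le> norm (x - y)" by (rule norm_triangle_ineq3)
  then show ?thesis unfolding tent_def by linarith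
qed

lemma integrable_tent_mult:
  fixes F :: "'a::euclidean_space \<Rightarrow> real"
  assumes "continuous_on UNIV F"
  shows "integrable lborel (\<lambda>x. tent R (x - s) * F x)"
proof -
  have "integrable lborel (\<lambda>x. indicator (cball s \<bar>R\<bar>) x *\<^sub>R (tent R (x - s) * F x))"
    unfolding tent_def
    by (rule borel_integrable_compact, simp)
      (intro continuous_intros continuous_on_subset[OF assms] subset_UNIV)
  moreover have "indicator (cball s \<bar>R\<bar>) x *\<^sub>R (tent R (x - s) * F x) = tent R (x - s) * F x" for x
    by (auto simp: tent_def indicator_def dist_norm norm_minus_commute)
  ultimately show ?thesis by (simp only:)
qed

lemma integral_lborel_translate:
  fixes g :: "'a::euclidean_space \<Rightarrow> real"
  assumes "g \<in> borel_measurable borel"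
  shows "(\<integral>x. g (x + s) \<partial>lborel) = (\<integral>x. g x \<partial>lborel)"
proof -
  have "(\<integral>x. g x \<partial>lborel) = (\<integral>x. g x \<partial>distr lborel borel ((+) s))"
    using lborel_distr_plus[of s] by simp
  also have "\<dots> = (\<integral>x. g (s + x) \<partial>lborel)"
    by (rule integral_distr) (use assms in auto)
  finally show ?thesis by (simp add: add.commute)
qed

text \<open>Translation invariance moves the shift from \<open>F\<close> to the weight, where the
  Lipschitz bound controls it. Both weights vanish outside the ball of radius
  \<open>\<bar>R\<bar> + L\<close>.\<close>

lemma integral_tent_translate:
  fixes F :: "'a::euclidean_space \<Rightarrow> real"
  assumes F: "continuous_on UNIV F" and M: "\<And>x. \<bar>F x\<bar> \<le> M" and L: "norm s \<le> L"
  shows "\<bar>(\<integral>x. tent R x * F (x + s) \<partial>lborel) - (\<integral>x. tent R x * F x \<partial>lborel)\<bar>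
    \<le> norm s * (M * measure lborel (cball (0::'a) (\<bar>R\<bar> + L)))"
proof -
  have M0: "0 \<le> M" using M[of 0] by linarith
  have "(\<integral>x. tent R x * F (x + s) \<partial>lborel) = (\<integral>x. tent R ((x + s) - s) * F (x + s) \<partial>lborel)"
    by simp
  also have "\<dots> = (\<integral>x. tent R (x - s) * F x \<partial>lborel)"
  proof (rule integral_lborel_translate)
    show "(\<lambda>x. tent R (x - s) * F x) \<in> borel_measurable borel"
      using borel_measurable_integrable[OF integrable_tent_mult[OF F]] by simp
  qed
  finally have "(\<integral>x. tent R x * F (x + s) \<partial>lborel) - (\<integral>x. tent R x * F x \<partial>lborel)
      = (\<integral>x. tent R (x - s) * F x - tent R x * F x \<partial>lborel)"
    using integrable_tent_mult[OF F, of R s] integrable_tent_mult[OF F, of R 0] by simp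
  also have "\<bar>\<dots>\<bar> \<le> (\<integral>x. norm s * M * indicator (cball (0::'a) (\<bar>R\<bar> + L)) x \<partial>lborel)"
  proof (rule integral_abs_bound_integral)
    show "integrable lborel (\<lambda>x. tent R (x - s) * F x - tent R x * F x)"
      using integrable_tent_mult[OF F, of R s] integrable_tent_mult[OF F, of R 0]
      by (intro Bochner_Integration.integrable_diff) auto
    show "integrable lborel (\<lambda>x. norm s * M * indicator (cball (0::'a) (\<bar>R\<bar> + L)) x)"
      by (intro integrable_mult_right integrable_real_indicator)
        (use emeasure_bounded_finite[of "cball (0::'a) (\<bar>R\<bar> + L)"] in auto)
    fix x :: 'a
    show "\<bar>tent R (x - s) * F x - tent R x * F x\<bar> \<le> norm s * M * indicator (cball (0::'a) (\<bar>R\<bar> + L)) x"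
    proof (cases "norm x \<le> \<bar>R\<bar> + L")
      case True
      have "\<bar>tent R (x - s) * F x - tent R x * F x\<bar> = \<bar>tent R (x - s) - tent R x\<bar> * \<bar>F x\<bar>"
        by (simp add: abs_mult[symmetric] algebra_simps)
      also have "\<dots> \<le> norm s * M"
        using tent_lipschitz[of R "x - s" x] M by (intro mult_mono) auto
      finally show ?thesis using True by simp
    next
      case False
      have "norm x \<le> norm (x - s) + norm s" by (metis diff_add_cancel norm_triangle_ineq)
      with False L norm_ge_zero[of s] have "R - norm (x - s) \<le> 0" "R - norm x \<le> 0"
        by linarith+
      then have "tent R (x - s) = 0" "tent R x = 0"
        by (simp_all add: tent_def max_absorb1)
      then show ?thesis using M0 by simp
    qed
  qed
  also have "\<dots> = norm s * (M * measure lborel (cball (0::'a) (\<bar>R\<bar> + L)))"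
    by simp
  finally show ?thesis .
qed

text \<open>Jensen's inequality for the square with weights 1/4, 1/2, 1/4. The defect is the sum of
  the squared pairwise differences, each weighted by the product of its two weights; one of the
  three terms is kept.\<close>

lemma dyadic_average_square:
  fixes a b d :: real
  shows "((a + 2 * b + d) / 4)\<^sup>2 + (a - b)\<^sup>2 / 8 \<le> a\<^sup>2 / 4 + b\<^sup>2 / 2 + d\<^sup>2 / 4"
proof -
  have "a\<^sup>2 / 4 + b\<^sup>2 / 2 + d\<^sup>2 / 4 - ((a + 2 * b + d) / 4)\<^sup>2 - (a - b)\<^sup>2 / 8
      = (b - d)\<^sup>2 / 8 + (a - d)\<^sup>2 / 16"
    by (simp add: power2_eq_square field_simps)
  moreover have "0 \<le> (b - d)\<^sup>2 / 8 + (a - d)\<^sup>2 / 16" by simp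
  ultimately show ?thesis by linarith
qed

text \<open>By Jensen the weighted \<open>L\<^sup>2\<close> energies of the \<open>D k\<close>
  increase with \<open>k\<close> up to translation errors of order \<open>(1/2)^k\<close>. As they
  are bounded, the Jensen defects, which dominate the squared increments, have summable
  integrals.\<close>

lemma AE_dyadic_increment_tendsto_0:
  fixes D :: "nat \<Rightarrow> 'a::euclidean_space \<Rightarrow> real"
  assumes cont: "\<And>k. continuous_on UNIV (D k)" and B: "\<And>k x. \<bar>D k x\<bar> \<le> B"
    and avg: "\<And>k x. D k x = (D (Suc k) x + 2 * D (Suc k) (x + (1/2)^Suc k *\<^sub>R \<xi>)
        + D (Suc k) (x + 2 *\<^sub>R ((1/2)^Suc k *\<^sub>R \<xi>))) / 4"
  shows "AE x in lborel. (\<lambda>k. D k (x + (1/2)^k *\<^sub>R \<eta> + (1/2)^k *\<^sub>R \<xi>) - D k (x + (1/2)^k *\<^sub>R \<eta>)) \<longlonglongrightarrow> 0"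
proof -
  define s where "s k = (1/2)^k *\<^sub>R \<xi>" for k :: nat
  define h where "h k = (1/2)^k *\<^sub>R \<eta>" for k :: nat
  define E where "E k x = (D k (x + s k) - D k x)\<^sup>2" for k x
  define L where "L = 2 * norm \<xi> + norm \<eta>"
  have pow_le1: "(1/2::real)^k \<le> 1" for k by (simp add: power_le_one)
  have s_le: "norm (s k) \<le> L" "norm (2 *\<^sub>R s k) \<le> L" and h_le: "norm (h k) \<le> L" for k
  proof -
    have "(1/2)^k * norm \<xi> \<le> norm \<xi>" "(1/2)^k * norm \<eta> \<le> norm \<eta>"
      by (simp_all add: mult_left_le_one_le pow_le1)
    then have "(1/2)^k * norm \<xi> \<le> L" "2 * ((1/2)^k * norm \<xi>) \<le> L" "(1/2)^k * norm \<eta> \<le> L"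
      using norm_ge_zero[of \<xi>] norm_ge_zero[of \<eta>] unfolding L_def by linarith+
    then show "norm (s k) \<le> L" "norm (2 *\<^sub>R s k) \<le> L" "norm (h k) \<le> L"
      by (simp_all add: s_def h_def)
  qed
  have B0: "0 \<le> B" using B[of 0 0] by linarith
  have contS: "continuous_on UNIV (\<lambda>x. D k (x + a))" for k a
    by (rule continuous_on_compose2[OF cont]) (auto intro!: continuous_intros)
  have contE: "continuous_on UNIV (E k)" for k
    unfolding E_def by (intro continuous_intros contS cont)
  have D2: "\<bar>(D k x)\<^sup>2\<bar> \<le> B\<^sup>2" for k x
    using B[of k x] by (metis abs_power2 abs_le_square_iff abs_of_nonneg B0)
  have EB: "\<bar>E k x\<bar> \<le> (2 * B)\<^sup>2" for k x
  proof -
    have "\<bar>D k (x + s k) - D k x\<bar> \<le> 2 * B" using B[of k x] B[of k "x + s k"] by linarith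
    then show ?thesis unfolding E_def by (metis abs_power2 abs_le_square_iff abs_of_nonneg B0 mult_nonneg_nonneg zero_le_numeral)
  qed
  have main: "AE x in lborel. (\<lambda>k. tent R x * E k (x + h k)) \<longlonglongrightarrow> 0" for R :: real
  proof (rule AE_tendsto_0_if_summable_integral)
    have contEh: "continuous_on UNIV (\<lambda>x. E k (x + h k))" for k
      by (rule continuous_on_compose2[OF contE]) (auto intro!: continuous_intros)
    show "integrable lborel (\<lambda>x. tent R x * E k (x + h k))" for k
      using integrable_tent_mult[OF contEh[of k], of R 0] by simp
    show "0 \<le> tent R x * E k (x + h k)" for k x
      by (simp add: tent_nonneg E_def)
    define V where "V = measure lborel (cball (0::'a) (\<bar>R\<bar> + L))"
    define I where "I F = (\<integral>x. tent R x * F x \<partial>lborel)" for F :: "'a \<Rightarrow> real"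
    have V0: "0 \<le> V" by (simp add: V_def)
    have intF: "integrable lborel (\<lambda>x. tent R x * F x)" if "continuous_on UNIV F" for F :: "'a \<Rightarrow> real"
      using integrable_tent_mult[OF that, of R 0] by simp
    define a where "a k = I (\<lambda>x. (D k x)\<^sup>2)" for k
    define e where "e k = I (E k)" for k
    have contD2: "continuous_on UNIV (\<lambda>x. (D k x)\<^sup>2)" for k
      by (intro continuous_intros cont)
    have contD2s: "continuous_on UNIV (\<lambda>x. (D k (x + b))\<^sup>2)" for k b
      by (intro continuous_intros contS)
    have shift: "I (\<lambda>x. (D k (x + b))\<^sup>2) \<le> a k + norm b * (B\<^sup>2 * V)" if "norm b \<le> L" for k b
      using integral_tent_translate[OF contD2 D2 that, of R k] unfolding I_def a_def V_def by linarith
    have e_nonneg: "0 \<le> e k" for k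
      unfolding e_def I_def by (rule Bochner_Integration.integral_nonneg) (simp add: tent_nonneg E_def)
    \<comment> \<open>The defect \<open>e\<close> at scale \<open>Suc k\<close> is paid for by the
      growth of the energy \<open>a\<close>. Moving the translated squares back to \<open>x\<close>
      costs the last term, which decays geometrically.\<close>
    have step: "a k + e (Suc k) / 8 \<le> a (Suc k) + norm (s (Suc k)) * (B\<^sup>2 * V)" for k
    proof -
      let ?s = "s (Suc k)" and ?D = "D (Suc k)"
      have "a k + e (Suc k) / 8 = (\<integral>x. tent R x * (D k x)\<^sup>2 + tent R x * E (Suc k) x / 8 \<partial>lborel)"
        unfolding a_def e_def I_def using intF[OF contD2[of k]] intF[OF contE[of "Suc k"]] by simp
      also have "\<dots> \<le> (\<integral>x. (tent R x * (?D x)\<^sup>2 / 4 + tent R x * (?D (x + ?s))\<^sup>2 / 2)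
          + tent R x * (?D (x + 2 *\<^sub>R ?s))\<^sup>2 / 4 \<partial>lborel)"
      proof (rule Bochner_Integration.integral_mono)
        show "integrable lborel (\<lambda>x. tent R x * (D k x)\<^sup>2 + tent R x * E (Suc k) x / 8)"
          using intF[OF contD2[of k]] intF[OF contE[of "Suc k"]] by simp
        show "integrable lborel (\<lambda>x. (tent R x * (?D x)\<^sup>2 / 4 + tent R x * (?D (x + ?s))\<^sup>2 / 2)
          + tent R x * (?D (x + 2 *\<^sub>R ?s))\<^sup>2 / 4)"
          using intF[OF contD2[of "Suc k"]] intF[OF contD2s[of "Suc k"]] by simp
        fix x
        have "(D k x)\<^sup>2 + E (Suc k) x / 8
            \<le> (?D x)\<^sup>2 / 4 + (?D (x + ?s))\<^sup>2 / 2 + (?D (x + 2 *\<^sub>R ?s))\<^sup>2 / 4"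
          using dyadic_average_square[of "?D x" "?D (x + ?s)" "?D (x + 2 *\<^sub>R ?s)"]
          unfolding E_def s_def avg[of k x] by (simp add: power2_commute)
        from mult_left_mono[OF this tent_nonneg[of R x]]
        show "tent R x * (D k x)\<^sup>2 + tent R x * E (Suc k) x / 8
          \<le> (tent R x * (?D x)\<^sup>2 / 4 + tent R x * (?D (x + ?s))\<^sup>2 / 2)
            + tent R x * (?D (x + 2 *\<^sub>R ?s))\<^sup>2 / 4"
          by (simp add: algebra_simps)
      qed
      also have "\<dots> = a (Suc k) / 4 + I (\<lambda>x. (?D (x + ?s))\<^sup>2) / 2 + I (\<lambda>x. (?D (x + 2 *\<^sub>R ?s))\<^sup>2) / 4"
        unfolding a_def I_def using intF[OF contD2[of "Suc k"]] intF[OF contD2s[of "Suc k"]] by simp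
      also have "\<dots> \<le> a (Suc k) + norm ?s * (B\<^sup>2 * V)"
        using shift[OF s_le(1)[of "Suc k"], of "Suc k"] shift[OF s_le(2)[of "Suc k"], of "Suc k"]
        by simp
      finally show ?thesis .
    qed
    have a_bd: "a k \<le> B\<^sup>2 * I (\<lambda>x. 1)" for k
    proof -
      have "a k \<le> (\<integral>x. tent R (x::'a) * B\<^sup>2 \<partial>lborel)"
        unfolding a_def I_def
      proof (rule Bochner_Integration.integral_mono)
        show "tent R x * (D k x)\<^sup>2 \<le> tent R x * B\<^sup>2" for x :: 'a
          using D2[of k x] by (intro mult_left_mono tent_nonneg) auto
      qed (rule intF[OF contD2], rule intF, rule continuous_on_const)
      then show ?thesis unfolding I_def by (simp add: mult.commute)
    qed
    have a0: "0 \<le> a k" for k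
      unfolding a_def I_def by (rule Bochner_Integration.integral_nonneg) (simp add: tent_nonneg)
    have sum_s: "(\<Sum>k<n. norm (s (Suc k))) \<le> norm \<xi>" for n
    proof -
      have "(\<Sum>k<n. norm (s (Suc k))) = norm \<xi> * (1 - (1/2)^n)"
        by (induction n) (auto simp: s_def algebra_simps)
      also have "\<dots> \<le> norm \<xi> * 1" by (intro mult_left_mono) auto
      finally show ?thesis by simp
    qed
    have tele: "(\<Sum>k<n. e (Suc k)) / 8 \<le> a n - a 0 + (\<Sum>k<n. norm (s (Suc k))) * (B\<^sup>2 * V)" for n
    proof (induction n)
      case (Suc n)
      then show ?case using step[of n] by (simp add: algebra_simps add_divide_distrib)
    qed simp
    have "summable (\<lambda>k. e (Suc k))"
    proof (rule summableI_nonneg_bounded)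
      show "(\<Sum>k<n. e (Suc k)) \<le> 8 * (B\<^sup>2 * I (\<lambda>x. 1) + norm \<xi> * (B\<^sup>2 * V))" for n
        using tele[of n] a_bd[of n] a0[of 0] mult_right_mono[OF sum_s[of n], of "B\<^sup>2 * V"] V0
        by simp
    qed (rule e_nonneg)
    then have summ_e: "summable e" by (simp add: summable_Suc_iff)
    \<comment> \<open>The increments are wanted at \<open>x + h k\<close> instead of
      \<open>x\<close>; this further translation has a summable cost too.\<close>
    have summ_h: "summable (\<lambda>k. norm (h k) * ((2 * B)\<^sup>2 * V))"
      unfolding h_def by (simp add: abs_mult summable_mult summable_mult2)
    show "summable (\<lambda>k. \<integral>x. tent R x * E k (x + h k) \<partial>lborel)"
    proof (rule summable_comparison_test'[OF summable_add[OF summ_e summ_h], of 0])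
      fix k :: nat
      have "0 \<le> (\<integral>x. tent R x * E k (x + h k) \<partial>lborel)"
        by (rule Bochner_Integration.integral_nonneg) (simp add: tent_nonneg E_def)
      then show "norm (\<integral>x. tent R x * E k (x + h k) \<partial>lborel) \<le> e k + norm (h k) * ((2 * B)\<^sup>2 * V)"
        using integral_tent_translate[OF contE EB h_le, of R k k] unfolding e_def I_def V_def by simp
    qed
  qed
  \<comment> \<open>A tent sees only one ball, so the exceptional sets of countably many radii are
    united.\<close>
  have "AE x in lborel. \<forall>N::nat. (\<lambda>k. tent (real N) x * E k (x + h k)) \<longlonglongrightarrow> 0"
    using main by (simp add: AE_all_countable)
  then show ?thesis
  proof eventually_elim
    case (elim x)
    obtain N :: nat where N: "norm x < real N" using reals_Archimedean2 by blast
    then have pos: "tent (real N) x > 0" by (simp add: tent_def)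
    have "(\<lambda>k. tent (real N) x * E k (x + h k) / tent (real N) x) \<longlonglongrightarrow> 0 / tent (real N) x"
      using elim pos by (intro tendsto_divide tendsto_const) auto
    then have "(\<lambda>k. E k (x + h k)) \<longlonglongrightarrow> 0" using pos by simp
    then have "(\<lambda>k. sqrt (E k (x + h k))) \<longlonglongrightarrow> 0" using tendsto_real_sqrt by fastforce
    then have "(\<lambda>k. \<bar>D k (x + h k + s k) - D k (x + h k)\<bar>) \<longlonglongrightarrow> 0"
      by (simp add: E_def)
    then show ?case
      unfolding h_def s_def by (simp add: tendsto_rabs_zero_iff)
  qed
qed

text \<open>A second difference of step \<open>2u\<close> is the sum, with weights 1, 2, 1, of three
  second differences of step \<open>u\<close>. In the normalisation by \<open>4^k\<close> this is
  the dyadic averaging relation, and the increment of a second difference by its own step is a third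
  difference.\<close>

lemma AE_scaled_third_diff_tendsto_0:
  fixes f :: "'a::euclidean_space \<Rightarrow> real"
  assumes cont: "continuous_on UNIV f"
    and c: "\<And>x h. \<bar>f (x + h) + f (x - h) - 2 * f x\<bar> \<le> c * (norm h)\<^sup>2"
  shows "AE z in lborel. (\<lambda>k. 4^k * third_diff f (z + (1/2)^k *\<^sub>R \<eta>) ((1/2)^k *\<^sub>R \<xi>)) \<longlonglongrightarrow> 0"
proof -
  define D where "D k x = 4^k * (f (x + 2 *\<^sub>R ((1/2)^k *\<^sub>R \<xi>)) - 2 * f (x + (1/2)^k *\<^sub>R \<xi>) + f x)" for k :: nat and x
  have contS: "continuous_on UNIV (\<lambda>x. f (x + a))" for a
    by (rule continuous_on_compose2[OF cont]) (auto intro!: continuous_intros)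
  have "AE x in lborel. (\<lambda>k. D k (x + (1/2)^k *\<^sub>R \<eta> + (1/2)^k *\<^sub>R \<xi>) - D k (x + (1/2)^k *\<^sub>R \<eta>)) \<longlonglongrightarrow> 0"
  proof (rule AE_dyadic_increment_tendsto_0)
    show "continuous_on UNIV (D k)" for k
      unfolding D_def by (intro continuous_intros contS cont)
    show "\<bar>D k x\<bar> \<le> c * (norm \<xi>)\<^sup>2" for k x
    proof -
      let ?s = "(1/2)^k *\<^sub>R \<xi>"
      have four: "(4::real)^k * ((1/2)^k)\<^sup>2 = 1"
        by (simp add: power_mult_distrib[symmetric] power2_eq_square)
      have "D k x = 4^k * (f ((x + ?s) + ?s) + f ((x + ?s) - ?s) - 2 * f (x + ?s))"
        by (simp add: D_def scaleR_2 add.assoc flip: scaleR_add_left)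
      then have "\<bar>D k x\<bar> = 4^k * \<bar>f ((x + ?s) + ?s) + f ((x + ?s) - ?s) - 2 * f (x + ?s)\<bar>"
        by (simp add: abs_mult)
      also have "\<dots> \<le> 4^k * (c * (norm ?s)\<^sup>2)"
        by (intro mult_left_mono c) auto
      also have "\<dots> = (4^k * ((1/2)^k)\<^sup>2) * (c * (norm \<xi>)\<^sup>2)"
        by (simp add: power_mult_distrib)
      finally show ?thesis unfolding four by simp
    qed
    show "D k x = (D (Suc k) x + 2 * D (Suc k) (x + (1/2)^Suc k *\<^sub>R \<xi>)
        + D (Suc k) (x + 2 *\<^sub>R ((1/2)^Suc k *\<^sub>R \<xi>))) / 4" for k x
    proof -
      define u where "u = (1/2)^Suc k *\<^sub>R \<xi>"
      have u: "(1/2)^k *\<^sub>R \<xi> = 2 *\<^sub>R u" by (simp add: u_def)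
      have e: "x + u + 2 *\<^sub>R u = x + 3 *\<^sub>R u" "x + u + u = x + 2 *\<^sub>R u"
        "x + 2 *\<^sub>R u + 2 *\<^sub>R u = x + 4 *\<^sub>R u" "x + 2 *\<^sub>R u + u = x + 3 *\<^sub>R u"
        using scaleR_add_left[of 1 2 u] scaleR_add_left[of 2 2 u] scaleR_add_left[of 1 1 u]
        by (simp_all add: add.assoc add.commute)
      show ?thesis unfolding D_def u_def[symmetric] u e by (simp add: field_simps)
    qed
  qed
  moreover have "D k (y + s) - D k y = 4^k * third_diff f y s" if "s = (1/2)^k *\<^sub>R \<xi>" for k y s
  proof -
    have e: "y + s + 2 *\<^sub>R s = y + 3 *\<^sub>R s" "y + s + s = y + 2 *\<^sub>R s"
      using scaleR_add_left[of 1 2 s] scaleR_add_left[of 1 1 s] by (simp_all add: add.assoc)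
    show ?thesis unfolding D_def that[symmetric] third_diff_def e by (simp add: algebra_simps)
  qed
  ultimately show ?thesis by simp
qed

section \<open>Paraboloid envelopes\<close>

text \<open>A sup-convolution followed by an inf-convolution with the same constant (a Lasry-Lions
  double envelope). The infimum of an empty set of reals is unspecified, so lower bounds for the
  envelope assume one dominating paraboloid, given by \<open>a0\<close> and
  \<open>b0\<close>.\<close>

definition par_env :: "real \<Rightarrow> ('a::euclidean_space \<Rightarrow> real) \<Rightarrow> 'a \<Rightarrow> real" where
  "par_env c w x = Inf {b + c * (norm (x - a))\<^sup>2 |a b. \<forall>y. w y \<le> b + c * (norm (y - a))\<^sup>2}"

lemma par_env_le:
  assumes "\<And>y. w y \<le> b + c * (norm (y - a))\<^sup>2"
  shows "par_env c w x \<le> b + c * (norm (x - a))\<^sup>2"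
  unfolding par_env_def
proof (rule cInf_lower)
  show "bdd_below {b + c * (norm (x - a))\<^sup>2 |a b. \<forall>y. w y \<le> b + c * (norm (y - a))\<^sup>2}"
    by (rule bdd_belowI[of _ "w x"]) auto
qed (use assms in auto)

lemma par_env_greatest:
  assumes "\<And>y. w y \<le> b0 + c * (norm (y - a0))\<^sup>2"
    and "\<And>a b. (\<And>y. w y \<le> b + c * (norm (y - a))\<^sup>2) \<Longrightarrow> k \<le> b + c * (norm (x - a))\<^sup>2"
  shows "k \<le> par_env c w x"
  unfolding par_env_def
proof (rule cInf_greatest)
  show "{b + c * (norm (x - a))\<^sup>2 |a b. \<forall>y. w y \<le> b + c * (norm (y - a))\<^sup>2} \<noteq> {}"
    using assms(1) by blast
qed (use assms(2) in auto)

lemma par_env_le_slope: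
  assumes c: "0 < c" and w: "\<And>y. w y \<le> k + p \<bullet> (y - z) + c * (norm (y - z))\<^sup>2"
  shows "par_env c w x \<le> k + p \<bullet> (x - z) + c * (norm (x - z))\<^sup>2"
proof -
  \<comment> \<open>Vertex and height, by completing the square, of the paraboloid with value
    \<open>k\<close> and slope \<open>p\<close> at \<open>z\<close>.\<close>
  define a where "a = z - (1 / (2 * c)) *\<^sub>R p"
  define b where "b = k - (norm p)\<^sup>2 / (4 * c)"
  have sq: "b + c * (norm (y - a))\<^sup>2 = k + p \<bullet> (y - z) + c * (norm (y - z))\<^sup>2" for y
  proof -
    define u where "u = y - z"
    have ya: "y - a = u + (1 / (2 * c)) *\<^sub>R p" by (simp add: a_def u_def)
    have "(norm (u + (1 / (2 * c)) *\<^sub>R p))\<^sup>2 = (norm u)\<^sup>2 + (1 / c) * (p \<bullet> u) + (1 / (2 * c))\<^sup>2 * (norm p)\<^sup>2"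
      unfolding dot_square_norm[symmetric] using c
      by (simp add: inner_simps inner_commute power2_eq_square)
    then have "c * (norm (y - a))\<^sup>2 = c * (norm u)\<^sup>2 + p \<bullet> u + (norm p)\<^sup>2 / (4 * c)"
      unfolding ya using c by (simp add: distrib_left power_divide power_mult_distrib) (simp add: power2_eq_square)
    then show ?thesis unfolding b_def u_def by simp
  qed
  show ?thesis using par_env_le[of w b c a x] w unfolding sq by simp
qed

lemma parallelogram_law_norm:
  fixes x h :: "'a::real_inner"
  shows "(norm (x + h))\<^sup>2 + (norm (x - h))\<^sup>2 = 2 * (norm x)\<^sup>2 + 2 * (norm h)\<^sup>2"
  by (simp add: power2_norm_eq_inner inner_simps inner_commute)

text \<open>All competing paraboloids have second difference exactly
  \<open>2 * c * (norm h)\<^sup>2\<close>, and an infimum inherits this upper bound.\<close>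

lemma par_env_second_diff_le:
  assumes "0 < c" and up: "\<And>y. w y \<le> b0 + c * (norm (y - a0))\<^sup>2"
  shows "par_env c w (x + h) + par_env c w (x - h) \<le> 2 * par_env c w x + 2 * c * (norm h)\<^sup>2"
proof -
  have "(par_env c w (x + h) + par_env c w (x - h) - 2 * c * (norm h)\<^sup>2) / 2 \<le> par_env c w x"
  proof (rule par_env_greatest[OF up])
    fix a b assume ab: "\<And>y. w y \<le> b + c * (norm (y - a))\<^sup>2"
    have "c * (norm (x + h - a))\<^sup>2 + c * (norm (x - h - a))\<^sup>2 = 2 * (c * (norm (x - a))\<^sup>2) + 2 * c * (norm h)\<^sup>2"
      using parallelogram_law_norm[of "x - a" h] unfolding distrib_left[symmetric]
      by (simp add: algebra_simps)
    then show "(par_env c w (x + h) + par_env c w (x - h) - 2 * c * (norm h)\<^sup>2) / 2 \<le> b + c * (norm (x - a))\<^sup>2"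
      using par_env_le[OF ab, of "x + h"] par_env_le[OF ab, of "x - h"] by (simp add: field_simps)
  qed
  then show ?thesis by (simp add: field_simps)
qed

text \<open>The paraboloids dominating a \<open>c\<close>-semiconvex function form a family that is itself semiconvex
  in the vertex, with the better constant \<open>c / 2\<close>; this is what makes their infimum semiconvex.\<close>

lemma par_env_second_diff_ge:
  assumes c: "0 < c" and up: "\<And>y. w y \<le> b0 + c * (norm (y - a0))\<^sup>2"
    and sc: "\<And>y k. 2 * w y - 2 * c * (norm k)\<^sup>2 \<le> w (y + k) + w (y - k)"
  shows "2 * par_env c w x - 2 * c * (norm h)\<^sup>2 \<le> par_env c w (x + h) + par_env c w (x - h)"
proof -
  have main: "2 * par_env c w x - 2 * c * (norm h)\<^sup>2 \<le> (b1 + c * (norm (x + h - a1))\<^sup>2) + (b2 + c * (norm (x - h - a2))\<^sup>2)"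
    if 1: "\<And>y. w y \<le> b1 + c * (norm (y - a1))\<^sup>2" and 2: "\<And>y. w y \<le> b2 + c * (norm (y - a2))\<^sup>2" for a1 b1 a2 b2
  proof -
    define a where "a = (1/2) *\<^sub>R (a1 + a2)"
    define d where "d = (1/2) *\<^sub>R (a1 - a2)"
    define b where "b = (b1 + b2) / 2 + c / 2 * (norm d)\<^sup>2"
    have a12: "a1 = a + d" "a2 = a - d"
      by (simp_all add: a_def d_def scaleR_right_distrib scaleR_right_diff_distrib flip: scaleR_add_left)
    have sq: "c * (norm (y + k - a1))\<^sup>2 + c * (norm (y - k - a2))\<^sup>2 = 2 * c * (norm (y - a))\<^sup>2 + 2 * c * (norm (k - d))\<^sup>2" for y k
      using arg_cong[OF parallelogram_law_norm[of "y - a" "k - d"], of "(*) c"] unfolding a12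
      by (simp add: algebra_simps)
    have "w y \<le> b + c * (norm (y - a))\<^sup>2" for y
    proof -
      \<comment> \<open>This choice minimises
        \<open>(norm (k - d))\<^sup>2 + (norm k)\<^sup>2\<close>, where the first term comes from
        the two vertices and the second from semiconvexity; the minimum accounts for the extra term
        in \<open>b\<close>.\<close>
      define k where "k = (1/2) *\<^sub>R d"
      have kd: "(norm (k - d))\<^sup>2 = (norm d)\<^sup>2 / 4" "(norm k)\<^sup>2 = (norm d)\<^sup>2 / 4"
      proof -
        have "d = k + k" by (simp add: k_def flip: scaleR_add_left)
        then have "norm (k - d) = norm k" by simp
        then show "(norm (k - d))\<^sup>2 = (norm d)\<^sup>2 / 4" "(norm k)\<^sup>2 = (norm d)\<^sup>2 / 4"
          by (simp_all only:) (simp_all add: k_def power_divide)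
      qed
      have "2 * w y \<le> b1 + b2 + (c * (norm (y + k - a1))\<^sup>2 + c * (norm (y - k - a2))\<^sup>2) + 2 * c * (norm k)\<^sup>2"
        using sc[of y k] 1[of "y + k"] 2[of "y - k"] by linarith
      also have "\<dots> = 2 * (b + c * (norm (y - a))\<^sup>2)"
        unfolding sq kd b_def by (simp add: field_simps)
      finally show ?thesis by simp
    qed
    then have "par_env c w x \<le> b + c * (norm (x - a))\<^sup>2" by (rule par_env_le)
    moreover have "c * (norm d)\<^sup>2 \<le> 2 * c * (norm (h - d))\<^sup>2 + 2 * c * (norm h)\<^sup>2"
    proof -
      have "norm d \<le> norm (h - d) + norm h" by (metis add_diff_cancel diff_add_cancel norm_minus_commute norm_triangle_sub add.commute)
      then have "(norm d)\<^sup>2 \<le> (norm (h - d) + norm h)\<^sup>2" by (simp add: power_mono)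
      also have "\<dots> \<le> 2 * (norm (h - d))\<^sup>2 + 2 * (norm h)\<^sup>2"
        using sum_squares_bound[of "norm (h - d)" "norm h"] by (simp add: power2_sum)
      finally have "c * (norm d)\<^sup>2 \<le> c * (2 * (norm (h - d))\<^sup>2 + 2 * (norm h)\<^sup>2)" using c by simp
      then show ?thesis by (simp add: algebra_simps)
    qed
    ultimately show ?thesis using sq[of x h] unfolding b_def by (simp add: field_simps)
  qed
  have "2 * par_env c w x - 2 * c * (norm h)\<^sup>2 - par_env c w (x - h) \<le> par_env c w (x + h)"
  proof (rule par_env_greatest[OF up])
    fix a1 b1 assume 1: "\<And>y. w y \<le> b1 + c * (norm (y - a1))\<^sup>2"
    have "2 * par_env c w x - 2 * c * (norm h)\<^sup>2 - (b1 + c * (norm (x + h - a1))\<^sup>2) \<le> par_env c w (x - h)"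
      by (rule par_env_greatest[OF up]) (use main[OF 1] in \<open>simp add: algebra_simps\<close>)
    then show "2 * par_env c w x - 2 * c * (norm h)\<^sup>2 - par_env c w (x - h) \<le> b1 + c * (norm (x + h - a1))\<^sup>2"
      by linarith
  qed
  then show ?thesis by linarith
qed

lemma le_par_env:
  assumes "\<And>y. w y \<le> b0 + c * (norm (y - a0))\<^sup>2"
  shows "w x \<le> par_env c w x"
  by (rule par_env_greatest[OF assms])

lemma slope_eq_if_quadratic_le:
  fixes q :: "'a::real_inner"
  assumes "0 < c" "\<And>h. q \<bullet> h \<le> c * (norm h)\<^sup>2"
  shows "q = 0"
proof -
  have "q \<bullet> ((1 / (2 * c)) *\<^sub>R q) \<le> c * (norm ((1 / (2 * c)) *\<^sub>R q))\<^sup>2" by (rule assms)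
  then have "(norm q)\<^sup>2 / (2 * c) \<le> (norm q)\<^sup>2 / (4 * c)"
    using assms(1) by (simp add: dot_square_norm power_mult_distrib power_divide) (simp add: power2_eq_square)
  then have "(norm q)\<^sup>2 \<le> 0" using assms(1) by (simp add: field_simps)
  then show ?thesis by simp
qed

text \<open>The paraboloid below \<open>s\<close> at \<open>z'\<close> has to stay below the affine
  function above \<open>s\<close> at \<open>z\<close>. A large difference of slopes would violate
  this, unless \<open>z'\<close> is far from \<open>z\<close>.\<close>

lemma slope_lipschitz:
  fixes s :: "'a::real_inner \<Rightarrow> real"
  assumes c: "0 < c"
    and up: "\<And>y. s y \<le> s z + q \<bullet> (y - z)"
    and low: "\<And>y. s z + q \<bullet> (y - z) - c * (norm (y - z))\<^sup>2 \<le> s y"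
    and low': "\<And>y. s z' + q' \<bullet> (y - z') - c * (norm (y - z'))\<^sup>2 \<le> s y"
  shows "norm (q' - q) \<le> 2 * c * norm (z' - z)"
proof -
  \<comment> \<open>The point at which the paraboloid at \<open>z'\<close> exceeds an affine
    function of slope \<open>q\<close> the most.\<close>
  define y where "y = z' + (1 / (2 * c)) *\<^sub>R (q' - q)"
  have yz: "y - z = (z' - z) + (y - z')" by simp
  have "s z' + q' \<bullet> (y - z') - c * (norm (y - z'))\<^sup>2 \<le> s z + q \<bullet> (y - z)"
    using low'[of y] up[of y] by linarith
  moreover have "s z + q \<bullet> (z' - z) - c * (norm (z' - z))\<^sup>2 \<le> s z'" by (rule low)
  ultimately have "(q' - q) \<bullet> (y - z') \<le> c * (norm (z' - z))\<^sup>2 + c * (norm (y - z'))\<^sup>2"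
    unfolding yz inner_add_right by (simp add: inner_diff_left)
  then have "(norm (q' - q))\<^sup>2 / (2 * c) \<le> c * (norm (z' - z))\<^sup>2 + (norm (q' - q))\<^sup>2 / (4 * c)"
    using c by (simp add: y_def dot_square_norm power_mult_distrib power_divide) (simp add: power2_eq_square)
  then have "(norm (q' - q))\<^sup>2 \<le> 4 * c\<^sup>2 * (norm (z' - z))\<^sup>2"
    using c by (simp add: field_simps) (simp add: power2_eq_square algebra_simps)
  also have "\<dots> = (2 * c * norm (z' - z))\<^sup>2" by (simp add: power_mult_distrib)
  finally show ?thesis using c by (simp add: power2_le_iff_abs_le)
qed

text \<open>Adding \<open>2 * e * (norm h)\<^sup>2\<close> to the quadratic bound outweighs the
  error \<open>e * r\<^sup>2\<close> on the sphere of radius \<open>r\<close>. The difference of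
  \<open>w\<close> and the steeper quadratic thus has an interior maximum on the ball, where the
  quadratic touches after a vertical shift.\<close>

lemma touching_paraboloid:
  fixes w :: "real^'n \<Rightarrow> real"
  assumes w: "continuous_on UNIV w" and r: "0 < r" and e: "0 < e"
    and le: "\<And>h. norm h \<le> r \<Longrightarrow> w (z + h) \<le> w z + \<xi> \<bullet> h + h \<bullet> (X *v h) / 2 + e * r\<^sup>2"
    and X: "X \<in> sym_matrices"
  obtains z1 p where "norm (z1 - z) < r"
    "\<forall>\<^sub>F \<zeta> in nhds z1. w \<zeta> \<le> w z1 + p \<bullet> (\<zeta> - z1) + (\<zeta> - z1) \<bullet> ((X + (4 * e) *\<^sub>R mat 1) *v (\<zeta> - z1)) / 2"
proof -
  define q where "q h = \<xi> \<bullet> h + h \<bullet> ((X + (4 * e) *\<^sub>R mat 1) *v h) / 2" for h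
  have q: "q h = \<xi> \<bullet> h + h \<bullet> (X *v h) / 2 + 2 * e * (norm h)\<^sup>2" for h
    by (simp add: q_def matrix_vector_mult_add_rdistrib inner_simps scaleR_matrix_vector_assoc[symmetric] power2_norm_eq_inner)
  have cont: "continuous_on (cball 0 r) (\<lambda>h. w (z + h) - q h)"
    unfolding q_def
    by (intro continuous_intros continuous_on_compose2[OF w] linear_continuous_on_compose[OF continuous_on_id])
       (auto simp: matrix_vector_mul_linear)
  obtain h1 where h1: "norm h1 \<le> r" and max: "\<And>h. norm h \<le> r \<Longrightarrow> w (z + h) - q h \<le> w (z + h1) - q h1"
    using continuous_attains_sup[OF compact_cball _ cont] r by auto
  have "norm h1 \<noteq> r"
  proof
    assume eq: "norm h1 = r"
    have "w z \<le> w (z + h1) - q h1" using max[of 0] r by (simp add: q)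
    also have "\<dots> \<le> w z - e * r\<^sup>2" using le[OF h1] eq by (simp add: q)
    finally show False using e r by (simp add: mult_le_0_iff)
  qed
  with h1 have h1r: "norm h1 < r" by simp
  define H where "H = X + (4 * e) *\<^sub>R mat 1"
  have symH: "u \<bullet> (H *v v) = v \<bullet> (H *v u)" for u v
    unfolding H_def by (intro inner_sym_matrix sym_matrices_add sym_matrices_scaled_id X)
  show ?thesis
  proof
    show "norm ((z + h1) - z) < r" using h1r by simp
    have "\<forall>\<^sub>F \<zeta> in nhds (z + h1). dist \<zeta> (z + h1) < r - norm h1"
      using h1r unfolding eventually_nhds_metric by (intro exI[of _ "r - norm h1"]) auto
    then show "\<forall>\<^sub>F \<zeta> in nhds (z + h1). w \<zeta> \<le> w (z + h1) + (\<xi> + H *v h1) \<bullet> (\<zeta> - (z + h1))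
        + (\<zeta> - (z + h1)) \<bullet> ((X + (4 * e) *\<^sub>R mat 1) *v (\<zeta> - (z + h1))) / 2"
    proof eventually_elim
      case (elim \<zeta>)
      define k where "k = \<zeta> - (z + h1)"
      have \<zeta>: "\<zeta> = z + (h1 + k)" by (simp add: k_def)
      have "norm (h1 + k) \<le> r" using elim norm_triangle_ineq[of h1 k] by (simp add: k_def dist_norm)
      from max[OF this] have "w \<zeta> \<le> w (z + h1) + (q (h1 + k) - q h1)" by (simp add: \<zeta>)
      also have "q (h1 + k) - q h1 = (\<xi> + H *v h1) \<bullet> k + k \<bullet> (H *v k) / 2"
        unfolding q_def H_def[symmetric] using symH[of h1 k]
        by (simp add: matrix_vector_right_distrib inner_simps inner_commute field_simps)
      finally show ?case by (simp add: k_def H_def)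
    qed
  qed
qed

section \<open>Second order expansions at tilted maxima\<close>

lemma paraboloid_slope_identity:
  fixes x y z :: "'a::real_inner"
  shows "k - c * (norm (x - y))\<^sup>2
    = k - c * (norm (x - z))\<^sup>2 + ((2 * c) *\<^sub>R (x - z)) \<bullet> (y - z) - c * (norm (y - z))\<^sup>2"
proof -
  have e: "x - y = (x - z) - (y - z)" by simp
  show ?thesis unfolding e dot_square_norm[symmetric]
    by (simp only: inner_simps) (simp add: algebra_simps inner_commute)
qed

text \<open>The paraboloids at \<open>z\<close> and at \<open>y\<close> bound
  \<open>w y - w z\<close> from below and from above, with locally bounded slopes; so
  \<open>w\<close> is locally Lipschitz.\<close>

lemma continuous_if_lower_paraboloids:
  fixes w :: "'a::real_inner \<Rightarrow> real"
  assumes c: "0 \<le> c" and low: "\<And>y z. w z + \<xi> z \<bullet> (y - z) - c * (norm (y - z))\<^sup>2 \<le> w y"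
    and bd: "\<And>z. norm (\<xi> z) \<le> a + b * norm z"
  shows "continuous_on UNIV w"
proof -
  have "isCont w z" for z
  proof -
    define B where "B = a + \<bar>b\<bar> * (norm z + 1) + c"
    have bound: "\<bar>w y - w z\<bar> \<le> B * norm (y - z)" if "norm (y - z) \<le> 1" for y
    proof -
      have sq: "c * (norm (y - z))\<^sup>2 \<le> c * norm (y - z)"
        using that c by (simp add: power2_eq_square mult_left_le_one_le mult_left_mono)
      have ny: "norm y \<le> norm z + 1" using that norm_triangle_ineq2[of y z] by linarith
      have \<xi>: "norm (\<xi> x) \<le> a + \<bar>b\<bar> * (norm z + 1)" if "norm x \<le> norm z + 1" for x
      proof -
        have "b * norm x \<le> \<bar>b\<bar> * norm x" by (intro mult_right_mono) auto
        also have "\<dots> \<le> \<bar>b\<bar> * (norm z + 1)" using that by (intro mult_left_mono) auto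
        finally show ?thesis using bd[of x] by linarith
      qed
      have cs: "\<bar>\<xi> x \<bullet> v\<bar> \<le> (a + \<bar>b\<bar> * (norm z + 1)) * norm v" if "norm x \<le> norm z + 1" for x v
        using Cauchy_Schwarz_ineq2[of "\<xi> x" v] mult_right_mono[OF \<xi>[OF that], of "norm v"] by simp
      have "\<bar>\<xi> z \<bullet> (y - z)\<bar> \<le> (a + \<bar>b\<bar> * (norm z + 1)) * norm (y - z)"
        "\<bar>\<xi> y \<bullet> (z - y)\<bar> \<le> (a + \<bar>b\<bar> * (norm z + 1)) * norm (y - z)"
        using cs[of z "y - z"] cs[OF ny, of "z - y"] by (simp_all add: norm_minus_commute)
      then show ?thesis
        using low[of z y] low[of y z] sq unfolding B_def distrib_right[of "a + \<bar>b\<bar> * (norm z + 1)" c]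
        by (simp add: norm_minus_commute abs_le_iff)
    qed
    have "(w \<longlongrightarrow> w z) (at z)"
    proof (rule LIM_zero_cancel, rule Lim_null_comparison)
      show "\<forall>\<^sub>F y in at z. norm (w y - w z) \<le> B * norm (y - z)"
        unfolding eventually_at by (intro exI[of _ 1]) (auto simp: dist_norm intro: bound)
      have "((\<lambda>y. B * norm (y - z)) \<longlongrightarrow> B * norm (z - z)) (at z)" by (intro tendsto_intros)
      then show "((\<lambda>y. B * norm (y - z)) \<longlongrightarrow> 0) (at z)" by simp
    qed
    then show ?thesis by (simp add: isCont_def)
  qed
  then show ?thesis by (simp add: continuous_at_imp_continuous_on)
qed

lemma continuous_if_second_diff_bounded:
  fixes g :: "'a::euclidean_space \<Rightarrow> real"
  assumes c: "\<And>x h. \<bar>g (x + h) + g (x - h) - 2 * g x\<bar> \<le> c * (norm h)\<^sup>2" and c0: "0 \<le> c"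
    and M: "\<And>y. \<bar>g y\<bar> \<le> M (norm y)" and mono: "\<And>s t. 0 \<le> s \<Longrightarrow> s \<le> t \<Longrightarrow> M s \<le> M t"
  shows "continuous_on UNIV g"
proof -
  have "isCont g x" for x
  proof -
    define R where "R = norm x + 1"
    have "(4 * M (R + 1) + c)-lipschitz_on (cball 0 R) g"
    proof (rule lipschitz_onI)
      fix y z :: 'a assume "y \<in> cball 0 R" "z \<in> cball 0 R"
      then show "dist (g y) (g z) \<le> (4 * M (R + 1) + c) * dist y z"
        using lipschitz_if_second_diff_bounded[OF c c0, of R "M (R + 1)" z y] M mono
        unfolding dist_norm real_norm_def by (meson order.trans mem_cball_0 norm_ge_zero)
    next
      have "0 \<le> M (R + 1)"
        using M[of 0] mono[of 0 "R + 1"] by (simp add: R_def)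
      then show "0 \<le> 4 * M (R + 1) + c" using c0 by simp
    qed
    then have "continuous_on (cball 0 R) g" by (rule lipschitz_on_continuous_on)
    then show ?thesis by (rule continuous_on_interior) (simp add: R_def)
  qed
  then show ?thesis by (simp add: continuous_at_imp_continuous_on)
qed

lemma global_max_exists:
  fixes s :: "'a::euclidean_space \<Rightarrow> real"
  assumes "continuous_on UNIV s" and decay: "\<And>z. norm z \<ge> R \<Longrightarrow> s z \<le> s 0"
  shows "\<exists>z. \<forall>y. s y \<le> s z"
proof -
  have "cball (0::'a) \<bar>R\<bar> \<noteq> {}" by simp
  then obtain z where z: "z \<in> cball 0 \<bar>R\<bar>" "\<And>y. y \<in> cball 0 \<bar>R\<bar> \<Longrightarrow> s y \<le> s z"
    using continuous_attains_sup[OF compact_cball _ continuous_on_subset[OF assms(1)]] by blast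
  have "s y \<le> s z" for y
  proof (cases "norm y \<le> \<bar>R\<bar>")
    case False
    then have "s y \<le> s 0" by (intro decay) linarith
    also have "\<dots> \<le> s z" by (rule z) simp
    finally show ?thesis .
  qed (use z in simp)
  then show ?thesis by blast
qed

text \<open>On the set of points where a tilted semiconvex function attains its maximum the tilting slope
  depends on the point in a Lipschitz way, and it takes all small values.\<close>

lemma not_negligible_tilted_maxima:
  fixes s :: "'a::euclidean_space \<Rightarrow> real"
  assumes c: "0 < c" and cont: "continuous_on UNIV s"
    and low: "\<And>y z. s z + T z \<bullet> (y - z) - c * (norm (y - z))\<^sup>2 \<le> s y"
    and decay: "\<And>p. norm p < \<rho> \<Longrightarrow> \<exists>R. \<forall>z. norm z \<ge> R \<longrightarrow> s z - p \<bullet> z \<le> s 0"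
    and \<rho>: "0 < \<rho>"
  shows "\<not> negligible {z. norm (T z) < \<rho> \<and> (\<forall>y. s y \<le> s z + T z \<bullet> (y - z))}" (is "\<not> negligible ?K")
proof
  assume neg: "negligible ?K"
  have "ball 0 \<rho> \<subseteq> T ` ?K"
  proof
    fix p :: 'a assume "p \<in> ball 0 \<rho>"
    then have p: "norm p < \<rho>" by simp
    obtain R where R: "\<And>z. norm z \<ge> R \<Longrightarrow> s z - p \<bullet> z \<le> s 0" using decay[OF p] by blast
    have "\<exists>z. \<forall>y. s y - p \<bullet> y \<le> s z - p \<bullet> z"
      using R by (intro global_max_exists[of _ R] continuous_intros cont) simp_all
    then obtain z where z: "\<And>y. s y - p \<bullet> y \<le> s z - p \<bullet> z" by blast
    \<comment> \<open>At a maximum of \<open>s y - p \<bullet> y\<close> the paraboloid below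
      \<open>s\<close> admits no slope other than \<open>p\<close>.\<close>
    have "T z - p = 0"
    proof (rule slope_eq_if_quadratic_le[OF c])
      fix h
      show "(T z - p) \<bullet> h \<le> c * (norm h)\<^sup>2"
        using low[of z "z + h"] z[of "z + h"] by (simp add: inner_simps)
    qed
    then have "T z = p" by simp
    moreover have "s y \<le> s z + p \<bullet> (y - z)" for y using z[of y] by (simp add: inner_diff_right)
    ultimately show "p \<in> T ` ?K" using p by auto
  qed
  \<comment> \<open>Lipschitz maps of a Euclidean space into itself preserve null sets, whereas the
    image contains a ball.\<close>
  moreover have "negligible (T ` ?K)"
  proof (rule negligible_locally_Lipschitz_image[OF order_refl neg])
    fix x assume "x \<in> ?K"
    then show "\<exists>U B. open U \<and> x \<in> U \<and> (\<forall>y\<in>?K \<inter> U. norm (T y - T x) \<le> B * norm (y - x))"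
      using slope_lipschitz[OF c, of s x "T x" _ "T _"] low by (intro exI[of _ UNIV] exI[of _ "2 * c"]) auto
  qed
  ultimately have "negligible (ball (0::'a) \<rho>)" by (rule negligible_subset[rotated])
  then show False using \<rho> by (simp add: open_not_negligible)
qed

text \<open>Quadratic rescaling by \<open>(1/2)^k\<close> preserves the bounds on growth and on
  second differences and turns \<open>td\<close> into vanishing third differences in the limit. A
  convergent subsequence gives the expansion along some arbitrarily small radii, with one matrix
  \<open>X\<close> for all tolerances.\<close>

lemma blow_up_quadratic:
  fixes f :: "real^'n \<Rightarrow> real"
  assumes c: "\<And>x h. \<bar>f (x + h) + f (x - h) - 2 * f x\<bar> \<le> c * (norm h)\<^sup>2" and c0: "0 \<le> c"
    and slope: "\<And>h. \<bar>f (z + h) - f z - \<xi> \<bullet> h\<bar> \<le> c * (norm h)\<^sup>2"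
    and D: "countable D" "closure D = UNIV"
    and td: "\<And>\<eta> \<zeta>. \<eta> \<in> D \<Longrightarrow> \<zeta> \<in> D \<Longrightarrow>
      (\<lambda>k. 4^k * third_diff f (z + (1/2)^k *\<^sub>R \<eta>) ((1/2)^k *\<^sub>R \<zeta>)) \<longlonglongrightarrow> 0"
  obtains X where "X \<in> sym_matrices"
    "\<And>e \<delta>. 0 < e \<Longrightarrow> 0 < \<delta> \<Longrightarrow> \<exists>r>0. r < \<delta> \<and>
       (\<forall>h. norm h \<le> r \<longrightarrow> \<bar>f (z + h) - f z - \<xi> \<bullet> h - h \<bullet> (X *v h) / 2\<bar> \<le> e * r\<^sup>2)"
proof -
  define r :: "nat \<Rightarrow> real" where "r k = (1/2)^k" for k
  have r: "0 < r k" "4^k * (r k)\<^sup>2 = 1" for k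
    by (simp_all add: r_def power_mult_distrib[symmetric] power2_eq_square)
  define G where "G k h = 4^k * (f (z + r k *\<^sub>R h) - f z - r k * (\<xi> \<bullet> h))" for k :: nat and h
  have scale: "4^k * (c * (norm (r k *\<^sub>R h))\<^sup>2) = c * (norm h)\<^sup>2" for k and h :: "real^'n"
  proof -
    have "4^k * (c * (norm (r k *\<^sub>R h))\<^sup>2) = (4^k * (r k)\<^sup>2) * (c * (norm h)\<^sup>2)"
      using r by (simp add: power_mult_distrib)
    then show ?thesis unfolding r by simp
  qed
  have G1: "\<bar>G k (x + h) + G k (x - h) - 2 * G k x\<bar> \<le> c * (norm h)\<^sup>2" for k x h
  proof -
    have "G k (x + h) + G k (x - h) - 2 * G k x
        = 4^k * (f ((z + r k *\<^sub>R x) + r k *\<^sub>R h) + f ((z + r k *\<^sub>R x) - r k *\<^sub>R h) - 2 * f (z + r k *\<^sub>R x))"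
      by (simp add: G_def algebra_simps inner_simps)
    then have "\<bar>G k (x + h) + G k (x - h) - 2 * G k x\<bar> \<le> 4^k * (c * (norm (r k *\<^sub>R h))\<^sup>2)"
      using c[of "z + r k *\<^sub>R x" "r k *\<^sub>R h"] by (simp only: abs_mult) (simp add: mult_left_mono)
    then show ?thesis unfolding scale .
  qed
  have G2: "\<bar>G k h\<bar> \<le> c * (norm h)\<^sup>2" for k h
  proof -
    have "\<bar>G k h\<bar> \<le> 4^k * (c * (norm (r k *\<^sub>R h))\<^sup>2)"
      using slope[of "r k *\<^sub>R h"] unfolding G_def abs_mult by (simp add: mult_left_mono)
    then show ?thesis unfolding scale .
  qed
  have G3: "(\<lambda>k. third_diff (G k) \<eta> \<zeta>) \<longlonglongrightarrow> 0" if "\<eta> \<in> D" "\<zeta> \<in> D" for \<eta> \<zeta>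
  proof -
    have "third_diff (G k) \<eta> \<zeta> = 4^k * third_diff f (z + r k *\<^sub>R \<eta>) (r k *\<^sub>R \<zeta>)" for k
      by (simp add: third_diff_def G_def inner_simps algebra_simps)
    then show ?thesis using td[OF that] by (simp add: r_def)
  qed
  obtain \<sigma> X where \<sigma>: "strict_mono (\<sigma> :: nat \<Rightarrow> nat)" and X: "X \<in> sym_matrices"
    and unif: "\<And>e. 0 < e \<Longrightarrow> \<forall>\<^sub>F n in sequentially. \<forall>h. norm h \<le> 1 \<longrightarrow> \<bar>G (\<sigma> n) h - h \<bullet> (X *v h) / 2\<bar> \<le> e"
    using subsequence_tendsto_quadratic_form[OF G1 G2 c0 c0 D G3] by blast
  show ?thesis
  proof (rule that[OF X])
    fix e \<delta> :: real assume e: "0 < e" and \<delta>: "0 < \<delta>"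
    have "(\<lambda>n. r (\<sigma> n)) \<longlonglongrightarrow> 0"
    proof -
      have "r \<longlonglongrightarrow> 0" unfolding r_def by (rule LIMSEQ_realpow_zero) auto
      from LIMSEQ_subseq_LIMSEQ[OF this \<sigma>] show ?thesis by (simp add: o_def)
    qed
    from order_tendstoD(2)[OF this \<delta>] have "\<forall>\<^sub>F n in sequentially. r (\<sigma> n) < \<delta>" .
    with unif[OF e] have "\<forall>\<^sub>F n in sequentially. r (\<sigma> n) < \<delta> \<and> (\<forall>h. norm h \<le> 1 \<longrightarrow> \<bar>G (\<sigma> n) h - h \<bullet> (X *v h) / 2\<bar> \<le> e)"
      by eventually_elim simp
    then obtain k where k: "r k < \<delta>" "\<And>h. norm h \<le> 1 \<Longrightarrow> \<bar>G k h - h \<bullet> (X *v h) / 2\<bar> \<le> e"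
      by (auto dest: eventually_happens)
    show "\<exists>r>0. r < \<delta> \<and> (\<forall>h. norm h \<le> r \<longrightarrow> \<bar>f (z + h) - f z - \<xi> \<bullet> h - h \<bullet> (X *v h) / 2\<bar> \<le> e * r\<^sup>2)"
    proof (intro exI[of _ "r k"] conjI allI impI r k)
      fix h :: "real^'n" assume h: "norm h \<le> r k"
      define u where "u = (1 / r k) *\<^sub>R h"
      have hu: "h = r k *\<^sub>R u" using r(1)[of k] by (simp add: u_def)
      have "norm u \<le> 1" using h r(1)[of k] by (simp add: u_def divide_le_eq)
      from k(2)[OF this] have "\<bar>G k u - u \<bullet> (X *v u) / 2\<bar> * (r k)\<^sup>2 \<le> e * (r k)\<^sup>2" by (intro mult_right_mono) auto
      moreover have "(G k u - u \<bullet> (X *v u) / 2) * (r k)\<^sup>2 = f (z + h) - f z - \<xi> \<bullet> h - h \<bullet> (X *v h) / 2"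
      proof -
        have "G k u * (r k)\<^sup>2 = (4^k * (r k)\<^sup>2) * (f (z + h) - f z - \<xi> \<bullet> h)"
          by (simp add: G_def hu)
        moreover have "(u \<bullet> (X *v u)) * (r k)\<^sup>2 = h \<bullet> (X *v h)"
          by (simp add: hu matrix_vector_mult_scaleR power2_eq_square)
        ultimately show ?thesis unfolding r by (simp add: left_diff_distrib)
      qed
      ultimately show "\<bar>f (z + h) - f z - \<xi> \<bullet> h - h \<bullet> (X *v h) / 2\<bar> \<le> e * (r k)\<^sup>2"
        by (metis abs_mult abs_power2)
    qed
  qed
qed

text \<open>The envelope \<open>f\<close> of \<open>w\<^sub>1\<close> lies between \<open>w\<^sub>1\<close> and every \<open>l - w\<^sub>2\<close>, where \<open>l\<close> is an affine
  majorant of \<open>w\<^sub>1 + w\<^sub>2\<close>. At a point where the three functions agree, a second order expansion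
  of \<open>f\<close> with matrix \<open>X\<close> thus bounds \<open>w\<^sub>1\<close> with \<open>X\<close> and \<open>w\<^sub>2\<close> with \<open>-X\<close> simultaneously.\<close>

lemma maximum_principle_semiconvex:
  fixes w1 w2 :: "real^'n \<Rightarrow> real"
  assumes c: "0 < c"
    and low1: "\<And>y z. w1 z + \<xi>1 z \<bullet> (y - z) - c * (norm (y - z))\<^sup>2 \<le> w1 y"
    and low2: "\<And>y z. w2 z + \<xi>2 z \<bullet> (y - z) - c * (norm (y - z))\<^sup>2 \<le> w2 y"
    and bd1: "\<And>z. norm (\<xi>1 z) \<le> a + b * norm z" and bd2: "\<And>z. norm (\<xi>2 z) \<le> a + b * norm z"
    and up: "\<And>y. w1 y \<le> M"
    and decay: "\<And>p. norm p < \<rho> \<Longrightarrow> \<exists>R. \<forall>z. norm z \<ge> R \<longrightarrow> w1 z + w2 z - p \<bullet> z \<le> w1 0 + w2 0"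
    and \<rho>: "0 < \<rho>" and e: "0 < e" and \<delta>: "0 < \<delta>"
  obtains z z1 z2 p1 p2 X where "norm (\<xi>1 z + \<xi>2 z) < \<rho>"
    "\<And>y. w1 y + w2 y \<le> w1 z + w2 z + (\<xi>1 z + \<xi>2 z) \<bullet> (y - z)"
    "X \<in> sym_matrices" "norm (z1 - z) < \<delta>" "norm (z2 - z) < \<delta>"
    "\<bar>w1 z1 - w1 z\<bar> < \<delta>" "\<bar>w2 z2 - w2 z\<bar> < \<delta>"
    "\<forall>\<^sub>F \<zeta> in nhds z1. w1 \<zeta> \<le> w1 z1 + p1 \<bullet> (\<zeta> - z1) + (\<zeta> - z1) \<bullet> ((X + e *\<^sub>R mat 1) *v (\<zeta> - z1)) / 2"
    "\<forall>\<^sub>F \<zeta> in nhds z2. w2 \<zeta> \<le> w2 z2 + p2 \<bullet> (\<zeta> - z2) + (\<zeta> - z2) \<bullet> ((- X + e *\<^sub>R mat 1) *v (\<zeta> - z2)) / 2"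
proof -
  have cont1: "continuous_on UNIV w1"
    by (rule continuous_if_lower_paraboloids[OF less_imp_le[OF c] low1 bd1])
  have cont2: "continuous_on UNIV w2"
    by (rule continuous_if_lower_paraboloids[OF less_imp_le[OF c] low2 bd2])
  define f where "f = par_env c w1"
  define T where "T z = \<xi>1 z + \<xi>2 z" for z
  have up': "w1 y \<le> M + c * (norm (y - 0))\<^sup>2" for y
    using up[of y] c by (simp add: add_increasing2)
  have w1f: "w1 x \<le> f x" for x unfolding f_def by (rule le_par_env[OF up'])
  have sc1: "2 * w1 y - 2 * c * (norm k)\<^sup>2 \<le> w1 (y + k) + w1 (y - k)" for y k
    using low1[of y "y + k"] low1[of y "y - k"] by simp
  have f2: "\<bar>f (x + h) + f (x - h) - 2 * f x\<bar> \<le> 2 * c * (norm h)\<^sup>2" for x h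
    using par_env_second_diff_ge[OF c up' sc1, of x h] par_env_second_diff_le[OF c up', of x h]
    unfolding f_def by linarith
  have contf: "continuous_on UNIV f"
  proof (rule continuous_if_second_diff_bounded[OF f2])
    define P where "P s = \<bar>M\<bar> + \<bar>w1 0\<bar> + norm (\<xi>1 0) * s + c * s\<^sup>2" for s :: real
    show "\<bar>f y\<bar> \<le> P (norm y)" for y
    proof -
      have "f y \<le> M + c * (norm y)\<^sup>2"
        using par_env_le[of w1 M c 0 y, OF up'] by (simp add: f_def)
      moreover have "w1 0 - norm (\<xi>1 0) * norm y - c * (norm y)\<^sup>2 \<le> f y"
        using low1[of 0 y] w1f[of y] Cauchy_Schwarz_ineq2[of "\<xi>1 0" y] by simp
      moreover have "0 \<le> norm (\<xi>1 0) * norm y" "0 \<le> c * (norm y)\<^sup>2" using c by simp_all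
      ultimately show ?thesis unfolding P_def by linarith
    qed
    show "P s \<le> P t" if "0 \<le> s" "s \<le> t" for s t
      using that c unfolding P_def by (intro add_mono mult_left_mono power_mono) auto
  qed (use c in simp)
  obtain D :: "(real^'n) set" where D: "countable D" "closure D = UNIV"
  proof -
    obtain D :: "(real^'n) set" where "countable D" "\<And>X. open X \<Longrightarrow> X \<noteq> {} \<Longrightarrow> \<exists>d\<in>D. d \<in> X"
      using countable_dense_setE by blast
    have "x \<in> closure D" for x
      unfolding closure_approachable
    proof (intro allI impI)
      fix e :: real assume "0 < e"
      then obtain d where "d \<in> D" "d \<in> ball x e"
        using \<open>\<And>X. open X \<Longrightarrow> X \<noteq> {} \<Longrightarrow> \<exists>d\<in>D. d \<in> X\<close>[of "ball x e"] by auto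
      then show "\<exists>y\<in>D. dist y x < e" by (auto simp: dist_commute)
    qed
    then show thesis using that \<open>countable D\<close> by blast
  qed
  have "AE z in lborel. \<forall>\<eta>\<in>D. \<forall>\<zeta>\<in>D. (\<lambda>k. 4^k * third_diff f (z + (1/2)^k *\<^sub>R \<eta>) ((1/2)^k *\<^sub>R \<zeta>)) \<longlonglongrightarrow> 0"
    using D(1) by (intro AE_ball_countable[THEN iffD2] ballI AE_scaled_third_diff_tendsto_0[OF contf f2])
  then obtain N where N: "N \<in> null_sets lborel"
    and td: "\<And>z. z \<notin> N \<Longrightarrow> \<forall>\<eta>\<in>D. \<forall>\<zeta>\<in>D. (\<lambda>k. 4^k * third_diff f (z + (1/2)^k *\<^sub>R \<eta>) ((1/2)^k *\<^sub>R \<zeta>)) \<longlonglongrightarrow> 0"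
    by (auto elim!: AE_E3)
  have "negligible N" using N by (simp add: negligible_iff_null_sets null_sets_completionI)
  \<comment> \<open>A set that is not negligible cannot lie in the null set \<open>N\<close>, so
    some tilted maximum is also a point of decay for the third differences of the envelope. The
    semiconvexity constants of \<open>w1\<close> and \<open>w2\<close> add up to
    \<open>2 * c\<close>.\<close>
  moreover have "\<not> negligible {z. norm (T z) < \<rho> \<and> (\<forall>y. w1 y + w2 y \<le> w1 z + w2 z + T z \<bullet> (y - z))}"
  proof (rule not_negligible_tilted_maxima[where c = "2 * c"])
    show "w1 z + w2 z + T z \<bullet> (y - z) - 2 * c * (norm (y - z))\<^sup>2 \<le> w1 y + w2 y" for y z
      using low1[of z y] low2[of z y] by (simp add: T_def inner_add_left)
    show "continuous_on UNIV (\<lambda>y. w1 y + w2 y)" by (intro continuous_intros cont1 cont2)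
  qed (use c decay \<rho> in simp_all)
  ultimately have "\<not> {z. norm (T z) < \<rho> \<and> (\<forall>y. w1 y + w2 y \<le> w1 z + w2 z + T z \<bullet> (y - z))} \<subseteq> N"
    by (meson negligible_subset)
  then obtain z where zN: "z \<notin> N" and Tz: "norm (T z) < \<rho>"
    and max: "\<And>y. w1 y + w2 y \<le> w1 z + w2 z + T z \<bullet> (y - z)"
    unfolding subset_iff mem_Collect_eq by metis
  have fw2: "f x + w2 x \<le> w1 z + w2 z + T z \<bullet> (x - z)" for x
  proof -
    \<comment> \<open>In the affine bound for \<open>w1 + w2\<close>, the summand \<open>w2\<close>
      is replaced by its lower paraboloid at \<open>x\<close>. The resulting bound on
      \<open>w1\<close> is a paraboloid of opening \<open>c\<close>, hence a competitor for the
      envelope.\<close>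
    have "w1 y \<le> (w1 z + w2 z + T z \<bullet> (x - z) - w2 x) + (T z - \<xi>2 x) \<bullet> (y - x) + c * (norm (y - x))\<^sup>2" for y
      using max[of y] low2[of x y] by (simp add: inner_simps)
    from par_env_le_slope[OF c this, of x] show ?thesis by (simp add: f_def)
  qed
  have fz: "f z = w1 z" using fw2[of z] w1f[of z] by simp
  \<comment> \<open>At \<open>z\<close> the envelope is pinched between the lower paraboloid of
    \<open>w1\<close> and a paraboloid above it that comes from \<open>w2\<close>; both have slope
    \<open>\<xi>1 z\<close>.\<close>
  have slope: "\<bar>f (z + h) - f z - \<xi>1 z \<bullet> h\<bar> \<le> 2 * c * (norm h)\<^sup>2" for h
  proof -
    have "f (z + h) \<le> w1 z + \<xi>1 z \<bullet> h + c * (norm h)\<^sup>2"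
      using fw2[of "z + h"] low2[of z "z + h"] by (simp add: T_def inner_simps)
    moreover have "w1 z + \<xi>1 z \<bullet> h - c * (norm h)\<^sup>2 \<le> f (z + h)"
      using low1[of z "z + h"] w1f[of "z + h"] by simp
    moreover have "0 \<le> c * (norm h)\<^sup>2" using c by simp
    ultimately show ?thesis unfolding fz by linarith
  qed
  obtain X where X: "X \<in> sym_matrices"
    and expand: "\<And>e \<delta>. 0 < e \<Longrightarrow> 0 < \<delta> \<Longrightarrow> \<exists>r>0. r < \<delta> \<and>
       (\<forall>h. norm h \<le> r \<longrightarrow> \<bar>f (z + h) - f z - \<xi>1 z \<bullet> h - h \<bullet> (X *v h) / 2\<bar> \<le> e * r\<^sup>2)"
  proof (rule blow_up_quadratic[OF f2 _ slope D])
    show "0 \<le> 2 * c" using c by simp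
  qed (use td[OF zN] in auto)
  have "isCont w1 z" "isCont w2 z" using cont1 cont2 by (simp_all add: continuous_on_eq_continuous_at)
  then obtain d1 d2 where d: "0 < d1" "0 < d2" "\<And>y. norm (y - z) < d1 \<Longrightarrow> \<bar>w1 y - w1 z\<bar> < \<delta>"
    "\<And>y. norm (y - z) < d2 \<Longrightarrow> \<bar>w2 y - w2 z\<bar> < \<delta>"
    using \<delta> unfolding continuous_at_eps_delta dist_norm real_norm_def by blast
  \<comment> \<open>The tolerance is \<open>e / 4\<close> because touching paraboloids enlarge the
    matrix by four times the tolerance.\<close>
  obtain r where r: "0 < r" "r < min \<delta> (min d1 d2)"
    and ex: "\<And>h. norm h \<le> r \<Longrightarrow> \<bar>f (z + h) - f z - \<xi>1 z \<bullet> h - h \<bullet> (X *v h) / 2\<bar> \<le> (e / 4) * r\<^sup>2"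
    using expand[of "e / 4" "min \<delta> (min d1 d2)"] e \<delta> d by auto
  have le1: "w1 (z + h) \<le> w1 z + \<xi>1 z \<bullet> h + h \<bullet> (X *v h) / 2 + (e / 4) * r\<^sup>2" if "norm h \<le> r" for h
    using ex[OF that] w1f[of "z + h"] unfolding fz by linarith
  have le2: "w2 (z + h) \<le> w2 z + \<xi>2 z \<bullet> h + h \<bullet> ((- X) *v h) / 2 + (e / 4) * r\<^sup>2" if "norm h \<le> r" for h
  proof -
    have "T z \<bullet> h = \<xi>1 z \<bullet> h + \<xi>2 z \<bullet> h" by (simp add: T_def inner_add_left)
    moreover have "h \<bullet> ((- X) *v h) / 2 = - (h \<bullet> (X *v h) / 2)"
      using matrix_vector_mult_diff_rdistrib[of 0 X h] by simp
    moreover have "f (z + h) + w2 (z + h) \<le> w1 z + w2 z + T z \<bullet> h" using fw2[of "z + h"] by simp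
    ultimately show ?thesis using ex[OF that] unfolding fz by linarith
  qed
  have e4: "0 < e / 4" "4 * (e / 4) = e" using e by simp_all
  have X': "- X \<in> sym_matrices" using X by (simp add: sym_matrices_def transpose_def vec_eq_iff)
  obtain z1 p1 where z1: "norm (z1 - z) < r"
    "\<forall>\<^sub>F \<zeta> in nhds z1. w1 \<zeta> \<le> w1 z1 + p1 \<bullet> (\<zeta> - z1) + (\<zeta> - z1) \<bullet> ((X + e *\<^sub>R mat 1) *v (\<zeta> - z1)) / 2"
    using touching_paraboloid[OF cont1 r(1) e4(1) le1 X] unfolding e4 by blast
  obtain z2 p2 where z2: "norm (z2 - z) < r"
    "\<forall>\<^sub>F \<zeta> in nhds z2. w2 \<zeta> \<le> w2 z2 + p2 \<bullet> (\<zeta> - z2) + (\<zeta> - z2) \<bullet> ((- X + e *\<^sub>R mat 1) *v (\<zeta> - z2)) / 2"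
    using touching_paraboloid[OF cont2 r(1) e4(1) le2 X'] unfolding e4 by blast
  show ?thesis
    by (rule that[of z X z1 z2 p1 p2]) (use Tz max X z1 z2 r d in \<open>auto simp: T_def\<close>)
qed

section \<open>Jets of doubled variables\<close>

lemma usc_on_add_continuous:
  assumes "usc_on S f" and "continuous_on S h"
  shows "usc_on S (\<lambda>x. f x + h x :: real)"
  unfolding usc_on_def
proof (intro ballI allI impI)
  fix x k assume x: "x \<in> S" and lt: "f x + h x < k"
  define e where "e = (k - f x - h x) / 2"
  have e: "0 < e" using lt by (simp add: e_def)
  have "\<forall>\<^sub>F y in at x within S. f y < f x + e"
    using assms(1) x e by (simp add: usc_on_def)
  moreover have "\<forall>\<^sub>F y in at x within S. h y < h x + e"
    using assms(2) x e by (intro order_tendstoD(2)[of h "h x"]) (auto simp: continuous_on_def)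
  ultimately show "\<forall>\<^sub>F y in at x within S. f y + h y < k"
  proof eventually_elim
    case (elim y)
    then have "f y + h y < f x + h x + 2 * e" by linarith
    moreover have "f x + h x + 2 * e = k" by (simp add: e_def field_simps)
    ultimately show ?case by simp
  qed
qed

text \<open>Without a maximum, compactness lets finitely many of the relatively open sets where
  \<open>f\<close> is below \<open>f y\<close> cover \<open>S\<close>. The index with the largest
  value would then lie in one of them, which is absurd.\<close>

lemma usc_on_attains_max:
  assumes "compact S" "S \<noteq> {}" "usc_on S f"
  shows "\<exists>x\<in>S. \<forall>y\<in>S. f y \<le> f x"
proof (rule ccontr)
  assume "\<not> ?thesis"
  then have none: "\<exists>y\<in>S. f x < f y" if "x \<in> S" for x using that by force
  have "\<exists>T. open T \<and> T \<inter> S = {z\<in>S. f z < f y}" if "y \<in> S" for y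
  proof -
    have "openin (top_of_set S) {z\<in>S. f z < f y}"
    proof (subst openin_subopen, intro ballI)
      fix z assume "z \<in> {z\<in>S. f z < f y}"
      then have z: "z \<in> S" "f z < f y" by auto
      then have "\<forall>\<^sub>F u in at z within S. f u < f y" using assms(3) by (simp add: usc_on_def)
      then obtain U where "open U" "z \<in> U" "\<forall>u\<in>U. u \<noteq> z \<longrightarrow> u \<in> S \<longrightarrow> f u < f y"
        unfolding eventually_at_topological by blast
      then show "\<exists>T. openin (top_of_set S) T \<and> z \<in> T \<and> T \<subseteq> {z\<in>S. f z < f y}"
        using z by (intro exI[of _ "S \<inter> U"]) auto
    qed
    then show ?thesis by (auto simp: openin_open)
  qed
  then obtain T where T: "\<And>y. y \<in> S \<Longrightarrow> open (T y)" "\<And>y. y \<in> S \<Longrightarrow> T y \<inter> S = {z\<in>S. f z < f y}"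
    by metis
  have "S \<subseteq> (\<Union>y\<in>S. T y)" using none T(2) by blast
  then obtain C where C: "C \<subseteq> S" "finite C" "S \<subseteq> (\<Union>y\<in>C. T y)"
    using compactE_image[OF assms(1), of S T] T(1) by metis
  then have "C \<noteq> {}" using assms(2) by auto
  then have "Max (f ` C) \<in> f ` C" using C(2) by (intro Max_in) auto
  then obtain y where y: "y \<in> C" "f y = Max (f ` C)" by auto
  have y_max: "f z \<le> f y" if "z \<in> C" for z using that C(2) unfolding y(2) by (intro Max_ge) auto
  then obtain z where "z \<in> C" "y \<in> T z" using C y(1) by blast
  then have "f y < f z" using T(2)[of z] C(1) y(1) by blast
  then show False using y_max[OF \<open>z \<in> C\<close>] by simp
qed

text \<open>\<open>H\<close> is the matrix of a superjet at \<open>z\<close> of the sup-convolution of \<open>f\<close> over \<open>Q\<close>, where the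
  supremum defining its value at \<open>z\<close> is attained at \<open>x\<close>.\<close>

definition supconv_jet :: "(real^'n) set \<Rightarrow> (real^'n \<Rightarrow> real) \<Rightarrow> real \<Rightarrow> real^'n \<Rightarrow> real^'n \<Rightarrow> real^'n^'n \<Rightarrow> bool" where
  "supconv_jet Q f c x z H \<longleftrightarrow> (\<exists>p. \<forall>\<^sub>F \<zeta> in nhds z. \<forall>x'\<in>Q. f x' - c * (norm (x' - \<zeta>))\<^sup>2
     \<le> f x - c * (norm (x - z))\<^sup>2 + p \<bullet> (\<zeta> - z) + (\<zeta> - z) \<bullet> (H *v (\<zeta> - z)) / 2)"

text \<open>The sum of the two sup-convolutions at \<open>z\<close> is the maximum over
  \<open>x\<close>, \<open>y\<close> of \<open>f x + g y\<close> minus the penalties for the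
  distances to the common point \<open>z\<close>. The maximum principle for semiconvex functions
  yields the matrices; its contact points \<open>z1\<close> and \<open>z2\<close> are only near
  \<open>z\<close>, whence the tolerance \<open>\<kappa>\<close>.\<close>

lemma doubling_jets:
  fixes f g :: "real^'n \<Rightarrow> real"
  assumes Q: "compact Q" "Q \<noteq> {}" and f: "usc_on Q f" and g: "usc_on Q g"
    and c: "0 < c" and \<kappa>: "0 < \<kappa>" and \<eta>: "0 < \<eta>"
  obtains x y z1 z2 H1 H2 where "x \<in> Q" "y \<in> Q" "H1 \<in> sym_matrices" "H2 \<in> sym_matrices"
    "\<And>v. v \<bullet> (H1 *v v) + v \<bullet> (H2 *v v) \<le> \<eta> * (norm v)\<^sup>2" "norm (z1 - z2) \<le> \<kappa>"
    "\<And>a. a \<in> Q \<Longrightarrow> f a + g a - \<kappa> \<le> f x - c * (norm (x - z1))\<^sup>2 + (g y - c * (norm (y - z2))\<^sup>2)"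
    "supconv_jet Q f c x z1 H1" "supconv_jet Q g c y z2 H2"
proof -
  have sup: "\<exists>X. \<forall>z. X z \<in> Q \<and> (\<forall>x\<in>Q. h x - c * (norm (x - z))\<^sup>2 \<le> h (X z) - c * (norm (X z - z))\<^sup>2)"
    if "usc_on Q h" for h :: "real^'n \<Rightarrow> real"
  proof (intro choice allI)
    fix z
    have "usc_on Q (\<lambda>x. h x + (- c * (norm (x - z))\<^sup>2))"
      by (intro usc_on_add_continuous that continuous_intros)
    from usc_on_attains_max[OF Q this]
    show "\<exists>x. x \<in> Q \<and> (\<forall>y\<in>Q. h y - c * (norm (y - z))\<^sup>2 \<le> h x - c * (norm (x - z))\<^sup>2)" by auto
  qed
  obtain X1 where X1: "\<And>z. X1 z \<in> Q" "\<And>x z. x \<in> Q \<Longrightarrow> f x - c * (norm (x - z))\<^sup>2 \<le> f (X1 z) - c * (norm (X1 z - z))\<^sup>2"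
    using sup[OF f] by blast
  obtain X2 where X2: "\<And>z. X2 z \<in> Q" "\<And>x z. x \<in> Q \<Longrightarrow> g x - c * (norm (x - z))\<^sup>2 \<le> g (X2 z) - c * (norm (X2 z - z))\<^sup>2"
    using sup[OF g] by blast
  obtain R where R: "0 < R" "\<And>x. x \<in> Q \<Longrightarrow> norm x \<le> R"
    using compact_imp_bounded[OF Q(1)] unfolding bounded_pos by blast
  obtain M1 M2 where M: "\<And>x. x \<in> Q \<Longrightarrow> f x \<le> M1" "\<And>x. x \<in> Q \<Longrightarrow> g x \<le> M2"
    using usc_on_attains_max[OF Q f] usc_on_attains_max[OF Q g] by blast
  define w1 where "w1 z = f (X1 z) - c * (norm (X1 z - z))\<^sup>2" for z
  define w2 where "w2 z = g (X2 z) - c * (norm (X2 z - z))\<^sup>2" for z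
  \<comment> \<open>Freezing the maximiser for \<open>z\<close> gives a paraboloid below the
    sup-convolution that touches it at \<open>z\<close>; \<open>\<xi>1\<close> and
    \<open>\<xi>2\<close> are the slopes there.\<close>
  define \<xi>1 where "\<xi>1 z = (2 * c) *\<^sub>R (X1 z - z)" for z
  define \<xi>2 where "\<xi>2 z = (2 * c) *\<^sub>R (X2 z - z)" for z
  have low1: "w1 z + \<xi>1 z \<bullet> (y - z) - c * (norm (y - z))\<^sup>2 \<le> w1 y" for y z
    using X1(2)[OF X1(1)[of z], of y] paraboloid_slope_identity[of "f (X1 z)" c "X1 z" y z]
    unfolding w1_def \<xi>1_def by linarith
  have low2: "w2 z + \<xi>2 z \<bullet> (y - z) - c * (norm (y - z))\<^sup>2 \<le> w2 y" for y z
    using X2(2)[OF X2(1)[of z], of y] paraboloid_slope_identity[of "g (X2 z)" c "X2 z" y z]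
    unfolding w2_def \<xi>2_def by linarith
  have bd: "norm ((2 * c) *\<^sub>R (x - z)) \<le> 2 * c * R + 2 * c * norm z" if "x \<in> Q" for x z
  proof -
    have "norm (x - z) \<le> R + norm z" using R(2)[OF that] norm_triangle_ineq4[of x z] by linarith
    then have "2 * c * norm (x - z) \<le> 2 * c * (R + norm z)" using c by (intro mult_left_mono) auto
    then show ?thesis using c by (simp add: distrib_left)
  qed
  have bd1: "norm (\<xi>1 z) \<le> 2 * c * R + 2 * c * norm z" and bd2: "norm (\<xi>2 z) \<le> 2 * c * R + 2 * c * norm z" for z
    unfolding \<xi>1_def \<xi>2_def by (rule bd[OF X1(1)], rule bd[OF X2(1)])
  have up1: "w1 y \<le> M1" for y
    using M(1)[OF X1(1)[of y]] c unfolding w1_def by (smt (verit) mult_nonneg_nonneg zero_le_power2)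
  have up2: "w2 y \<le> M2" for y
    using M(2)[OF X2(1)[of y]] c unfolding w2_def by (smt (verit) mult_nonneg_nonneg zero_le_power2)
  define L where "L = 2 * R + 1 / (4 * c)"
  have L: "0 < L" using R c by (simp add: L_def add_pos_pos)
  \<comment> \<open>\<open>\<rho> \<le> 1\<close> serves to locate \<open>z\<close>. As
    \<open>L\<close> will bound the distance of \<open>z\<close> to the points of \<open>Q\<close>,
    the second bound limits the effect of the tilt on \<open>Q\<close> to
    \<open>\<kappa> / 2\<close>.\<close>
  define \<rho> where "\<rho> = min 1 (\<kappa> / (2 * L))"
  have \<rho>: "0 < \<rho>" "\<rho> \<le> 1" "\<rho> * L \<le> \<kappa> / 2"
    using \<kappa> L by (auto simp: \<rho>_def min_def field_simps)
  have decay: "\<exists>r. \<forall>z. norm z \<ge> r \<longrightarrow> w1 z + w2 z - p \<bullet> z \<le> w1 0 + w2 0" if p: "norm p < \<rho>" for p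
  proof -
    define B where "B = M1 + M2 + R - (w1 0 + w2 0)"
    \<comment> \<open>Far from \<open>Q\<close> the penalty is at least \<open>2 * \<tau>\<close>,
      while the tilt contributes at most \<open>\<tau> + R\<close>.\<close>
    have "w1 z + w2 z - p \<bullet> z \<le> w1 0 + w2 0" if z: "norm z \<ge> R + 2 / c + \<bar>B\<bar>" for z
    proof -
      define \<tau> where "\<tau> = norm z - R"
      have "0 < 2 / c" using c by simp
      then have \<tau>: "2 / c \<le> \<tau>" "\<bar>B\<bar> \<le> \<tau>" "0 < \<tau>" using z unfolding \<tau>_def by linarith+
      have "\<tau> \<le> norm (X1 z - z)"
        using R(2)[OF X1(1)[of z]] norm_triangle_ineq2[of z "X1 z"] unfolding \<tau>_def
        by (simp add: norm_minus_commute)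
      then have "\<tau>\<^sup>2 \<le> (norm (X1 z - z))\<^sup>2" using \<tau> by (intro power_mono) auto
      then have "c * \<tau>\<^sup>2 \<le> c * (norm (X1 z - z))\<^sup>2" using c by simp
      then have 1: "w1 z \<le> M1 - c * \<tau>\<^sup>2" using M(1)[OF X1(1)[of z]] unfolding w1_def by linarith
      have "2 \<le> c * \<tau>" using \<tau>(1) c by (simp add: field_simps)
      then have "2 * \<tau> \<le> (c * \<tau>) * \<tau>" using \<tau> by (intro mult_right_mono) auto
      then have 2: "2 * \<tau> \<le> c * \<tau>\<^sup>2" by (simp add: power2_eq_square)
      have "\<bar>p \<bullet> z\<bar> \<le> norm p * norm z" by (rule Cauchy_Schwarz_ineq2)
      also have "\<dots> \<le> 1 * norm z" using p \<rho> by (intro mult_right_mono) auto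
      finally have "- (p \<bullet> z) \<le> \<tau> + R" unfolding \<tau>_def by linarith
      then show ?thesis using 1 2 up2[of z] \<tau> unfolding B_def by linarith
    qed
    then show ?thesis by blast
  qed
  have \<eta>2: "0 < \<eta> / 2" and \<kappa>4: "0 < \<kappa> / 4" using \<eta> \<kappa> by simp_all
  obtain z z1 z2 p1 p2 X where z: "norm (\<xi>1 z + \<xi>2 z) < \<rho>"
    "\<And>y. w1 y + w2 y \<le> w1 z + w2 z + (\<xi>1 z + \<xi>2 z) \<bullet> (y - z)"
    and X: "X \<in> sym_matrices" and zz: "norm (z1 - z) < \<kappa> / 4" "norm (z2 - z) < \<kappa> / 4"
    "\<bar>w1 z1 - w1 z\<bar> < \<kappa> / 4" "\<bar>w2 z2 - w2 z\<bar> < \<kappa> / 4"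
    and touch1: "\<forall>\<^sub>F \<zeta> in nhds z1. w1 \<zeta> \<le> w1 z1 + p1 \<bullet> (\<zeta> - z1) + (\<zeta> - z1) \<bullet> ((X + (\<eta>/2) *\<^sub>R mat 1) *v (\<zeta> - z1)) / 2"
    and touch2: "\<forall>\<^sub>F \<zeta> in nhds z2. w2 \<zeta> \<le> w2 z2 + p2 \<bullet> (\<zeta> - z2) + (\<zeta> - z2) \<bullet> ((- X + (\<eta>/2) *\<^sub>R mat 1) *v (\<zeta> - z2)) / 2"
  proof (rule maximum_principle_semiconvex[OF c low1 low2 bd1 bd2 up1 _ \<rho>(1) \<eta>2 \<kappa>4])
    show "\<exists>r. \<forall>z. norm z \<ge> r \<longrightarrow> w1 z + w2 z - p \<bullet> z \<le> w1 0 + w2 0" if "norm p < \<rho>" for p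
      using that by (rule decay)
  qed (rule that)
  \<comment> \<open>The slope at \<open>z\<close> is \<open>2 * c\<close> times
    \<open>X1 z + X2 z - 2z\<close>. Being shorter than 1, it places \<open>z\<close> within
    \<open>1 / (4 * c)\<close> of the midpoint of two points of \<open>Q\<close>.\<close>
  have normz: "norm z \<le> R + 1 / (4 * c)"
  proof -
    have "(4 * c) *\<^sub>R z = (2 * c) *\<^sub>R X1 z + (2 * c) *\<^sub>R X2 z - (\<xi>1 z + \<xi>2 z)"
    proof -
      have "(4 * c) *\<^sub>R z = (2 * c) *\<^sub>R z + (2 * c) *\<^sub>R z" by (simp flip: scaleR_add_left)
      then show ?thesis by (simp add: \<xi>1_def \<xi>2_def scaleR_right_diff_distrib)
    qed
    moreover have "norm (u + v - t) \<le> norm u + norm v + norm t" for u v t :: "real^'n"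
      using norm_triangle_ineq4[of "u + v" t] norm_triangle_ineq[of u v] by linarith
    ultimately have "norm ((4 * c) *\<^sub>R z) \<le> norm ((2 * c) *\<^sub>R X1 z) + norm ((2 * c) *\<^sub>R X2 z) + norm (\<xi>1 z + \<xi>2 z)"
      by (simp only:)
    also have "\<dots> \<le> 2 * c * R + 2 * c * R + 1"
      using R(2)[OF X1(1)[of z]] R(2)[OF X2(1)[of z]] z(1) \<rho>(2) c by (intro add_mono) auto
    finally show ?thesis using c by (simp add: field_simps)
  qed
  show ?thesis
  proof (rule that)
    show "X1 z1 \<in> Q" "X2 z2 \<in> Q" by (rule X1 X2)+
    show "X + (\<eta>/2) *\<^sub>R mat 1 \<in> sym_matrices"
      by (intro sym_matrices_add sym_matrices_scaled_id X)
    have "- X \<in> sym_matrices" using X by (simp add: sym_matrices_def transpose_def vec_eq_iff)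
    then show "- X + (\<eta>/2) *\<^sub>R mat 1 \<in> sym_matrices"
      by (intro sym_matrices_add sym_matrices_scaled_id)
    show "v \<bullet> ((X + (\<eta>/2) *\<^sub>R mat 1) *v v) + v \<bullet> ((- X + (\<eta>/2) *\<^sub>R mat 1) *v v) \<le> \<eta> * (norm v)\<^sup>2" for v
    proof -
      have "v \<bullet> ((X + (\<eta>/2) *\<^sub>R mat 1) *v v) + v \<bullet> ((- X + (\<eta>/2) *\<^sub>R mat 1) *v v)
          = v \<bullet> ((X + (\<eta>/2) *\<^sub>R mat 1 + (- X + (\<eta>/2) *\<^sub>R mat 1)) *v v)"
        by (simp only: matrix_vector_mult_add_rdistrib inner_add_right)
      also have "X + (\<eta>/2) *\<^sub>R mat 1 + (- X + (\<eta>/2) *\<^sub>R mat 1) = (\<eta>/2 + \<eta>/2) *\<^sub>R mat 1"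
        by (simp only: scaleR_add_left) simp
      finally show ?thesis by (simp add: scaleR_matrix_vector_assoc[symmetric] dot_square_norm)
    qed
    show "norm (z1 - z2) \<le> \<kappa>"
      using norm_triangle_ineq4[of "z1 - z" "z2 - z"] zz \<kappa> by simp
    \<comment> \<open>The loss \<open>\<kappa>\<close> consists of \<open>\<kappa> / 2\<close> for
      the tilt and \<open>\<kappa> / 4\<close> each for moving from \<open>z\<close> to
      \<open>z1\<close> and to \<open>z2\<close>.\<close>
    show "f a + g a - \<kappa> \<le> f (X1 z1) - c * (norm (X1 z1 - z1))\<^sup>2 + (g (X2 z2) - c * (norm (X2 z2 - z2))\<^sup>2)"
      if a: "a \<in> Q" for a
    proof -
      have "norm (a - z) \<le> L"
        using R(2)[OF a] normz norm_triangle_ineq4[of a z] unfolding L_def by linarith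
      then have "norm (\<xi>1 z + \<xi>2 z) * norm (a - z) \<le> \<rho> * L" using z(1) \<rho>(1) by (intro mult_mono) auto
      then have "\<bar>(\<xi>1 z + \<xi>2 z) \<bullet> (a - z)\<bar> \<le> \<kappa> / 2"
        using Cauchy_Schwarz_ineq2[of "\<xi>1 z + \<xi>2 z" "a - z"] \<rho>(3) by linarith
      moreover have "f a \<le> w1 a" "g a \<le> w2 a"
        using X1(2)[OF a, of a] X2(2)[OF a, of a] by (simp_all add: w1_def w2_def)
      ultimately show ?thesis
        using z(2)[of a] zz(3,4) unfolding w1_def[of z1, symmetric] w2_def[of z2, symmetric] by linarith
    qed
    show "supconv_jet Q f c (X1 z1) z1 (X + (\<eta>/2) *\<^sub>R mat 1)"
      unfolding supconv_jet_def
      by (rule exI, rule eventually_mono[OF touch1[unfolded w1_def]]) (blast intro: order.trans X1(2))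
    show "supconv_jet Q g c (X2 z2) z2 (- X + (\<eta>/2) *\<^sub>R mat 1)"
      unfolding supconv_jet_def
      by (rule exI, rule eventually_mono[OF touch2[unfolded w2_def]]) (blast intro: order.trans X2(2))
  qed
qed

section \<open>Matrix inequalities and superjets\<close>

lemma loewner_leI:
  assumes "X \<in> sym_matrices" "Y \<in> sym_matrices" "\<And>v. v \<bullet> (X *v v) \<le> v \<bullet> (Y *v v)"
  shows "loewner_le X Y"
  using assms sym_matrices_minus[OF assms(2,1)]
  by (simp add: loewner_le_def pos_semidef_def matrix_vector_mult_diff_rdistrib inner_diff_right)

lemma inner_add_scaled_id:
  fixes X :: "real^'n^'n"
  shows "v \<bullet> ((X + r *\<^sub>R mat 1) *v v) = v \<bullet> (X *v v) + r * (norm v)\<^sup>2"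
  by (simp add: matrix_vector_mult_add_rdistrib scaleR_matrix_vector_assoc[symmetric] inner_add_right dot_square_norm)

lemma inner_matrix_le_op_norm:
  fixes X :: "real^'n^'n"
  shows "\<bar>v \<bullet> (X *v v)\<bar> \<le> op_norm X * (norm v)\<^sup>2"
proof -
  have "\<bar>v \<bullet> (X *v v)\<bar> \<le> norm v * norm (X *v v)" by (rule Cauchy_Schwarz_ineq2)
  also have "\<dots> \<le> norm v * (op_norm X * norm v)"
    unfolding op_norm_def by (intro mult_left_mono onorm matrix_vector_mul_bounded_linear) auto
  finally show ?thesis by (simp add: power2_eq_square algebra_simps)
qed

lemma norm_matrix_vector_le:
  fixes X :: "real^'n^'n"
  shows "norm (X *v v) \<le> norm X * norm v"
proof -
  have "norm (X *v v) = L2_set (\<lambda>i. norm ((X *v v) $ i)) UNIV" by (simp add: norm_vec_def)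
  also have "\<dots> \<le> L2_set (\<lambda>i. norm (X $ i) * norm v) UNIV"
  proof (rule L2_set_mono)
    fix i
    have "(X *v v) $ i = X $ i \<bullet> v" by (simp add: matrix_vector_mult_def inner_vec_def)
    then show "norm ((X *v v) $ i) \<le> norm (X $ i) * norm v"
      using Cauchy_Schwarz_ineq2[of "X $ i" v] by simp
  qed simp
  also have "\<dots> = norm X * norm v" by (simp add: L2_set_left_distrib norm_vec_def)
  finally show ?thesis .
qed

lemma inner_matrix_le_norm:
  fixes X :: "real^'n^'n"
  shows "\<bar>v \<bullet> (X *v v)\<bar> \<le> norm X * (norm v)\<^sup>2"
proof -
  have "\<bar>v \<bullet> (X *v v)\<bar> \<le> norm v * norm (X *v v)" by (rule Cauchy_Schwarz_ineq2)
  also have "\<dots> \<le> norm v * (norm X * norm v)" by (intro mult_left_mono norm_matrix_vector_le) auto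
  finally show ?thesis by (simp add: power2_eq_square algebra_simps)
qed

lemma matrix_inv_eqI:
  fixes A B :: "real^'n^'n"
  assumes "A ** B = mat 1" "B ** A = mat 1"
  shows "matrix_inv A = B"
proof -
  have "A ** matrix_inv A = mat 1 \<and> matrix_inv A ** A = mat 1"
    unfolding matrix_inv_def by (rule someI[of _ B]) (use assms in simp)
  then have "matrix_inv A = (B ** A) ** matrix_inv A \<and> A ** matrix_inv A = mat 1" using assms by simp
  then show ?thesis by (metis matrix_mul_assoc matrix_mul_rid)
qed

text \<open>With \<open>B = (I + \<delta> H)\<inverse>\<close> and \<open>Y = H B\<close> one has \<open>I - \<delta> Y = B\<close>. The last inequality says
  that a superjet of the sup-convolution with matrix \<open>H\<close> yields, along the displacements \<open>B k\<close>,
  a superjet of the original function with matrix \<open>Y\<close>.\<close>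

lemma perturbation_preimage:
  fixes H :: "real^'n^'n"
  assumes H: "H \<in> sym_matrices" and low: "\<And>v. - (2 * c) * (norm v)\<^sup>2 \<le> v \<bullet> (H *v v)"
    and c: "0 < c" and \<delta>: "0 \<le> \<delta>" "8 * c * \<delta> \<le> 1"
  obtains Y B where "Y \<in> sym_matrices" "\<delta> * op_norm Y < 1" "Y ** matrix_inv (mat 1 - \<delta> *\<^sub>R Y) = H"
    "\<And>k. (B *v k) \<bullet> (H *v (B *v k)) + 2 * c * (norm (k - B *v k))\<^sup>2 \<le> k \<bullet> (Y *v k)"
proof -
  define C where "C = mat 1 + \<delta> *\<^sub>R H"
  have Cv: "C *v u = u + \<delta> *\<^sub>R (H *v u)" for u
    by (simp add: C_def matrix_vector_mult_add_rdistrib scaleR_matrix_vector_assoc[symmetric])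
  \<comment> \<open>So \<open>\<delta> H\<close> is bounded below by -1/4, which makes
    \<open>C\<close> injective with a margin; the margin is needed again for the strict bound on
    \<open>op_norm Y\<close>.\<close>
  have low': "- (norm u)\<^sup>2 / 4 \<le> \<delta> * (u \<bullet> (H *v u))" for u
  proof -
    have "(2 * c * \<delta>) * (norm u)\<^sup>2 \<le> (1/4) * (norm u)\<^sup>2" using \<delta> by (intro mult_right_mono) auto
    moreover have "\<delta> * (- (2 * c) * (norm u)\<^sup>2) \<le> \<delta> * (u \<bullet> (H *v u))" by (intro mult_left_mono low \<delta>)
    ultimately show ?thesis by (simp add: algebra_simps)
  qed
  have norm_C: "(norm (C *v u))\<^sup>2 \<ge> (norm u)\<^sup>2 / 2 + (norm (\<delta> *\<^sub>R (H *v u)))\<^sup>2" for u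
  proof -
    have "(norm (C *v u))\<^sup>2 = (norm u)\<^sup>2 + 2 * (\<delta> * (u \<bullet> (H *v u))) + (norm (\<delta> *\<^sub>R (H *v u)))\<^sup>2"
      unfolding Cv dot_square_norm[symmetric] by (simp add: inner_simps inner_commute)
    then show ?thesis using low'[of u] by simp
  qed
  have "invertible C"
  proof -
    have "u = 0" if "C *v u = 0" for u
    proof -
      have "(norm u)\<^sup>2 / 2 + (norm (\<delta> *\<^sub>R (H *v u)))\<^sup>2 \<le> 0" using norm_C[of u] that by simp
      then have "(norm u)\<^sup>2 \<le> 0" using zero_le_power2[of "norm (\<delta> *\<^sub>R (H *v u))"] by linarith
      then show ?thesis by simp
    qed
    then show ?thesis by (simp add: invertible_left_inverse matrix_left_invertible_ker)
  qed
  then obtain B where CB: "C ** B = mat 1" and BC: "B ** C = mat 1"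
    unfolding invertible_def by blast
  have commCH: "C ** H = H ** C"
  proof (rule matrix_eq[THEN iffD2], rule allI)
    fix k
    show "(C ** H) *v k = (H ** C) *v k"
      by (simp add: matrix_vector_mul_assoc[symmetric] Cv matrix_vector_right_distrib matrix_vector_mult_scaleR)
  qed
  have HB: "H ** B = B ** H"
  proof -
    have "H ** B = B ** (C ** H) ** B" by (simp add: matrix_mul_assoc BC)
    also have "\<dots> = B ** H ** (C ** B)" unfolding commCH by (simp add: matrix_mul_assoc)
    finally show ?thesis by (simp add: CB)
  qed
  have symC: "transpose C = C"
    using sym_matrices_add[OF sym_matrices_scaled_id[of 1], of "\<delta> *\<^sub>R H"] H
    by (simp add: C_def sym_matrices_def transpose_def vec_eq_iff)
  have symB: "transpose B = B"
  proof -
    have "transpose B ** C = mat 1" by (metis CB matrix_transpose_mul symC transpose_mat)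
    then have "transpose B = mat 1 ** B" by (metis CB matrix_mul_assoc matrix_mul_rid)
    then show ?thesis by simp
  qed
  define Y where "Y = H ** B"
  have Bk: "B *v k + \<delta> *\<^sub>R (H *v (B *v k)) = k" for k
    using Cv[of "B *v k"] CB by (metis matrix_vector_mul_assoc matrix_vector_mul_lid)
  have Yk: "Y *v k = H *v (B *v k)" for k by (simp add: Y_def matrix_vector_mul_assoc)
  have inv: "mat 1 - \<delta> *\<^sub>R Y = B"
  proof (rule matrix_eq[THEN iffD2], rule allI)
    fix k
    have "(mat 1 - \<delta> *\<^sub>R Y) *v k = k - \<delta> *\<^sub>R (H *v (B *v k))"
      by (simp add: matrix_vector_mult_diff_rdistrib scaleR_matrix_vector_assoc[symmetric] Yk)
    then show "(mat 1 - \<delta> *\<^sub>R Y) *v k = B *v k" using Bk[of k] by (simp add: algebra_simps)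
  qed
  show ?thesis
  proof (rule that)
    show "Y \<in> sym_matrices"
      using H HB symB by (simp add: sym_matrices_def Y_def matrix_transpose_mul)
    have "matrix_inv B = C" by (rule matrix_inv_eqI[OF BC CB])
    then show "Y ** matrix_inv (mat 1 - \<delta> *\<^sub>R Y) = H"
      unfolding inv by (simp add: Y_def matrix_mul_assoc[symmetric] BC)
    \<comment> \<open>With \<open>u = B k\<close> one has \<open>k - u = \<delta> H u\<close>. The
      penalty is thus \<open>2 * c * \<delta>\<^sup>2 * (norm (H *v u))\<^sup>2\<close>, which is
      absorbed by the surplus \<open>\<delta> * (norm (H *v u))\<^sup>2\<close> of the form of
      \<open>Y\<close> at \<open>k\<close> over that of \<open>H\<close> at
      \<open>u\<close>.\<close>
    show "(B *v k) \<bullet> (H *v (B *v k)) + 2 * c * (norm (k - B *v k))\<^sup>2 \<le> k \<bullet> (Y *v k)" for k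
    proof -
      define u where "u = B *v k"
      have ku: "k = u + \<delta> *\<^sub>R (H *v u)" using Bk[of k] by (simp add: u_def)
      have "2 * c * (norm (k - u))\<^sup>2 = (2 * c * \<delta>) * (\<delta> * (norm (H *v u))\<^sup>2)"
        unfolding ku using \<delta> by (simp add: power_mult_distrib) (simp add: power2_eq_square)
      also have "\<dots> \<le> 1 * (\<delta> * (norm (H *v u))\<^sup>2)" using \<delta> by (intro mult_right_mono) auto
      finally have "2 * c * (norm (k - u))\<^sup>2 \<le> \<delta> * (norm (H *v u))\<^sup>2" by simp
      moreover have "k \<bullet> (Y *v k) = u \<bullet> (H *v u) + \<delta> * (norm (H *v u))\<^sup>2"
        unfolding Yk u_def[symmetric] by (subst ku) (simp add: inner_add_left dot_square_norm)
      ultimately show ?thesis by (simp add: u_def)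
    qed
    define L where "L = 1 + norm (\<delta> *\<^sub>R H)"
    have L: "0 < L" by (simp add: L_def add_pos_nonneg)
    \<comment> \<open>A contraction factor independent of \<open>k\<close>, since the strict
      inequality has to survive the supremum in the operator norm. It results from
      \<open>norm_C\<close> and the bound of \<open>\<delta> H\<close> by \<open>L\<close>.\<close>
    define q where "q = 1 / sqrt (1 + 1 / (2 * L\<^sup>2))"
    have big: "1 < 1 + 1 / (2 * L\<^sup>2)" using L by simp
      have "1 < sqrt (1 + 1 / (2 * L\<^sup>2))" using big by (simp only: real_sqrt_gt_1_iff)
    moreover from this have m0: "0 < sqrt (1 + 1 / (2 * L\<^sup>2))" by linarith
    ultimately have q: "q < 1" "0 < q" unfolding q_def by (simp_all only: divide_less_eq_1_pos zero_less_divide_1_iff)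
    have "norm (\<delta> *\<^sub>R (Y *v k)) \<le> q * norm k" for k
    proof -
      define u where "u = B *v k"
      define a where "a = norm (\<delta> *\<^sub>R (H *v u))"
      have "norm ((\<delta> *\<^sub>R H) *v u) \<le> norm (\<delta> *\<^sub>R H) * norm u" by (rule norm_matrix_vector_le)
      also have "\<dots> \<le> L * norm u" by (intro mult_right_mono) (auto simp: L_def)
      finally have "a \<le> L * norm u" by (simp add: a_def scaleR_matrix_vector_assoc[symmetric])
      then have "a\<^sup>2 \<le> L\<^sup>2 * (norm u)\<^sup>2" using power_mono[of a "L * norm u" 2] by (simp add: a_def power_mult_distrib)
      then have "a\<^sup>2 * (1 / (2 * L\<^sup>2)) \<le> (norm u)\<^sup>2 / 2" using L by (simp add: field_simps)
      moreover have "(norm u)\<^sup>2 / 2 + a\<^sup>2 \<le> (norm k)\<^sup>2" using norm_C[of u] Bk[of k] by (simp add: a_def u_def Cv)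
      ultimately have "a\<^sup>2 * (1 + 1 / (2 * L\<^sup>2)) \<le> (norm k)\<^sup>2" by (simp add: distrib_left)
      then have "sqrt (a\<^sup>2 * (1 + 1 / (2 * L\<^sup>2))) \<le> norm k" by (simp add: real_le_lsqrt)
      then have "a * sqrt (1 + 1 / (2 * L\<^sup>2)) \<le> norm k" by (simp add: real_sqrt_mult a_def)
      then have "a \<le> q * norm k" by (simp only: q_def pos_le_divide_eq[OF m0] times_divide_eq_left mult_1)
      then show ?thesis by (simp add: a_def u_def Yk)
    qed
    then have "onorm (\<lambda>k. \<delta> *\<^sub>R (Y *v k)) \<le> q" by (intro onorm_le)
    moreover have "onorm (\<lambda>k. \<delta> *\<^sub>R (Y *v k)) = \<delta> * op_norm Y"
      using onorm_scaleR[OF matrix_vector_mul_bounded_linear[of Y], of \<delta>] \<delta> by (simp add: op_norm_def)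
    ultimately show "\<delta> * op_norm Y < 1" using q by linarith
  qed
qed

section \<open>From superjets of a sup-convolution to superjets of the function\<close>

lemma supconv_jet_lower_bound:
  assumes jet: "supconv_jet Q f c x z H" and x: "x \<in> Q"
  shows "- (2 * c) * (norm v)\<^sup>2 \<le> v \<bullet> (H *v v)"
proof -
  define k where "k = f x"
  obtain p d where d: "0 < d" and le: "\<And>\<zeta>. dist \<zeta> z < d \<Longrightarrow> k - c * (norm (x - \<zeta>))\<^sup>2
       \<le> k - c * (norm (x - z))\<^sup>2 + p \<bullet> (\<zeta> - z) + (\<zeta> - z) \<bullet> (H *v (\<zeta> - z)) / 2"
    using jet x unfolding supconv_jet_def eventually_nhds_metric k_def by blast
  \<comment> \<open>Inserting \<open>x' = x\<close> into the jet puts a paraboloid of second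
    derivative \<open>- 2 * c\<close> below it; adding the inequalities for \<open>h\<close> and
    \<open>- h\<close> cancels the slopes.\<close>
  have small: "- (2 * c) * (norm h)\<^sup>2 \<le> h \<bullet> (H *v h)" if "norm h < d" for h
  proof -
    have "(2 * c) *\<^sub>R (x - z) \<bullet> h - c * (norm h)\<^sup>2 \<le> p \<bullet> h + h \<bullet> (H *v h) / 2"
      if "norm h < d" for h
      using le[of "z + h"] that paraboloid_slope_identity[of k c x "z + h" z] by (simp add: dist_norm)
    from this[OF that] this[of "- h"] that
    have "- c * (norm h)\<^sup>2 \<le> h \<bullet> (H *v h) / 2"
      using matrix_vector_mult_scaleR[of H "-1" h] by simp
    then show ?thesis by simp
  qed
  define N where "N = norm v + 1"
  have N: "0 < N" by (simp add: N_def add_nonneg_pos)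
  define t where "t = d / (2 * N)"
  have t: "0 < t" using d N by (simp add: t_def)
  have "norm (t *\<^sub>R v) < d"
  proof -
    have "t * norm v \<le> t * N" using t by (intro mult_left_mono) (auto simp: N_def)
    also have "\<dots> = d / 2" using N by (simp add: t_def)
    finally show ?thesis using d t by simp
  qed
  from small[OF this] have "t\<^sup>2 * (- (2 * c) * (norm v)\<^sup>2) \<le> t\<^sup>2 * (v \<bullet> (H *v v))"
    by (simp add: matrix_vector_mult_scaleR power_mult_distrib power2_eq_square algebra_simps)
  then show ?thesis using t by (simp only: mult_le_cancel_left_pos zero_less_power)
qed

text \<open>The jet at \<open>z\<close> is tested at \<open>z + B k\<close> against the point
  \<open>x + k\<close>. For \<open>B = mat 1\<close> both points move in parallel and
  \<open>Y = H\<close> is admissible; other \<open>B\<close> trade some penalty for a smaller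
  matrix.\<close>

lemma supconv_jet_transfer:
  assumes jet: "supconv_jet Q f c x z H"
    and B: "\<And>k. (B *v k) \<bullet> (H *v (B *v k)) + 2 * c * (norm (k - B *v k))\<^sup>2 \<le> k \<bullet> (Y *v k)"
  obtains q where "\<forall>\<^sub>F x' in nhds x. x' \<in> Q \<longrightarrow> f x' \<le> f x + q \<bullet> (x' - x) + (x' - x) \<bullet> (Y *v (x' - x)) / 2"
proof -
  obtain p where touch: "\<forall>\<^sub>F \<zeta> in nhds z. \<forall>x'\<in>Q. f x' - c * (norm (x' - \<zeta>))\<^sup>2
       \<le> f x - c * (norm (x - z))\<^sup>2 + p \<bullet> (\<zeta> - z) + (\<zeta> - z) \<bullet> (H *v (\<zeta> - z)) / 2"
    using jet unfolding supconv_jet_def by blast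
  \<comment> \<open>The chain rule: \<open>p\<close> pulled back through \<open>B\<close>, plus the
    derivative of the penalty.\<close>
  define q where "q = transpose B *v p + (2 * c) *\<^sub>R ((x - z) - transpose B *v (x - z))"
  have "((\<lambda>x'. z + B *v (x' - x)) \<longlongrightarrow> z + B *v (x - x)) (nhds x)"
    by (intro tendsto_intros bounded_linear.tendsto[OF matrix_vector_mul_bounded_linear]) (simp add: filterlim_ident)
  then have "filterlim (\<lambda>x'. z + B *v (x' - x)) (nhds z) (nhds x)" by simp
  from eventually_compose_filterlim[OF touch this]
  have "\<forall>\<^sub>F x' in nhds x. x' \<in> Q \<longrightarrow> f x' \<le> f x + q \<bullet> (x' - x) + (x' - x) \<bullet> (Y *v (x' - x)) / 2"
  proof eventually_elim
    case (elim x')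
    define k where "k = x' - x"
    define u where "u = B *v k"
    show ?case
    proof
      assume "x' \<in> Q"
      then have "f x' - c * (norm (x' - (z + u)))\<^sup>2 \<le> f x - c * (norm (x - z))\<^sup>2 + p \<bullet> u + u \<bullet> (H *v u) / 2"
        using elim by (simp add: u_def k_def)
      moreover have "(norm (x' - (z + u)))\<^sup>2 = (norm (x - z))\<^sup>2 + 2 * ((x - z) \<bullet> (k - u)) + (norm (k - u))\<^sup>2"
      proof -
        have "x' - (z + u) = (x - z) + (k - u)" by (simp add: k_def)
        then show ?thesis by (simp only: dot_square_norm[symmetric] inner_add_left inner_add_right) (simp add: inner_commute)
      qed
      then have "c * (norm (x' - (z + u)))\<^sup>2 = c * (norm (x - z))\<^sup>2 + 2 * c * ((x - z) \<bullet> (k - u)) + c * (norm (k - u))\<^sup>2"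
        by (simp only: distrib_left mult.assoc mult.left_commute)
      moreover have "q \<bullet> k = p \<bullet> u + 2 * c * ((x - z) \<bullet> (k - u))"
      proof -
        have "(transpose B *v w) \<bullet> k = w \<bullet> u" for w
          by (simp add: u_def dot_lmul_matrix transpose_matrix_vector)
        then show ?thesis by (simp add: q_def inner_simps algebra_simps)
      qed
      moreover have "u \<bullet> (H *v u) + 2 * c * (norm (k - u))\<^sup>2 \<le> k \<bullet> (Y *v k)" unfolding u_def by (rule B)
      ultimately show "f x' \<le> f x + q \<bullet> (x' - x) + (x' - x) \<bullet> (Y *v (x' - x)) / 2"
        unfolding k_def[symmetric] by linarith
    qed
  qed
  then show ?thesis by (rule that)
qed

lemma quadratic_C2:
  fixes x0 q :: "real^'n" and a :: real and Y :: "real^'n^'n"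
  assumes Y: "Y \<in> sym_matrices"
  defines "\<phi> \<equiv> \<lambda>x. a + q \<bullet> (x - x0) + (x - x0) \<bullet> (Y *v (x - x0)) / 2"
  shows "C2_near \<phi> x0" and "hessian \<phi> x = Y"
proof -
  have d1: "(\<phi> has_derivative (\<lambda>h. (q + Y *v (x - x0)) \<bullet> h)) (at x)" for x
  proof -
    have "(\<phi> has_derivative (\<lambda>h. q \<bullet> h + ((x - x0) \<bullet> (Y *v h) + h \<bullet> (Y *v (x - x0))) / 2)) (at x)"
      unfolding \<phi>_def
      by (auto intro!: derivative_eq_intros bounded_linear.has_derivative[OF matrix_vector_mul_bounded_linear])
    moreover have "q \<bullet> h + ((x - x0) \<bullet> (Y *v h) + h \<bullet> (Y *v (x - x0))) / 2 = (q + Y *v (x - x0)) \<bullet> h" for h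
      using inner_sym_matrix[OF Y, of "x - x0" h] by (simp add: inner_add_left inner_add_right inner_commute)
    ultimately show ?thesis by simp
  qed
  have grad: "gradient \<phi> = (\<lambda>x. q + Y *v (x - x0))"
  proof
    fix x
    show "gradient \<phi> x = q + Y *v (x - x0)"
      unfolding gradient_def frechet_derivative_at[OF d1, symmetric] vec_eq_iff
      by (simp add: inner_axis)
  qed
  have d2: "(gradient \<phi> has_derivative (\<lambda>h. Y *v h)) (at x)" for x
    unfolding grad
    by (auto intro!: derivative_eq_intros bounded_linear.has_derivative[OF matrix_vector_mul_bounded_linear])
  have hess: "hessian \<phi> = (\<lambda>x. Y)"
    unfolding hessian_def jacobian_def frechet_derivative_at[OF d2, symmetric] by simp
  show "hessian \<phi> x = Y" by (simp add: hess)
  show "C2_near \<phi> x0"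
    unfolding C2_near_def hess
    by (intro exI[of _ UNIV]) (auto simp: differentiable_def intro: d1 d2)
qed

section \<open>Frontiers of upward closed sets and the gap between \<open>\<Theta>\<^sub>+\<close>
  and \<open>\<Theta>\<^sub>-\<close>\<close>

lemma loewner_le_add_scaled_id:
  assumes "X \<in> sym_matrices" "Y \<in> sym_matrices" "norm (Y - X) \<le> r"
  shows "loewner_le (X - r *\<^sub>R mat 1) Y" "loewner_le Y (X + r *\<^sub>R mat 1)"
proof -
  have *: "\<bar>v \<bullet> (Y *v v) - v \<bullet> (X *v v)\<bar> \<le> r * (norm v)\<^sup>2" for v
    using inner_matrix_le_norm[of v "Y - X"] mult_right_mono[OF assms(3), of "(norm v)\<^sup>2"]
    by (simp add: matrix_vector_mult_diff_rdistrib inner_diff_right)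
  have "v \<bullet> ((X - r *\<^sub>R mat 1) *v v) = v \<bullet> (X *v v) - r * (norm v)\<^sup>2" for v
    using inner_add_scaled_id[of v X "-r"] by simp
  then show "loewner_le (X - r *\<^sub>R mat 1) Y"
    using * assms by (intro loewner_leI sym_matrices_minus sym_matrices_scaled_id) (auto simp: abs_le_iff algebra_simps)
  show "loewner_le Y (X + r *\<^sub>R mat 1)"
  proof (rule loewner_leI)
    show "v \<bullet> (Y *v v) \<le> v \<bullet> ((X + r *\<^sub>R mat 1) *v v)" for v
      using *[of v] unfolding inner_add_scaled_id by linarith
  qed (use assms in \<open>auto intro: sym_matrices_add sym_matrices_scaled_id\<close>)
qed

lemma norm_mat_1_pos: "0 < norm (mat 1 :: real^'n^'n)"
proof -
  have "(mat 1 :: real^'n^'n) $ undefined $ undefined \<noteq> 0" by (simp add: mat_def)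
  then show ?thesis by (metis zero_less_norm_iff zero_index)
qed

text \<open>Far down, the line through \<open>X\<close> in direction of the identity lies below any
  given symmetric matrix, in particular below one outside \<open>S\<close>; so it leaves
  \<open>S\<close>, and the infimum of its parameters in \<open>S\<close> marks a frontier
  point.\<close>

lemma upward_closed_frontier_on_line:
  fixes S :: "(real^'n^'n) set"
  assumes up: "\<And>X Y. X \<in> S \<Longrightarrow> Y \<in> sym_matrices \<Longrightarrow> loewner_le X Y \<Longrightarrow> Y \<in> S"
    and sub: "S \<subseteq> sym_matrices" and X: "X \<in> S" and ne: "S \<noteq> sym_matrices"
  obtains r where "r \<le> 0" "X + r *\<^sub>R mat 1 \<in> sym_frontier S"
proof -
  define A where "A r = X + r *\<^sub>R mat 1" for r
  have symA: "A r \<in> sym_matrices" for r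
    using X sub unfolding A_def by (intro sym_matrices_add sym_matrices_scaled_id) auto
  have monoA: "loewner_le (A r) (A t)" if "r \<le> t" for r t
    using that symA[unfolded A_def] unfolding A_def
    by (intro loewner_leI) (auto simp: inner_add_scaled_id mult_right_mono)
  obtain Z where Z: "Z \<in> sym_matrices" "Z \<notin> S" using ne sub by blast
  define R where "R = {r. A r \<in> S}"
  have R0: "0 \<in> R" using X by (simp add: R_def A_def)
  have Rup: "t \<in> R" if "r \<in> R" "r \<le> t" for r t
    using up[of "A r" "A t"] symA monoA that by (auto simp: R_def)
  have bdd: "- norm (Z - X) \<le> r" if "r \<in> R" for r
  proof (rule ccontr)
    assume "\<not> ?thesis"
    then have "A (- norm (Z - X)) \<in> S" using Rup[OF that, of "- norm (Z - X)"] by (simp add: R_def)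
    moreover have "loewner_le (A (- norm (Z - X))) Z"
      using loewner_le_add_scaled_id(1)[of X Z "norm (Z - X)"] X sub Z by (auto simp: A_def)
    ultimately show False using up Z by blast
  qed
  define r0 where "r0 = Inf R"
  have "bdd_below R" using bdd by (auto simp: bdd_below_def)
  then have r0_le: "r0 \<le> r" if "r \<in> R" for r unfolding r0_def using that by (rule cInf_lower[rotated])
  have above: "r \<in> R" if r: "r0 < r" for r
  proof -
    have "R \<noteq> {}" using R0 by blast
    from cInf_lessD[OF this] obtain t where "t \<in> R" "t < r" using r unfolding r0_def by blast
    then show ?thesis using Rup by auto
  qed
  have "A r0 \<in> sym_frontier S"
    unfolding sym_frontier_def frontier_of_def
  proof (rule DiffI)
    \<comment> \<open>Every relative neighbourhood of \<open>A r0\<close> contains a piece of the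
      line on both sides: the part above \<open>r0\<close> lies in \<open>S\<close>, the part below
      does not.\<close>
    have near: "\<exists>e>0. \<forall>t. \<bar>t\<bar> \<le> e \<longrightarrow> A (r0 + t) \<in> T" if T: "openin (top_of_set sym_matrices) T" "A r0 \<in> T" for T
    proof -
      obtain e where e: "0 < e" "\<And>Y. Y \<in> sym_matrices \<Longrightarrow> dist Y (A r0) < e \<Longrightarrow> Y \<in> T"
        using T unfolding openin_euclidean_subtopology_iff by blast
      define m where "m = norm (mat 1 :: real^'n^'n)"
      have m: "0 < m" unfolding m_def by (rule norm_mat_1_pos)
      define d where "d = e / (2 * m)"
      have d: "0 < d" using e(1) m by (simp add: d_def)
      have "A (r0 + t) \<in> T" if t: "\<bar>t\<bar> \<le> d" for t
      proof (rule e(2)[OF symA])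
        have "dist (A (r0 + t)) (A r0) = \<bar>t\<bar> * m"
          by (simp add: dist_norm A_def scaleR_add_left m_def)
        also have "\<dots> \<le> d * m" using t m by (intro mult_right_mono) auto
        also have "\<dots> < e" using e(1) m by (simp add: d_def)
        finally show "dist (A (r0 + t)) (A r0) < e" .
      qed
      then show ?thesis using d by blast
    qed
    show "A r0 \<in> top_of_set sym_matrices closure_of S"
      unfolding in_closure_of
    proof (intro conjI allI impI)
      show "A r0 \<in> topspace (top_of_set sym_matrices)" using symA by simp
      fix T assume "A r0 \<in> T \<and> openin (top_of_set sym_matrices) T"
      then obtain e where "0 < e" "A (r0 + e) \<in> T" using near[of T] abs_of_pos by fastforce
      moreover have "A (r0 + e) \<in> S" using above[of "r0 + e"] \<open>0 < e\<close> by (simp add: R_def)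
      ultimately show "\<exists>y. y \<in> S \<and> y \<in> T" by blast
    qed
    show "A r0 \<notin> top_of_set sym_matrices interior_of S"
    proof
      assume "A r0 \<in> top_of_set sym_matrices interior_of S"
      then obtain T where T: "openin (top_of_set sym_matrices) T" "A r0 \<in> T" "T \<subseteq> S"
        unfolding interior_of_def by blast
      obtain e where e: "0 < e" "\<And>t. \<bar>t\<bar> \<le> e \<Longrightarrow> A (r0 + t) \<in> T" using near[OF T(1,2)] by blast
      have "A (r0 + - e) \<in> T" using e(1) by (intro e(2)) simp
      then have "r0 - e \<in> R" using T(3) by (auto simp: R_def)
      then have "r0 \<le> r0 - e" by (rule r0_le)
      then show False using e(1) by simp
    qed
  qed
  then show ?thesis using that[of r0] r0_le[OF R0] by (simp add: A_def)
qed

text \<open>Otherwise a frontier point \<open>Z\<close> of \<open>\<Theta>\<^sub>+\<close> on the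
  line below \<open>X\<close> would have a whole ball of radius \<open>s\<close> below
  \<open>X + s I\<close>, hence inside \<open>\<Theta>\<^sub>-\<close>. But \<open>Z\<close> is also
  a frontier point of \<open>\<Theta>\<^sub>-\<close>.\<close>

lemma not_Theta_minus_if_Theta_plus_shift:
  fixes F :: "real^'n^'n \<Rightarrow> real^'n \<Rightarrow> ereal"
  assumes ell: "elliptic_at_0 \<Omega> F" and x: "x \<in> \<Omega>"
    and fr: "sym_frontier (Theta_plus F x) = sym_frontier (Theta_minus F x)"
    and ne: "sym_frontier (Theta_plus F x) \<noteq> {}"
    and X: "X \<in> Theta_plus F x" and s: "0 < s"
  shows "X + s *\<^sub>R mat 1 \<notin> Theta_minus F x"
proof
  assume Xs: "X + s *\<^sub>R mat 1 \<in> Theta_minus F x"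
  have symX: "X \<in> sym_matrices" using X by (simp add: Theta_plus_def)
  have "Theta_plus F x \<noteq> sym_matrices"
  proof
    assume eq: "Theta_plus F x = sym_matrices"
    have "sym_frontier (Theta_plus F x) = {}"
      unfolding eq sym_frontier_def using frontier_of_topspace[of "top_of_set sym_matrices"] by simp
    with ne show False by simp
  qed
  moreover have "Y \<in> Theta_plus F x" if "Z \<in> Theta_plus F x" "Y \<in> sym_matrices" "loewner_le Z Y" for Y Z
    using ell x that unfolding elliptic_at_0_def Theta_plus_def by blast
  moreover have "Theta_plus F x \<subseteq> sym_matrices" by (auto simp: Theta_plus_def)
  ultimately obtain r where r: "r \<le> 0" "X + r *\<^sub>R mat 1 \<in> sym_frontier (Theta_plus F x)"
    using upward_closed_frontier_on_line[OF _ _ X] by metis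
  define Z where "Z = X + r *\<^sub>R mat 1"
  have symZ: "Z \<in> sym_matrices" using symX unfolding Z_def by (intro sym_matrices_add sym_matrices_scaled_id)
  have "Z \<in> top_of_set sym_matrices interior_of (Theta_minus F x)"
    unfolding interior_of_def
  proof (intro CollectI exI conjI)
    show "openin (top_of_set sym_matrices) (sym_matrices \<inter> ball Z s)" by (rule openin_open_Int) simp
    show "Z \<in> sym_matrices \<inter> ball Z s" using symZ s by simp
    show "sym_matrices \<inter> ball Z s \<subseteq> Theta_minus F x"
    proof
      fix Y assume Y: "Y \<in> sym_matrices \<inter> ball Z s"
      then have "norm (Y - Z) \<le> s" by (simp add: dist_norm norm_minus_commute)
      then have le: "loewner_le Y (Z + s *\<^sub>R mat 1)" using loewner_le_add_scaled_id(2) symZ Y by blast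
      have symXs: "X + s *\<^sub>R mat 1 \<in> sym_matrices" using Xs by (simp add: Theta_minus_def)
      have "loewner_le Y (X + s *\<^sub>R mat 1)"
      proof (rule loewner_leI)
        fix v
        have "v \<bullet> (Y *v v) \<le> v \<bullet> ((Z + s *\<^sub>R mat 1) *v v)"
          using le by (simp add: loewner_le_def pos_semidef_def matrix_vector_mult_diff_rdistrib inner_diff_right)
        also have "\<dots> \<le> v \<bullet> ((X + s *\<^sub>R mat 1) *v v)"
          using r(1) by (simp add: Z_def inner_add_scaled_id mult_nonpos_nonneg)
        finally show "v \<bullet> (Y *v v) \<le> v \<bullet> ((X + s *\<^sub>R mat 1) *v v)" .
      qed (use Y symXs in auto)
      \<comment> \<open>The contrapositive of the strict half of ellipticity.\<close>
      then have "\<not> 0 < F Y x"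
        using ell x Y symXs Xs unfolding elliptic_at_0_def Theta_minus_def by (auto simp: not_less[symmetric])
      then show "Y \<in> Theta_minus F x" using Y by (simp add: Theta_minus_def)
    qed
  qed
  then have "Z \<notin> sym_frontier (Theta_minus F x)" by (simp add: sym_frontier_def frontier_of_def)
  then show False using r(2) fr by (simp add: Z_def)
qed

section \<open>Comparison\<close>

lemma usc_on_eventually_less:
  assumes "usc_on S f" "x0 \<in> S" "a \<longlonglongrightarrow> x0" "\<And>n::nat. a n \<in> S" "0 < e"
  shows "\<forall>\<^sub>F n in sequentially. f (a n) < f x0 + e"
proof -
  have "\<forall>\<^sub>F y in at x0 within S. f y < f x0 + e"
    using assms(1,2,5) by (simp add: usc_on_def)
  then obtain U where U: "open U" "x0 \<in> U" "\<And>y. y \<in> U \<Longrightarrow> y \<noteq> x0 \<Longrightarrow> y \<in> S \<Longrightarrow> f y < f x0 + e"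
    unfolding eventually_at_topological by blast
  have "\<forall>\<^sub>F n in sequentially. a n \<in> U" using topological_tendstoD[OF assms(3) U(1,2)] .
  then show ?thesis
  proof eventually_elim
    case (elim n)
    then show ?case using U(3)[of "a n"] assms(4)[of n] assms(5) by (cases "a n = x0") auto
  qed
qed

lemma viscosity_subsolution_jet:
  assumes v: "viscosity_subsolution \<Omega> F v" and x: "open \<Omega>" "x \<in> \<Omega>" and Y: "Y \<in> sym_matrices"
    and touch: "\<forall>\<^sub>F x' in nhds x. x' \<in> closure \<Omega> \<longrightarrow> v x' \<le> v x + q \<bullet> (x' - x) + (x' - x) \<bullet> (Y *v (x' - x)) / 2"
  shows "0 \<le> F Y x"
proof -
  define \<phi> where "\<phi> = (\<lambda>x'. v x + q \<bullet> (x' - x) + (x' - x) \<bullet> (Y *v (x' - x)) / 2)"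
  have "\<forall>\<^sub>F x' in nhds x. x' \<in> \<Omega>" using x by (rule eventually_nhds_in_open)
  with touch have "\<forall>\<^sub>F x' in nhds x. v x' \<le> \<phi> x'"
    unfolding \<phi>_def by eventually_elim (use closure_subset in blast)
  moreover have "C2_near \<phi> x" "hessian \<phi> x = Y" unfolding \<phi>_def by (rule quadratic_C2[OF Y])+
  moreover have "\<phi> x = v x" by (simp add: \<phi>_def)
  ultimately show ?thesis using v x(2) unfolding viscosity_subsolution_def by metis
qed

lemma viscosity_supersolution_jet:
  assumes u: "viscosity_supersolution \<Omega> F u" and x: "open \<Omega>" "x \<in> \<Omega>" and Y: "Y \<in> sym_matrices"
    and touch: "\<forall>\<^sub>F x' in nhds x. x' \<in> closure \<Omega> \<longrightarrow> u x + q \<bullet> (x' - x) + (x' - x) \<bullet> (Y *v (x' - x)) / 2 \<le> u x'"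
  shows "F Y x \<le> 0"
proof -
  define \<phi> where "\<phi> = (\<lambda>x'. u x + q \<bullet> (x' - x) + (x' - x) \<bullet> (Y *v (x' - x)) / 2)"
  have "\<forall>\<^sub>F x' in nhds x. x' \<in> \<Omega>" using x by (rule eventually_nhds_in_open)
  with touch have "\<forall>\<^sub>F x' in nhds x. \<phi> x' \<le> u x'"
    unfolding \<phi>_def by eventually_elim (use closure_subset in blast)
  moreover have "C2_near \<phi> x" "hessian \<phi> x = Y" unfolding \<phi>_def by (rule quadratic_C2[OF Y])+
  moreover have "\<phi> x = u x" by (simp add: \<phi>_def)
  ultimately show ?thesis using u x(2) unfolding viscosity_supersolution_def by metis
qed

lemma norm_sum3_squared_le:
  fixes a b d :: "'a::real_normed_vector"
  shows "(norm (a + b + d))\<^sup>2 \<le> 3 * ((norm a)\<^sup>2 + (norm b)\<^sup>2 + (norm d)\<^sup>2)"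
proof -
  have "norm (a + b + d) \<le> norm a + norm b + norm d"
    using norm_triangle_ineq[of "a + b" d] norm_triangle_ineq[of a b] by linarith
  then have "(norm (a + b + d))\<^sup>2 \<le> (norm a + norm b + norm d)\<^sup>2" by (simp add: power_mono)
  also have "\<dots> \<le> 3 * ((norm a)\<^sup>2 + (norm b)\<^sup>2 + (norm d)\<^sup>2)"
  proof -
    have "0 \<le> (norm a - norm b)\<^sup>2 + (norm a - norm d)\<^sup>2 + (norm b - norm d)\<^sup>2" by simp
    then show ?thesis by (simp add: power2_eq_square algebra_simps)
  qed
  finally show ?thesis .
qed

text \<open>A small excess puts some \<open>Z\<close> of \<open>\<Theta>\<^sub>+\<close> at
  \<open>y\<close> within \<open>s / 4\<close> of \<open>H1\<close>. With another
  \<open>s / 4\<close> from \<open>sum\<close> this gives \<open>Z \<le> (s/2) I - H2\<close>, which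
  therefore lies in \<open>\<Theta>\<^sub>+\<close>, while the jet of \<open>u\<close> puts
  \<open>s I - H2\<close> into \<open>\<Theta>\<^sub>-\<close>. The remaining gap
  \<open>s / 2\<close> is impossible.\<close>

lemma no_contact_if_excess_small:
  fixes F :: "real^'n^'n \<Rightarrow> real^'n \<Rightarrow> ereal"
  assumes op: "open \<Omega>" and ell: "elliptic_at_0 \<Omega> F"
    and fr: "sym_frontier (Theta_plus F y) = sym_frontier (Theta_minus F y)"
    and ne: "sym_frontier (Theta_plus F y) \<noteq> {}"
    and v: "viscosity_subsolution \<Omega> F v" and u: "viscosity_supersolution \<Omega> F u"
    and xy: "x \<in> \<Omega>" "y \<in> \<Omega>" and s: "0 < s" and c: "0 < c"
    and \<delta>: "0 \<le> \<delta>" "8 * c * \<delta> \<le> 1"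
    and H: "H1 \<in> sym_matrices" "H2 \<in> sym_matrices"
    and sum: "\<And>w. w \<bullet> (H1 *v w) + w \<bullet> (H2 *v w) \<le> s / 4 * (norm w)\<^sup>2"
    and jet1: "supconv_jet (closure \<Omega>) v c x z1 H1"
    and jet2: "supconv_jet (closure \<Omega>) (\<lambda>y. - u y + s / 2 * ((norm y)\<^sup>2 - K)) c y z2 H2"
  shows "\<not> excess (Theta_plus_pert F \<delta> x) (Theta_plus F y) < ennreal (s / 4)"
proof
  assume ex: "excess (Theta_plus_pert F \<delta> x) (Theta_plus F y) < ennreal (s / 4)"
  have xyQ: "x \<in> closure \<Omega>" "y \<in> closure \<Omega>" using xy closure_subset by auto
  have "- (2 * c) * (norm w)\<^sup>2 \<le> w \<bullet> (H1 *v w)" for w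
    by (rule supconv_jet_lower_bound[OF jet1 xyQ(1)])
  then obtain Y B where Y: "Y \<in> sym_matrices" "\<delta> * op_norm Y < 1" "Y ** matrix_inv (mat 1 - \<delta> *\<^sub>R Y) = H1"
    and B: "\<And>k. (B *v k) \<bullet> (H1 *v (B *v k)) + 2 * c * (norm (k - B *v k))\<^sup>2 \<le> k \<bullet> (Y *v k)"
    using perturbation_preimage[OF H(1) _ c \<delta>] by blast
  obtain q where "\<forall>\<^sub>F x' in nhds x. x' \<in> closure \<Omega> \<longrightarrow> v x' \<le> v x + q \<bullet> (x' - x) + (x' - x) \<bullet> (Y *v (x' - x)) / 2"
    using supconv_jet_transfer[OF jet1 B] by blast
  then have "0 \<le> F Y x" by (rule viscosity_subsolution_jet[OF v op xy(1) Y(1)])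
  then have "H1 \<in> Theta_plus_pert F \<delta> x" using Y unfolding Theta_plus_pert_def by blast
  then have "op_dist H1 (Theta_plus F y) \<le> excess (Theta_plus_pert F \<delta> x) (Theta_plus F y)"
    unfolding excess_def by (rule SUP_upper)
  with ex have "op_dist H1 (Theta_plus F y) < ennreal (s / 4)" by (rule le_less_trans[rotated])
  then obtain Z where Z: "Z \<in> Theta_plus F y" "op_norm (H1 - Z) < s / 4"
    unfolding op_dist_def INF_less_iff by (auto simp: ennreal_less_iff op_norm_def onorm_pos_le)
  \<comment> \<open>In the second variable the jet is transferred in parallel, so that
    \<open>H2\<close> is kept; the perturbation concerns the first variable alone.\<close>
  obtain q2 where q2: "\<forall>\<^sub>F x' in nhds y. x' \<in> closure \<Omega> \<longrightarrow> - u x' + s / 2 * ((norm x')\<^sup>2 - K)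
      \<le> - u y + s / 2 * ((norm y)\<^sup>2 - K) + q2 \<bullet> (x' - y) + (x' - y) \<bullet> (H2 *v (x' - y)) / 2"
    using supconv_jet_transfer[OF jet2, of "mat 1" H2] by auto
  define W where "W = (s / 2) *\<^sub>R mat 1 - H2"
  have W: "W \<in> sym_matrices" unfolding W_def by (intro sym_matrices_minus sym_matrices_scaled_id H)
  have Wform: "w \<bullet> (W *v w) = s / 2 * (norm w)\<^sup>2 - w \<bullet> (H2 *v w)" for w
    by (simp add: W_def matrix_vector_mult_diff_rdistrib inner_diff_right scaleR_matrix_vector_assoc[symmetric] dot_square_norm)
  have "F (W + (s / 2) *\<^sub>R mat 1) y \<le> 0"
  proof (rule viscosity_supersolution_jet[OF u op xy(2)])
    show "W + (s / 2) *\<^sub>R mat 1 \<in> sym_matrices" by (intro sym_matrices_add sym_matrices_scaled_id W)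
    show "\<forall>\<^sub>F x' in nhds y. x' \<in> closure \<Omega> \<longrightarrow> u y + (s *\<^sub>R y - q2) \<bullet> (x' - y)
        + (x' - y) \<bullet> ((W + (s / 2) *\<^sub>R mat 1) *v (x' - y)) / 2 \<le> u x'"
      using q2
    proof eventually_elim
      case (elim x')
      define k where "k = x' - y"
      have "(norm x')\<^sup>2 = (norm y)\<^sup>2 + 2 * (y \<bullet> k) + (norm k)\<^sup>2"
        unfolding dot_square_norm[symmetric] k_def by (simp add: inner_simps inner_commute)
      then have "s / 2 * ((norm x')\<^sup>2 - K) = s / 2 * ((norm y)\<^sup>2 - K) + s * (y \<bullet> k) + s / 2 * (norm k)\<^sup>2"
        by (simp add: field_simps)
      then show ?case
        using elim unfolding k_def[symmetric] inner_add_scaled_id Wform inner_diff_left inner_scaleR_left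
        by (auto simp: field_simps)
    qed
  qed
  then have "W + (s / 2) *\<^sub>R mat 1 \<in> Theta_minus F y"
    using W by (simp add: Theta_minus_def sym_matrices_add sym_matrices_scaled_id)
  moreover have "W \<in> Theta_plus F y"
  proof -
    have "loewner_le Z W"
    proof (rule loewner_leI)
      fix w
      have "w \<bullet> (Z *v w) = w \<bullet> (H1 *v w) - w \<bullet> ((H1 - Z) *v w)"
        by (simp add: matrix_vector_mult_diff_rdistrib inner_diff_right)
      also have "\<dots> \<le> w \<bullet> (H1 *v w) + s / 4 * (norm w)\<^sup>2"
        using inner_matrix_le_op_norm[of w "H1 - Z"] mult_right_mono[OF less_imp_le[OF Z(2)], of "(norm w)\<^sup>2"]
        by (auto simp: abs_le_iff)
      also have "\<dots> \<le> w \<bullet> (W *v w)" using sum[of w] unfolding Wform by (simp add: field_simps)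
      finally show "w \<bullet> (Z *v w) \<le> w \<bullet> (W *v w)" .
    qed (use Z W in \<open>auto simp: Theta_plus_def\<close>)
    then show ?thesis using ell xy(2) Z(1) W unfolding elliptic_at_0_def Theta_plus_def by blast
  qed
  ultimately show False
    using not_Theta_minus_if_Theta_plus_shift[OF ell xy(2) fr ne, of W "s / 2"] s by simp
qed

theorem theorem1p1:
  fixes \<Omega> :: "(real^'n) set"
    and F :: "real^'n^'n \<Rightarrow> real^'n \<Rightarrow> ereal"
  assumes "open \<Omega>" and "bounded \<Omega>"
    and "elliptic_at_0 \<Omega> F"
    and "\<And>x0. x0 \<in> \<Omega> \<Longrightarrow> sym_frontier (Theta_plus F x0) = sym_frontier (Theta_minus F x0)"
    and "\<And>x0. x0 \<in> \<Omega> \<Longrightarrow> sym_frontier (Theta_plus F x0) \<noteq> {}"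
    and "\<And>x0. x0 \<in> \<Omega> \<Longrightarrow>
      ((\<lambda>t. SUP (x, y)\<in>ball x0 t \<times> ball x0 t.
          excess (Theta_plus_pert F ((norm (x - y))\<^sup>2 / t) x) (Theta_plus F y)) \<longlongrightarrow> 0) (at_right 0)"
  shows "comparison_principle \<Omega> F"
  unfolding comparison_principle_def
proof (intro allI impI ballI, elim conjE, rule ccontr)
  fix v u xs
  assume v: "viscosity_subsolution \<Omega> F v" and u: "viscosity_supersolution \<Omega> F u"
    and bdry: "\<forall>x\<in>frontier \<Omega>. v x \<le> u x" and xs: "xs \<in> \<Omega>" and "\<not> v xs \<le> u xs"
  define Q where "Q = closure \<Omega>"
  have Q: "compact Q" "Q \<noteq> {}" "xs \<in> Q" using assms(2) xs closure_subset by (auto simp: Q_def)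
  obtain R where R: "0 < R" "\<And>x. x \<in> Q \<Longrightarrow> norm x \<le> R"
    using compact_imp_bounded[OF Q(1)] unfolding bounded_pos by blast
  \<comment> \<open>The quadratic perturbation has size at most \<open>s / 2 * R\<^sup>2\<close> on
    \<open>Q\<close>, half of the assumed violation at \<open>xs\<close>.\<close>
  define s where "s = (v xs - u xs) / R\<^sup>2"
  have s: "0 < s" "s / 2 * R\<^sup>2 < v xs - u xs"
    using R(1) \<open>\<not> v xs \<le> u xs\<close> by (simp_all add: s_def)
  \<comment> \<open>The Hessian \<open>s I\<close> of the added quadratic produces the strictness.
    Subtracting \<open>R\<^sup>2\<close> keeps \<open>g \<le> - u\<close> on \<open>Q\<close>, so
    the boundary inequality persists.\<close>
  define g where "g y = - u y + s / 2 * ((norm y)\<^sup>2 - R\<^sup>2)" for y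
  have uscv: "usc_on Q v" using v by (simp add: viscosity_subsolution_def Q_def)
  have uscg: "usc_on Q g"
  proof -
    have "usc_on Q (\<lambda>y. - u y)"
      using u unfolding viscosity_supersolution_def lsc_on_def usc_on_def Q_def by (simp add: minus_less_iff[of "u _"])
    then show ?thesis unfolding g_def by (rule usc_on_add_continuous) (intro continuous_intros)
  qed
  have g_le: "g y \<le> - u y" if "y \<in> Q" for y
    using R(2)[OF that] s(1) by (simp add: g_def mult_nonneg_nonpos power_mono)
  define m where "m = v xs + g xs"
  have m: "0 < m"
  proof -
    have "- (s / 2 * R\<^sup>2) \<le> s / 2 * ((norm xs)\<^sup>2 - R\<^sup>2)" using s(1) by (simp add: algebra_simps)
    then show ?thesis using s(2) unfolding m_def g_def by linarith
  qed
  define c where "c k = real (Suc k)" for k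
  have c: "0 < c k" "1 \<le> c k" for k by (simp_all add: c_def)
  \<comment> \<open>The outcome of the doubling with penalty \<open>c k\<close>, tolerance
    \<open>1 / c k\<close> and matrix defect \<open>s / 4\<close>, bundled so that the points can be
    chosen for all \<open>k\<close> at once.\<close>
  define J where "J k x y z1 z2 \<longleftrightarrow> x \<in> Q \<and> y \<in> Q \<and> norm (z1 - z2) \<le> 1 / c k \<and>
      (\<forall>a\<in>Q. v a + g a - 1 / c k \<le> v x - c k * (norm (x - z1))\<^sup>2 + (g y - c k * (norm (y - z2))\<^sup>2)) \<and>
      (\<exists>H1 H2. H1 \<in> sym_matrices \<and> H2 \<in> sym_matrices \<and>
        (\<forall>w. w \<bullet> (H1 *v w) + w \<bullet> (H2 *v w) \<le> s / 4 * (norm w)\<^sup>2) \<and>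
        supconv_jet Q v (c k) x z1 H1 \<and> supconv_jet Q g (c k) y z2 H2)" for k x y z1 z2
  have "\<exists>x y z1 z2. J k x y z1 z2" for k
  proof -
    have pos: "0 < 1 / c k" "0 < s / 4" using c s by simp_all
    obtain x y z1 z2 H1 H2 where
      "x \<in> Q" "y \<in> Q" "H1 \<in> sym_matrices" "H2 \<in> sym_matrices"
      "\<And>w. w \<bullet> (H1 *v w) + w \<bullet> (H2 *v w) \<le> s / 4 * (norm w)\<^sup>2" "norm (z1 - z2) \<le> 1 / c k"
      "\<And>a. a \<in> Q \<Longrightarrow> v a + g a - 1 / c k \<le> v x - c k * (norm (x - z1))\<^sup>2 + (g y - c k * (norm (y - z2))\<^sup>2)"
      "supconv_jet Q v (c k) x z1 H1" "supconv_jet Q g (c k) y z2 H2"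
      by (rule doubling_jets[OF Q(1,2) uscv uscg c(1) pos]) (rule that)
    then have "J k x y z1 z2" unfolding J_def by blast
    then show ?thesis by blast
  qed
  then obtain X Y Z1 Z2 where J: "\<And>k. J k (X k) (Y k) (Z1 k) (Z2 k)" by metis
  have XQ: "X k \<in> Q" "Y k \<in> Q" and Z12: "norm (Z1 k - Z2 k) \<le> 1 / c k" for k
    using J[of k] unfolding J_def by blast+
  define S where "S k = c k * ((norm (X k - Z1 k))\<^sup>2 + (norm (Y k - Z2 k))\<^sup>2)" for k
  have S0: "0 \<le> S k" for k using c[of k] by (simp add: S_def)
  have maxi: "v a + g a - 1 / c k + S k \<le> v (X k) + g (Y k)" if "a \<in> Q" for a k
    using J[of k] that unfolding J_def S_def distrib_left by force
  \<comment> \<open>The path from \<open>X k\<close> to \<open>Y k\<close> leads through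
    \<open>Z1 k\<close> and \<open>Z2 k\<close>. The middle piece is at most \<open>1 / c k\<close>,
    and so contributes \<open>c k * (1 / c k)\<^sup>2 = 1 / c k\<close>.\<close>
  have dist_le: "c k * (norm (X k - Y k))\<^sup>2 \<le> 3 * S k + 3 / c k" for k
  proof -
    have "X k - Y k = (X k - Z1 k) + (Z1 k - Z2 k) + (Z2 k - Y k)" by simp
    then have "(norm (X k - Y k))\<^sup>2 \<le> 3 * ((norm (X k - Z1 k))\<^sup>2 + (norm (Z1 k - Z2 k))\<^sup>2 + (norm (Z2 k - Y k))\<^sup>2)"
      by (metis norm_sum3_squared_le)
    then have "c k * (norm (X k - Y k))\<^sup>2 \<le> c k * (3 * ((norm (X k - Z1 k))\<^sup>2 + (norm (Z1 k - Z2 k))\<^sup>2 + (norm (Z2 k - Y k))\<^sup>2))"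
      using c[of k] by (intro mult_left_mono) auto
    also have "\<dots> = 3 * S k + 3 * (c k * (norm (Z1 k - Z2 k))\<^sup>2)"
      by (simp add: S_def norm_minus_commute algebra_simps)
    also have "c k * (norm (Z1 k - Z2 k))\<^sup>2 \<le> c k * (1 / c k)\<^sup>2"
      using c[of k] Z12[of k] by (intro mult_left_mono power_mono) auto
    also have "\<dots> = 1 / c k" using c[of k] by (simp add: power2_eq_square)
    finally show ?thesis by simp
  qed
  have c_inv: "(\<lambda>k. 1 / c k) \<longlonglongrightarrow> 0"
    unfolding c_def using LIMSEQ_inverse_real_of_nat by (simp add: inverse_eq_divide)
  obtain x0 \<sigma> where x0: "x0 \<in> Q" and \<sigma>: "strict_mono (\<sigma> :: nat \<Rightarrow> nat)" and X_lim: "(\<lambda>n. X (\<sigma> n)) \<longlonglongrightarrow> x0"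
    using Q(1) XQ(1) unfolding compact_def o_def by metis
  have c_inv\<sigma>: "(\<lambda>n. 1 / c (\<sigma> n)) \<longlonglongrightarrow> 0"
    using LIMSEQ_subseq_LIMSEQ[OF c_inv \<sigma>] by (simp add: o_def)
  have Y_lim: "(\<lambda>n. Y (\<sigma> n)) \<longlonglongrightarrow> x0"
  proof -
    obtain M1 M2 where M: "\<And>x. x \<in> Q \<Longrightarrow> v x \<le> M1" "\<And>x. x \<in> Q \<Longrightarrow> g x \<le> M2"
      using usc_on_attains_max[OF Q(1,2) uscv] usc_on_attains_max[OF Q(1,2) uscg] by blast
    define B where "B = 3 * (M1 + M2 - m + 1) + 3"
    have "(norm (X k - Y k))\<^sup>2 \<le> B * (1 / c k)" for k
    proof -
      have "1 / c k \<le> 1" using c[of k] by simp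
      then have "c k * (norm (X k - Y k))\<^sup>2 \<le> B"
        using maxi[OF Q(3), of k] M(1)[OF XQ(1)[of k]] M(2)[OF XQ(2)[of k]] dist_le[of k]
        unfolding m_def[symmetric] B_def by simp
      then show ?thesis using c[of k] by (simp add: field_simps)
    qed
    then have "\<forall>n. norm ((norm (X (\<sigma> n) - Y (\<sigma> n)))\<^sup>2) \<le> B * (1 / c (\<sigma> n))" by simp
    from Lim_null_comparison[OF always_eventually[OF this] tendsto_mult_right_zero[OF c_inv\<sigma>]]
    have "(\<lambda>n. (norm (X (\<sigma> n) - Y (\<sigma> n)))\<^sup>2) \<longlonglongrightarrow> 0" .
    then have "(\<lambda>n. X (\<sigma> n) - Y (\<sigma> n)) \<longlonglongrightarrow> 0"
      using tendsto_real_sqrt[of "\<lambda>n. (norm (X (\<sigma> n) - Y (\<sigma> n)))\<^sup>2" 0] by (simp add: tendsto_norm_zero_iff)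
    from tendsto_diff[OF X_lim this] show ?thesis by simp
  qed
  have upper: "\<forall>\<^sub>F n in sequentially. v (X (\<sigma> n)) + g (Y (\<sigma> n)) < v x0 + g x0 + e" if "0 < e" for e
    using usc_on_eventually_less[OF uscv x0 X_lim XQ(1) half_gt_zero[OF that]]
      usc_on_eventually_less[OF uscg x0 Y_lim XQ(2) half_gt_zero[OF that]]
    by eventually_elim (simp add: field_simps)
  have c_small: "\<forall>\<^sub>F n in sequentially. 1 / c (\<sigma> n) < e" if "0 < e" for e
    using order_tendstoD(2)[OF c_inv\<sigma> that] .
  \<comment> \<open>Near-maximality compared with \<open>a = x0\<close> and upper semicontinuity at
    \<open>x0\<close> leave no room for the penalty in the limit.\<close>
  have S_small: "\<forall>\<^sub>F n in sequentially. S (\<sigma> n) < e" if "0 < e" for e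
    using upper[OF half_gt_zero[OF that]] c_small[OF half_gt_zero[OF that]]
  proof eventually_elim
    case (elim n)
    then show ?case using maxi[OF x0, of "\<sigma> n"] field_sum_of_halves[of e] by linarith
  qed
  \<comment> \<open>The near-maximal values are close to \<open>m\<close> or larger, so
    \<open>v + g\<close> is positive at \<open>x0\<close>, whereas it is nonpositive on the
    boundary.\<close>
  have "x0 \<in> \<Omega>"
  proof -
    have m4: "0 < m / 4" using m by simp
    have "\<forall>\<^sub>F n in sequentially. m / 2 < v x0 + g x0"
      using upper[OF m4] c_small[OF m4]
    proof eventually_elim
      case (elim n)
      then show ?case using maxi[OF Q(3), of "\<sigma> n"] S0[of "\<sigma> n"] unfolding m_def[symmetric] by linarith
    qed
    then have "m / 2 < v x0 + g x0" by simp
    then have "\<not> v x0 \<le> u x0" using g_le[OF x0] m by linarith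
    then have "x0 \<notin> frontier \<Omega>" using bdry by blast
    then show ?thesis using x0 assms(1) by (simp add: frontier_def Q_def interior_open)
  qed
  define E where "E t = (SUP (x, y)\<in>ball x0 t \<times> ball x0 t.
          excess (Theta_plus_pert F ((norm (x - y))\<^sup>2 / t) x) (Theta_plus F y))" for t
  have "\<forall>\<^sub>F t in at_right 0. E t < ennreal (s / 4)"
    using order_tendstoD(2)[OF assms(6)[OF \<open>x0 \<in> \<Omega>\<close>], of "ennreal (s / 4)"] s(1) unfolding E_def by simp
  moreover have "\<forall>\<^sub>F t::real in at_right 0. 0 < t" by (rule eventually_at_right_less)
  ultimately have "\<forall>\<^sub>F t in at_right 0. E t < ennreal (s / 4) \<and> 0 < t" by eventually_elim simp
  then obtain t where t: "E t < ennreal (s / 4)" "0 < t"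
    using eventually_happens'[OF trivial_limit_at_right_real] by blast
  \<comment> \<open>\<open>t\<close> is fixed before the penalisation \<open>c k\<close> grows: \<open>\<delta> = |x - y|\<^sup>2 / t\<close> only has to be
    dominated by \<open>1 / c k\<close>, and \<open>c k |x - y|\<^sup>2\<close> tends to \<open>0\<close>.\<close>
  have t48: "0 < t / 48" using t(2) by simp
  have "\<forall>\<^sub>F n in sequentially. X (\<sigma> n) \<in> ball x0 t \<inter> \<Omega> \<and> Y (\<sigma> n) \<in> ball x0 t \<inter> \<Omega>"
    using topological_tendstoD[OF X_lim, of "ball x0 t \<inter> \<Omega>"] topological_tendstoD[OF Y_lim, of "ball x0 t \<inter> \<Omega>"]
      assms(1) \<open>x0 \<in> \<Omega>\<close> t(2) by (auto simp: eventually_conj_iff)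
  with S_small[OF t48] c_small[OF t48]
  have "\<forall>\<^sub>F n in sequentially. \<exists>k. X k \<in> ball x0 t \<inter> \<Omega> \<and> Y k \<in> ball x0 t \<inter> \<Omega> \<and> S k < t / 48 \<and> 1 / c k < t / 48"
    by eventually_elim blast
  then obtain k where k: "X k \<in> ball x0 t" "X k \<in> \<Omega>" "Y k \<in> ball x0 t" "Y k \<in> \<Omega>" "S k < t / 48" "1 / c k < t / 48"
    by (auto dest: eventually_happens)
  define \<delta> where "\<delta> = (norm (X k - Y k))\<^sup>2 / t"
  have \<delta>: "0 \<le> \<delta>" using t(2) by (simp add: \<delta>_def)
  \<comment> \<open>By \<open>dist_le\<close> the product
    \<open>c k * (norm (X k - Y k))\<^sup>2\<close> is below
    \<open>3 * t / 48 + 3 * t / 48 = t / 8\<close>.\<close>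
  have \<delta>c: "8 * c k * \<delta> \<le> 1"
  proof -
    have "8 * (c k * (norm (X k - Y k))\<^sup>2) \<le> t" using dist_le[of k] k(5,6) by linarith
    then show ?thesis using t(2) by (simp add: \<delta>_def divide_le_eq)
  qed
  have "excess (Theta_plus_pert F \<delta> (X k)) (Theta_plus F (Y k)) \<le> E t"
    unfolding E_def \<delta>_def
    by (rule SUP_upper2[of "(X k, Y k)"]) (use k in auto)
  then have ex: "excess (Theta_plus_pert F \<delta> (X k)) (Theta_plus F (Y k)) < ennreal (s / 4)"
    using t(1) by (rule le_less_trans)
  obtain H1 H2 where H: "H1 \<in> sym_matrices" "H2 \<in> sym_matrices"
      "\<And>w. w \<bullet> (H1 *v w) + w \<bullet> (H2 *v w) \<le> s / 4 * (norm w)\<^sup>2"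
    and jets: "supconv_jet Q v (c k) (X k) (Z1 k) H1" "supconv_jet Q g (c k) (Y k) (Z2 k) H2"
    using J[of k] unfolding J_def by blast
  have "\<not> excess (Theta_plus_pert F \<delta> (X k)) (Theta_plus F (Y k)) < ennreal (s / 4)"
    by (rule no_contact_if_excess_small[OF assms(1,3) assms(4)[OF k(4)] assms(5)[OF k(4)] v u k(2,4) s(1) c(1) \<delta> \<delta>c H
        jets[unfolded Q_def g_def]])
  with ex show False by blast
qed

end
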